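(* Let Assumptions 1 and 2 and the feasibility assumption (all stated in the context) hold. Let $\alpha_0>0$, $\theta_1\in(0,1)$, $\theta_2\in(0,1)$, $\theta_3>0$ and $\tau_0\ge0$ be constants, and let $\{x_{i,t}\}$ be the sequences generated by Algorithm 1 (described in the context) with $$\alpha_t=\frac{\alpha_0}{t^{\theta_1}},\quad \beta_t=\frac{1}{t^{\theta_2}},\quad \gamma_t=\frac{1}{t^{1-\theta_2}},\quad \xi_t=\frac{1}{t+1},\quad \delta_t=\frac{r(\mathbb{X})}{t+1},\quad \tau_t=\frac{\tau_0}{t^{\theta_3}},\qquad\forall t\in\mathbb{N}_+.$$ Then for any $T\in\mathbb{N}_+$ and any comparator sequence $y_{[T]}=(y_1,\dots,y_T)\in\mathcal{X}_T$, $$\mathbf{E}[\mathrm{Net\text{-}Reg}(\{x_{i,t}\},y_{[T]})]=\begin{cases}\mathcal{O}\big(\alpha_0T^{1-\theta_1}+T^{\theta_2}+\frac{\tau_0}{\alpha_0}T^{1+\theta_1-\theta_3}+\frac{T^{\theta_1}(1+P_T)}{\alpha_0}\big), & \theta_1<\theta_3<1+\theta_1,\\ \mathcal{O}\big(\alpha_0T^{1-\theta_1}+T^{\theta_2}+\frac{\tau_0}{\alpha_0}\log(T)+\frac{T^{\theta_1}(1+P_T)}{\alpha_0}\big), & \theta_3=1+\theta_1,\\ \mathcal{O}\big(\alpha_0T^{1-\theta_1}+T^{\theta_2}+\frac{\tau_0}{\alpha_0}+\frac{T^{\theta_1}(1+P_T)}{\alpha_0}\big), & \theta_3>1+\theta_1,\end{cases}$$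 $$\mathbf{E}[\mathrm{Net\text{-}CCV}(\{x_{i,t}\})]=\begin{cases}\mathcal{O}\big(\sqrt{\alpha_0}\,T^{1-\theta_1/2}+T^{1-\theta_2/2}+\sqrt{\tau_0}\,T^{1-\theta_3/2}\big), & \theta_1<\theta_3<1,\\ \mathcal{O}\big(\sqrt{\alpha_0}\,T^{1-\theta_1/2}+T^{1-\theta_2/2}+\sqrt{\tau_0T\log(T)}\big), & \theta_3=1,\\ \mathcal{O}\big(\sqrt{\alpha_0}\,T^{1-\theta_1/2}+T^{1-\theta_2/2}+\sqrt{\tau_0T}\big), & \theta_3>1,\end{cases}$$ where $P_T=\sum_{t=1}^{T-1}\|y_{t+1}-y_t\|$ is the path-length of $y_{[T]}$.
   Context: Setting. There are $n$ agents, $i\in[n]=\{1,\dots,n\}$, and a set $\mathbb{X}\subseteq\mathbb{R}^p$. For each $t\in\mathbb{N}_+$ and $i\in[n]$ there are a local loss function $f_{i,t}:\mathbb{X}\to\mathbb{R}$ and a local constraint function $g_{i,t}:\mathbb{X}\to\mathbb{R}^{m_i}$. Set $f_t(x)=\frac1n\sum_{j=1}^n f_{j,t}(x)$, $g_t(x)=\mathrm{col}(g_{1,t}(x),\dots,g_{n,t}(x))\in\mathbb{R}^m$, $m=\sum_i m_i$. $\|\cdot\|$ is the Euclidean norm (spectral norm for matrices), $[\cdot]_+$ is the componentwise positive part, $\mathcal{P}_{\mathbb{K}}$ is Euclidean projection onto $\mathbb{K}$, $\mathbb{B}^p$ and $\mathbb{S}^p$ are the unit ball and unit sphere of $\mathbb{R}^p$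 centered at the origin, vector inequalities are componentwise. Performance measures: $\mathrm{Net\text{-}Reg}(\{x_{i,t}\},y_{[T]})=\frac1n\sum_{i=1}^n\sum_{t=1}^T f_t(x_{i,t})-\sum_{t=1}^T f_t(y_t)$ and $\mathrm{Net\text{-}CCV}(\{x_{i,t}\})=\frac1n\sum_{i=1}^n\sum_{t=1}^T\|[g_t(x_{i,t})]_+\|$. $\mathcal{X}_T=\{(x_1,\dots,x_T): x_t\in\mathbb{X},\ g_t(x_t)\le \mathbf{0}_m\ \forall t\in[T]\}$ is the set of feasible decision sequences. Feasibility assumption (standing): for every $T\in\mathbb{N}_+$, $\mathcal{X}_T$ is non-empty, and so is the set of feasible static sequences $\{(x,\dots,x): x\in\mathbb{X},\ g_t(x)\le\mathbf{0}_m\ \forall t\in[T]\}$. Assumption 1. (i) $\mathbb{X}$ is convex and closed, and $r(\mathbb{X})\mathbb{B}^p\subseteq\mathbb{X}\subseteq R(\mathbb{X})\mathbb{B}^p$ for constants $r(\mathbb{X}),R(\mathbb{X})>0$. (ii) All $f_{i,t}$ and $g_{i,t}$ are convex (the latter componentwise), and there is a constant $F_1$ with $|f_{i,t}(x)-f_{i,t}(y)|\le F_1$ and $\|g_{i,t}(x)\|\le F_1$ for all $x,y\in\mathbb{X}$, $i$, $t$. (iii) Subgradients $\partial f_{i,t}(x)\in\mathbb{R}^p$ and $\partial g_{i,t}(x)\in\mathbb{R}^{p\times m_i}$ exist and there is a constant $F_2$ with $\|\partial f_{i,t}(x)\|\le F_2$, $\|\partial g_{i,t}(x)\|\le F_2$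 for all $x\in\mathbb{X}$, $i$, $t$. Assumption 2. For $t\in\mathbb{N}_+$, $\mathcal{G}_t=([n],\mathcal{E}_t)$ is a directed graph with mixing matrix $W_t\in\mathbb{R}^{n\times n}$ such that: (i) there is a constant $w\in(0,1)$ with $[W_t]_{ij}\ge w$ if $(j,i)\in\mathcal{E}_t$ or $i=j$, and $[W_t]_{ij}=0$ otherwise; (ii) $W_t$ is doubly stochastic; (iii) there is an integer $B>0$ such that $([n],\cup_{l=0}^{B-1}\mathcal{E}_{t+l})$ is strongly connected for every $t$. Algorithm 1. Inputs: $r(\mathbb{X})$ and non-increasing sequences $\{\alpha_t\},\{\beta_t\},\{\gamma_t\}\subseteq(0,+\infty)$, $\{\tau_t\}\subseteq[0,+\infty)$, $\{\xi_t\}\subseteq(0,1)$, $\{\delta_t\}$ with $\delta_t\in(0,r(\mathbb{X})\xi_t]$. Initialization: $x_{i,1}\in(1-\xi_1)\mathbb{X}$, $\hat x_{i,1}=x_{i,1}$, $q_{i,1}=\mathbf{0}_{m_i}$. For $t=1,2,\dots$ and each $i\in[n]$: draw $u_{i,t}$ uniformly from $\mathbb{S}^p$ (all draws over $i,t$ independent), and set $\hat\partial f_{i,t}(x_{i,t})=\frac{p}{\delta_t}\big(f_{i,t}(x_{i,t}+\delta_tu_{i,t})-f_{i,t}(x_{i,t})\big)u_{i,t}\in\mathbb{R}^p$, $\hat\partial[g_{i,t}(x_{i,t})]_+=\frac{p}{\delta_t}\,u_{i,t}\big([g_{i,t}(x_{i,t}+\delta_tu_{i,t})]_+-[g_{i,t}(x_{i,t})]_+\big)^T\in\mathbb{R}^{p\times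 m_i}$, $z_{i,t+1}=\sum_{j=1}^n[W_t]_{ij}\hat x_{j,t}$, $\hat\omega_{i,t+1}=\hat\partial f_{i,t}(x_{i,t})+\hat\partial[g_{i,t}(x_{i,t})]_+\,q_{i,t}$, $x_{i,t+1}=\mathcal{P}_{(1-\xi_{t+1})\mathbb{X}}(z_{i,t+1}-\alpha_{t+1}\hat\omega_{i,t+1})$, $q_{i,t+1}=\big[(1-\beta_{t+1}\gamma_{t+1})q_{i,t}+\gamma_{t+1}\big([g_{i,t}(x_{i,t})]_++(\hat\partial[g_{i,t}(x_{i,t})]_+)^T(x_{i,t+1}-x_{i,t})\big)\big]_+$, and $\hat x_{i,t+1}=x_{i,t+1}$ if $\|x_{i,t+1}-\hat x_{i,t}\|\ge\tau_{t+1}$, otherwise $\hat x_{i,t+1}=\hat x_{i,t}$. $\mathbf{E}$ is expectation over the random vectors $u_{i,t}$. The constants hidden in $\mathcal{O}(\cdot)$ do not depend on $T$ or on the comparator sequence; they may depend on the other problem data and algorithm parameters (including $\alpha_0,\tau_0,\theta_1,\theta_2,\theta_3$). *)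

theory Defs
  imports "HOL-Probability.Probability"
begin

text \<open>
  Conventions. Agents are the elements of a finite type \<open>'n\<close>, so \<open>n = CARD('n)\<close>; decisions live in
  \<open>real ^ 'p\<close>, so \<open>p = CARD('p)\<close>. Rounds are natural numbers \<open>t \<ge> 1\<close>; values at \<open>t = 0\<close> are never used.
  The dimension \<open>m i\<close> of a constraint function depends on the agent, hence a vector of \<open>\<real>\<^sup>m\<close>, with
  \<open>m = m i\<close>, is a function \<open>v :: nat \<Rightarrow> real\<close> of which only the entries \<open>k < m i\<close> matter, its Euclidean
  norm is \<open>L2_set v {..<m i}\<close>, and a \<open>p \<times> m i\<close> matrix is the family \<open>A :: nat \<Rightarrow> real ^ 'p\<close> of its
  columns \<open>A k\<close>, \<open>k < m i\<close>. Local functions are only ever constrained and evaluated on the set \<open>X\<close>.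
\<close>

definition spectral_norm :: "nat \<Rightarrow> (nat \<Rightarrow> 'a::real_normed_vector) \<Rightarrow> real" where
  "spectral_norm d A = (SUP c \<in> {c. L2_set c {..<d} \<le> 1}. norm (\<Sum>k<d. c k *\<^sub>R A k))"

definition subgradient_on :: "'a::real_inner set \<Rightarrow> ('a \<Rightarrow> real) \<Rightarrow> 'a \<Rightarrow> 'a \<Rightarrow> bool" where
  "subgradient_on X f x s \<longleftrightarrow> (\<forall>y\<in>X. f y \<ge> f x + s \<bullet> (y - x))"

subsection \<open>Losses, constraints and performance measures\<close>

definition global_loss :: "('n::finite \<Rightarrow> nat \<Rightarrow> 'a \<Rightarrow> real) \<Rightarrow> nat \<Rightarrow> 'a \<Rightarrow> real" where
  "global_loss f t x = (\<Sum>j\<in>UNIV. f j t x) / real CARD('n)"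

definition net_reg ::
  "('n::finite \<Rightarrow> nat \<Rightarrow> 'a \<Rightarrow> real) \<Rightarrow> nat \<Rightarrow> ('n \<Rightarrow> nat \<Rightarrow> 'a) \<Rightarrow> (nat \<Rightarrow> 'a) \<Rightarrow> real" where
  "net_reg f T x y =
     (\<Sum>i\<in>UNIV. \<Sum>t=1..T. global_loss f t (x i t)) / real CARD('n)
     - (\<Sum>t=1..T. global_loss f t (y t))"

text \<open>The stacked vector \<open>g\<^sub>t(x) = col(g\<^sub>1\<^sub>,\<^sub>t(x), \<dots>, g\<^sub>n\<^sub>,\<^sub>t(x))\<close> is indexed by the pairs \<open>(j, k)\<close> with
  \<open>k < m j\<close>.\<close>

definition global_constr ::
  "('n::finite \<Rightarrow> nat \<Rightarrow> 'a \<Rightarrow> nat \<Rightarrow> real) \<Rightarrow> nat \<Rightarrow> 'a \<Rightarrow> 'n \<times> nat \<Rightarrow> real" where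
  "global_constr g t x = (\<lambda>(j, k). g j t x k)"

definition constr_index :: "('n::finite \<Rightarrow> nat) \<Rightarrow> ('n \<times> nat) set" where
  "constr_index m = (SIGMA j:UNIV. {..<m j})"

definition net_ccv ::
  "('n::finite \<Rightarrow> nat) \<Rightarrow> ('n \<Rightarrow> nat \<Rightarrow> 'a \<Rightarrow> nat \<Rightarrow> real) \<Rightarrow> nat \<Rightarrow> ('n \<Rightarrow> nat \<Rightarrow> 'a) \<Rightarrow> real" where
  "net_ccv m g T x =
     (\<Sum>i\<in>UNIV. \<Sum>t=1..T. L2_set (\<lambda>jk. max 0 (global_constr g t (x i t) jk)) (constr_index m))
     / real CARD('n)"

text \<open>A sequence \<open>y\<^sub>1, \<dots>, y\<^sub>T\<close> is a function on \<open>nat\<close> of which only the values at \<open>1, \<dots>, T\<close> matter.\<close>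

definition feasible_seqs ::
  "'a set \<Rightarrow> ('n::finite \<Rightarrow> nat) \<Rightarrow> ('n \<Rightarrow> nat \<Rightarrow> 'a \<Rightarrow> nat \<Rightarrow> real) \<Rightarrow> nat \<Rightarrow> (nat \<Rightarrow> 'a) set" where
  "feasible_seqs X m g T =
     {y. \<forall>t\<in>{1..T}. y t \<in> X \<and> (\<forall>jk\<in>constr_index m. global_constr g t (y t) jk \<le> 0)}"

definition static_feasible_seqs ::
  "'a set \<Rightarrow> ('n::finite \<Rightarrow> nat) \<Rightarrow> ('n \<Rightarrow> nat \<Rightarrow> 'a \<Rightarrow> nat \<Rightarrow> real) \<Rightarrow> nat \<Rightarrow> (nat \<Rightarrow> 'a) set" where
  "static_feasible_seqs X m g T = {y \<in> feasible_seqs X m g T. \<exists>x. y = (\<lambda>_. x)}"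

definition feasibility ::
  "'a set \<Rightarrow> ('n::finite \<Rightarrow> nat) \<Rightarrow> ('n \<Rightarrow> nat \<Rightarrow> 'a \<Rightarrow> nat \<Rightarrow> real) \<Rightarrow> bool" where
  "feasibility X m g \<longleftrightarrow>
     (\<forall>T\<ge>1. feasible_seqs X m g T \<noteq> {} \<and> static_feasible_seqs X m g T \<noteq> {})"

definition path_length :: "(nat \<Rightarrow> 'a::real_normed_vector) \<Rightarrow> nat \<Rightarrow> real" where
  "path_length y T = (\<Sum>t=1..<T. norm (y (t + 1) - y t))"

subsection \<open>Standing assumptions\<close>

text \<open>The last two conditions ask for one bounded subgradient at each point of \<open>X\<close>. Bounding all
  subgradients of functions defined only on \<open>X\<close> would be contradictory at boundary points of \<open>X\<close>,
  where the subdifferential is unbounded.\<close>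

definition assumption1 ::
  "(real ^ 'p) set \<Rightarrow> real \<Rightarrow> real \<Rightarrow> ('n::finite \<Rightarrow> nat)
   \<Rightarrow> ('n \<Rightarrow> nat \<Rightarrow> real ^ 'p \<Rightarrow> real) \<Rightarrow> ('n \<Rightarrow> nat \<Rightarrow> real ^ 'p \<Rightarrow> nat \<Rightarrow> real)
   \<Rightarrow> real \<Rightarrow> real \<Rightarrow> bool" where
  "assumption1 X r R m f g F\<^sub>1 F\<^sub>2 \<longleftrightarrow>
     convex X \<and> closed X \<and> r > 0 \<and> R > 0 \<and> cball 0 r \<subseteq> X \<and> X \<subseteq> cball 0 R \<and>
     (\<forall>i. \<forall>t\<ge>1.
        convex_on X (f i t) \<and>
        (\<forall>k<m i. convex_on X (\<lambda>x. g i t x k)) \<and>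
        (\<forall>x\<in>X. \<forall>y\<in>X. \<bar>f i t x - f i t y\<bar> \<le> F\<^sub>1) \<and>
        (\<forall>x\<in>X. L2_set (g i t x) {..<m i} \<le> F\<^sub>1) \<and>
        (\<forall>x\<in>X. \<exists>s. subgradient_on X (f i t) x s \<and> norm s \<le> F\<^sub>2) \<and>
        (\<forall>x\<in>X. \<exists>A. (\<forall>k<m i. subgradient_on X (\<lambda>x'. g i t x' k) x (A k)) \<and>
                   spectral_norm (m i) A \<le> F\<^sub>2))"

definition doubly_stochastic :: "real ^ 'n ^ 'n \<Rightarrow> bool" where
  "doubly_stochastic A \<longleftrightarrow>
     (\<forall>i j. A $ i $ j \<ge> 0) \<and> (\<forall>i. (\<Sum>j\<in>UNIV. A $ i $ j) = 1) \<and> (\<forall>j. (\<Sum>i\<in>UNIV. A $ i $ j) = 1)"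

definition strongly_connected :: "('n \<times> 'n) set \<Rightarrow> bool" where
  "strongly_connected E \<longleftrightarrow> (\<forall>i j. (i, j) \<in> E\<^sup>*)"

definition assumption2 ::
  "(nat \<Rightarrow> ('n \<times> 'n) set) \<Rightarrow> (nat \<Rightarrow> real ^ 'n ^ 'n) \<Rightarrow> real \<Rightarrow> nat \<Rightarrow> bool" where
  "assumption2 E W w B \<longleftrightarrow>
     0 < w \<and> w < 1 \<and> B > 0 \<and>
     (\<forall>t\<ge>1.
        (\<forall>i j. if (j, i) \<in> E t \<or> i = j then W t $ i $ j \<ge> w else W t $ i $ j = 0) \<and>
        doubly_stochastic (W t) \<and>
        strongly_connected (\<Union>l<B. E (t + l)))"

subsection \<open>Sampling and the algorithm\<close>

text \<open>Normalized surface measure of the unit sphere, in the form of the cone measure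
  \<open>\<sigma>(A) = vol {s u | u \<in> A, 0 < s \<le> 1} / vol (cball 0 1)\<close>: the radial projection of the uniform
  distribution on the unit ball.\<close>

definition sphere_uniform :: "(real ^ 'p) measure" where
  "sphere_uniform = distr (uniform_measure lborel (cball 0 1)) borel (\<lambda>v. v /\<^sub>R norm v)"

text \<open>The index set of the family of independent draws is the set of all \<open>(i, t)\<close> with \<open>t \<ge> 1\<close>.\<close>

definition iid_sphere_draws ::
  "'w measure \<Rightarrow> ('n \<Rightarrow> nat \<Rightarrow> 'w \<Rightarrow> real ^ 'p) \<Rightarrow> bool" where
  "iid_sphere_draws M u \<longleftrightarrow>
     prob_space.indep_vars M (\<lambda>_. borel) (\<lambda>(i, t). u i t) (UNIV \<times> {1..}) \<and>
     (\<forall>i. \<forall>t\<ge>1. distr M borel (u i t) = sphere_uniform \<and> (\<forall>\<omega>\<in>space M. u i t \<omega> \<in> sphere 0 1))"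

definition loss_estimate ::
  "real \<Rightarrow> (real ^ 'p \<Rightarrow> real) \<Rightarrow> real ^ 'p \<Rightarrow> real ^ 'p \<Rightarrow> real ^ 'p" where
  "loss_estimate d h x v = (real CARD('p) / d) *\<^sub>R ((h (x + d *\<^sub>R v) - h x) *\<^sub>R v)"

text \<open>Column \<open>k\<close> of the estimate of the subgradient of the positive part of a constraint function.\<close>

definition constr_estimate ::
  "real \<Rightarrow> (real ^ 'p \<Rightarrow> nat \<Rightarrow> real) \<Rightarrow> real ^ 'p \<Rightarrow> real ^ 'p \<Rightarrow> nat \<Rightarrow> real ^ 'p" where
  "constr_estimate d h x v k =
     (real CARD('p) / d) *\<^sub>R ((max 0 (h (x + d *\<^sub>R v) k) - max 0 (h x k)) *\<^sub>R v)"

definition algorithm_inputs ::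
  "real \<Rightarrow> (nat \<Rightarrow> real) \<Rightarrow> (nat \<Rightarrow> real) \<Rightarrow> (nat \<Rightarrow> real) \<Rightarrow> (nat \<Rightarrow> real) \<Rightarrow> (nat \<Rightarrow> real)
   \<Rightarrow> (nat \<Rightarrow> real) \<Rightarrow> bool" where
  "algorithm_inputs r \<alpha> \<beta> \<gamma> \<tau> \<xi> \<delta> \<longleftrightarrow>
     antimono_on {1..} \<alpha> \<and> antimono_on {1..} \<beta> \<and> antimono_on {1..} \<gamma> \<and>
     antimono_on {1..} \<tau> \<and> antimono_on {1..} \<xi> \<and> antimono_on {1..} \<delta> \<and>
     (\<forall>t\<ge>1. \<alpha> t > 0 \<and> \<beta> t > 0 \<and> \<gamma> t > 0 \<and> \<tau> t \<ge> 0 \<and> 0 < \<xi> t \<and> \<xi> t < 1 \<and>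
            0 < \<delta> t \<and> \<delta> t \<le> r * \<xi> t)"

text \<open>\<open>algorithm1 \<dots> x\<^sub>1 u x x' q\<close>: with initial decisions \<open>x\<^sub>1\<close> and sampled directions \<open>u\<close>, the iterates
  are \<open>x\<close>, the last transmitted decisions \<open>x'\<close> (hatted in the algorithm) and the dual variables \<open>q\<close>.\<close>

definition algorithm1 ::
  "(real ^ 'p) set \<Rightarrow> real \<Rightarrow> ('n::finite \<Rightarrow> nat)
   \<Rightarrow> ('n \<Rightarrow> nat \<Rightarrow> real ^ 'p \<Rightarrow> real) \<Rightarrow> ('n \<Rightarrow> nat \<Rightarrow> real ^ 'p \<Rightarrow> nat \<Rightarrow> real)
   \<Rightarrow> (nat \<Rightarrow> real ^ 'n ^ 'n)
   \<Rightarrow> (nat \<Rightarrow> real) \<Rightarrow> (nat \<Rightarrow> real) \<Rightarrow> (nat \<Rightarrow> real) \<Rightarrow> (nat \<Rightarrow> real) \<Rightarrow> (nat \<Rightarrow> real) \<Rightarrow> (nat \<Rightarrow> real)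
   \<Rightarrow> ('n \<Rightarrow> real ^ 'p) \<Rightarrow> ('n \<Rightarrow> nat \<Rightarrow> real ^ 'p)
   \<Rightarrow> ('n \<Rightarrow> nat \<Rightarrow> real ^ 'p) \<Rightarrow> ('n \<Rightarrow> nat \<Rightarrow> real ^ 'p) \<Rightarrow> ('n \<Rightarrow> nat \<Rightarrow> nat \<Rightarrow> real) \<Rightarrow> bool" where
  "algorithm1 X r m f g W \<alpha> \<beta> \<gamma> \<tau> \<xi> \<delta> x\<^sub>1 u x x' q \<longleftrightarrow>
     algorithm_inputs r \<alpha> \<beta> \<gamma> \<tau> \<xi> \<delta> \<and>
     (\<forall>i. x\<^sub>1 i \<in> (*\<^sub>R) (1 - \<xi> 1) ` X \<and> x i 1 = x\<^sub>1 i \<and> x' i 1 = x i 1 \<and> (\<forall>k<m i. q i 1 k = 0)) \<and>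
     (\<forall>t\<ge>1. \<forall>i.
        let df = loss_estimate (\<delta> t) (f i t) (x i t) (u i t);
            dg = constr_estimate (\<delta> t) (g i t) (x i t) (u i t);
            z = (\<Sum>j\<in>UNIV. W t $ i $ j *\<^sub>R x' j t);
            w = df + (\<Sum>k<m i. q i t k *\<^sub>R dg k)
        in x i (t + 1) = closest_point ((*\<^sub>R) (1 - \<xi> (t + 1)) ` X) (z - \<alpha> (t + 1) *\<^sub>R w) \<and>
           (\<forall>k<m i. q i (t + 1) k =
              max 0 ((1 - \<beta> (t + 1) * \<gamma> (t + 1)) * q i t k
                     + \<gamma> (t + 1) * (max 0 (g i t (x i t) k) + dg k \<bullet> (x i (t + 1) - x i t)))) \<and>
           x' i (t + 1) = (if norm (x i (t + 1) - x' i t) \<ge> \<tau> (t + 1) then x i (t + 1) else x' i t))"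

end

theory Submission
  imports Defs
begin

text \<open>
  The one-round inequality adds the projection step of the primal update to the expansion of
  \<open>q\<^sup>2\<close> in the dual update: the products \<open>q * (dg \<bullet> (x (t + 1) - x t))\<close> cancel, the dual terms
  telescope to a nonnegative \<open>V\<close> because \<open>1 / \<gamma> t - 1 / \<gamma> (t + 1) + \<beta> (t + 1) \<ge> 0\<close>, and the projection
  errors enter with a negative square that absorbs every term linear in the disagreement of the
  agents, since products of the mixing matrices over a window of \<open>n B\<close> rounds have all entries
  at least \<open>w\<close> to the power \<open>n B\<close>. Randomness enters only through terms linear in the gradient
  estimates. Given the past, such an estimate is up to an error of order \<open>\<delta>\<close> a subgradient of a
  convex function, as the difference of two ball averages dominates the spherical average of
  \<open>h u * (u \<bullet> d)\<close>. Taking expectations gives the regret bound. With a static comparator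
  the same inequality bounds the expectation of \<open>V\<close> and of the sum of squared projection errors by
  a multiple of \<open>T\<close>; weighted AM-GM with the weights \<open>T powr (\<theta>\<^sub>2 / 2)\<close> and \<open>T powr (\<theta>\<^sub>1 / 2)\<close> then
  bounds the constraint violation.
\<close>

section \<open>Spherical averages of convex functions\<close>

text \<open>An estimate formed from two function values has norm at most the dimension times the
  Lipschitz constant, however small \<delta> is. The energy argument can therefore be run at every
  sample point with uniform bounds, and only its linear terms are averaged. A one-sided average is
  enough there: the factor in front of a constraint estimate is a dual variable, nonnegative and
  fixed before the direction is drawn. The average must not deteriorate with the distance to the
  comparator, which is large compared with \<delta>; this is why convexity along the whole segment
  is used and not a local expansion. Two features of the schedule carry the dual analysis: the
  product of \<beta> and \<gamma> is 1 / t, so the damped recursion is a convex combination, and 1 /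
  \<gamma> grows by at most \<beta> per round. The regret may be negative of order T, so V and the
  squared projection errors are controlled only up to order T; the square-root type rates of the
  violation come from balancing this linear bound.\<close>

lemma lborel_integral_scale:
  fixes g :: "'a::euclidean_space \<Rightarrow> real"
  assumes [measurable]: "g \<in> borel_measurable borel" and "c > 0"
  shows "(\<integral>v. g v \<partial>lborel) = c ^ DIM('a) * (\<integral>v. g (c *\<^sub>R v) \<partial>lborel)"
proof -
  have "(\<integral>v. g v \<partial>lborel)
      = (\<integral>v. g v \<partial>density (distr lborel borel (\<lambda>x. 0 + c *\<^sub>R x)) (\<lambda>_. ennreal (\<bar>c\<bar> ^ DIM('a))))"
    by (subst lborel_affine[of c 0]) (use \<open>c > 0\<close> in auto)
  also have "\<dots> = c ^ DIM('a) * (\<integral>v. g (c *\<^sub>R v) \<partial>lborel)"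
    using \<open>c > 0\<close> by (subst integral_density) (auto simp: integral_distr)
  finally show ?thesis .
qed

lemma lborel_integral_shift:
  fixes g :: "'a::euclidean_space \<Rightarrow> real"
  assumes [measurable]: "g \<in> borel_measurable borel"
  shows "(\<integral>v. g (c + v) \<partial>lborel) = (\<integral>v. g v \<partial>lborel)"
proof -
  have "(\<integral>v. g v \<partial>lborel) = (\<integral>v. g v \<partial>distr lborel borel ((+) c))"
    by (subst lborel_distr_plus) simp
  then show ?thesis
    by (simp add: integral_distr)
qed

lemma integrable_bounded_support:
  fixes g :: "'a::euclidean_space \<Rightarrow> real"
  assumes [measurable]: "g \<in> borel_measurable borel"
    and "\<And>v. \<bar>g v\<bar> \<le> C" and "\<And>v. norm v > r \<Longrightarrow> g v = 0"
  shows "integrable lborel g"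
proof (rule Bochner_Integration.integrable_bound)
  show "integrable lborel (\<lambda>v::'a. C * indicator (cball 0 r) v :: real)"
    using emeasure_lborel_cball_finite[of "0::'a" r]
    by (intro integrable_mult_right integrable_real_indicator) (auto simp: less_top)
  show "AE v in lborel. norm (g v) \<le> norm (C * indicator (cball 0 r) v :: real)"
    using assms(2,3) by (intro AE_I2) (auto simp: indicator_def abs_mult intro: order_trans[OF _ abs_ge_self])
qed auto

section \<open>Integration against the cone measure of the sphere\<close>

lemma sphere_uniform_integral:
  fixes \<phi> :: "real ^ 'p \<Rightarrow> real"
  assumes [measurable]: "\<phi> \<in> borel_measurable borel"
  shows "measure lborel (cball 0 1 :: (real^'p) set) * (\<integral>u. \<phi> u \<partial>sphere_uniform)
    = (\<integral>v. indicator (cball 0 1) v * \<phi> (v /\<^sub>R norm v) \<partial>lborel)"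
proof -
  let ?B = "cball 0 1 :: (real^'p) set"
  have pos: "measure lborel ?B > 0"
    by (simp add: content_cball_pos)
  have em: "emeasure lborel ?B = ennreal (measure lborel ?B)"
    using emeasure_lborel_cball_finite[of "0::real^'p" 1] by (simp add: emeasure_eq_ennreal_measure less_top[symmetric])
  have um: "uniform_measure lborel ?B = density lborel (\<lambda>v. ennreal (indicator ?B v / measure lborel ?B))"
    unfolding uniform_measure_def using pos
    by (intro arg_cong2[of _ _ _ _ density] refl ext)
       (auto simp: em indicator_def divide_ennreal simp flip: ennreal_1)
  have "(\<integral>u. \<phi> u \<partial>sphere_uniform) = (\<integral>v. \<phi> (v /\<^sub>R norm v) \<partial>uniform_measure lborel ?B)"
    unfolding sphere_uniform_def by (subst integral_distr) auto
  also have "\<dots> = (\<integral>v. indicator ?B v / measure lborel ?B * \<phi> (v /\<^sub>R norm v) \<partial>lborel)"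
    unfolding um using pos by (subst integral_density) (auto intro!: AE_I2 borel_measurable_divide borel_measurable_indicator)
  also have "\<dots> = (\<integral>v. indicator ?B v * \<phi> (v /\<^sub>R norm v) \<partial>lborel) / measure lborel ?B"
    by (simp flip: integral_divide_zero)
  finally show ?thesis using pos by simp
qed

lemma sphere_uniform_prob_space: "prob_space (sphere_uniform :: (real^'p) measure)"
proof -
  have "prob_space (uniform_measure lborel (cball 0 1 :: (real^'p) set))"
    using content_cball_pos[of 1 "0::real^'p"] emeasure_lborel_cball_finite[of "0::real^'p" 1]
    by (intro prob_space_uniform_measure) (auto simp: measure_def)
  then show ?thesis
    unfolding sphere_uniform_def by (rule prob_space.prob_space_distr) simp
qed

text \<open>A function of the direction alone does not change under dilations, so the radius enters
  only through the Jacobian. Subtracting two radii gives integrals over shells.\<close>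

lemma ball_integral_radial:
  fixes \<phi> :: "real ^ 'p \<Rightarrow> real"
  assumes [measurable]: "\<phi> \<in> borel_measurable borel" and "\<rho> > 0"
  shows "(\<integral>v. indicator (cball 0 \<rho>) v * \<phi> (v /\<^sub>R norm v) \<partial>lborel)
    = \<rho> ^ CARD('p) * (measure lborel (cball 0 1 :: (real^'p) set) * (\<integral>u. \<phi> u \<partial>sphere_uniform))"
proof -
  have *: "indicator (cball 0 \<rho>) (\<rho> *\<^sub>R v) = (indicator (cball 0 1) v :: real)" for v :: "real^'p"
    using \<open>\<rho> > 0\<close> by (auto simp: indicator_def)
  have **: "(\<rho> *\<^sub>R v) /\<^sub>R norm (\<rho> *\<^sub>R v) = v /\<^sub>R norm v" for v :: "real^'p"
    using \<open>\<rho> > 0\<close> by (simp add: field_simps)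
  have "(\<lambda>v. indicator (cball 0 \<rho>) v * \<phi> (v /\<^sub>R norm v)) \<in> borel_measurable borel"
    by (intro borel_measurable_times borel_measurable_indicator) simp_all
  then show ?thesis
    using \<open>\<rho> > 0\<close> unfolding sphere_uniform_integral[OF assms(1)]
    by (subst lborel_integral_scale[where c = \<rho>]) (simp_all only: * ** DIM_cart DIM_real mult_1_right)
qed

text \<open>The profile falls linearly from 1 to 0 across the shell between the radii
  \<open>1 - \<epsilon>\<close> and 1. Its gradient there is the inward unit normal divided by
  \<epsilon>, and zero elsewhere: the surface measure times the normal, smeared over the
  shell.\<close>

definition cutoff :: "real \<Rightarrow> 'a::real_inner \<Rightarrow> real" where
  "cutoff \<epsilon> v = min 1 (max 0 ((1 - norm v) / \<epsilon>))"

lemma cutoff_measurable [measurable]: "cutoff \<epsilon> \<in> borel_measurable (borel :: 'a::euclidean_space measure)"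
  unfolding cutoff_def by measurable

lemma cutoff_bounds: "0 \<le> cutoff \<epsilon> v" "cutoff \<epsilon> v \<le> 1"
  by (auto simp: cutoff_def)

lemma cutoff_outside: "\<epsilon> > 0 \<Longrightarrow> norm v \<ge> 1 \<Longrightarrow> cutoff \<epsilon> v = 0"
  by (simp add: cutoff_def divide_nonpos_pos)

lemma cutoff_inside: "\<epsilon> > 0 \<Longrightarrow> norm v \<le> 1 - \<epsilon> \<Longrightarrow> cutoff \<epsilon> v = 1"
  by (auto simp: cutoff_def le_divide_eq)

lemma cutoff_lipschitz:
  assumes "\<epsilon> > 0"
  shows "\<bar>cutoff \<epsilon> v - cutoff \<epsilon> w\<bar> \<le> norm (v - w) / \<epsilon>"
proof -
  have "\<bar>cutoff \<epsilon> v - cutoff \<epsilon> w\<bar> \<le> \<bar>(1 - norm v) / \<epsilon> - (1 - norm w) / \<epsilon>\<bar>"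
    unfolding cutoff_def by linarith
  also have "\<dots> = \<bar>norm w - norm v\<bar> / \<epsilon>"
    using assms by (simp add: diff_divide_distrib[symmetric])
  also have "\<dots> \<le> norm (v - w) / \<epsilon>"
    using assms norm_triangle_ineq3[of w v] by (intro divide_right_mono) (auto simp: norm_minus_commute)
  finally show ?thesis .
qed

text \<open>The two excluded radii are the kinks of the profile and form a null set. Because the
  shift is by minus \<open>d\<close>, the limit carries the outward normal with a plus sign.\<close>

lemma cutoff_difference_quotient:
  fixes v d :: "'a::euclidean_space"
  assumes "0 < \<epsilon>" "\<epsilon> < 1" "norm v \<noteq> 1" "norm v \<noteq> 1 - \<epsilon>"
  shows "(\<lambda>n. real (Suc n) * (cutoff \<epsilon> (v - d /\<^sub>R real (Suc n)) - cutoff \<epsilon> v))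
    \<longlonglongrightarrow> (if 1 - \<epsilon> < norm v \<and> norm v \<le> 1 then ((v /\<^sub>R norm v) \<bullet> d) / \<epsilon> else 0)"
proof -
  have lim: "(\<lambda>n. v - d /\<^sub>R real (Suc n)) \<longlonglongrightarrow> v"
  proof -
    have "(\<lambda>n. v - inverse (real (Suc n)) *\<^sub>R d) \<longlonglongrightarrow> v - 0 *\<^sub>R d"
      by (intro tendsto_intros LIMSEQ_inverse_real_of_nat)
    then show ?thesis by simp
  qed
  have limn: "(\<lambda>n. norm (v - d /\<^sub>R real (Suc n))) \<longlonglongrightarrow> norm v"
    by (intro tendsto_norm lim)
  consider "norm v < 1 - \<epsilon>" | "1 < norm v" | "1 - \<epsilon> < norm v" "norm v < 1"
    using assms by linarith
  then show ?thesis
  proof cases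
    case 1
    have "\<forall>\<^sub>F n in sequentially. norm (v - d /\<^sub>R real (Suc n)) < 1 - \<epsilon>"
      using limn 1 by (rule order_tendstoD)
    then have "\<forall>\<^sub>F n in sequentially. real (Suc n) * (cutoff \<epsilon> (v - d /\<^sub>R real (Suc n)) - cutoff \<epsilon> v) = 0"
      by eventually_elim (use 1 assms in \<open>simp add: cutoff_inside\<close>)
    then show ?thesis using 1 by (simp add: tendsto_eventually)
  next
    case 2
    have "\<forall>\<^sub>F n in sequentially. norm (v - d /\<^sub>R real (Suc n)) > 1"
      using limn 2 by (rule order_tendstoD)
    then have "\<forall>\<^sub>F n in sequentially. real (Suc n) * (cutoff \<epsilon> (v - d /\<^sub>R real (Suc n)) - cutoff \<epsilon> v) = 0"
      by eventually_elim (use 2 assms in \<open>simp add: cutoff_outside\<close>)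
    then show ?thesis using 2 by (simp add: tendsto_eventually)
  next
    case 3
    have v0: "v \<noteq> 0" using 3 assms by auto
    have der: "((\<lambda>s. norm (v - s *\<^sub>R d)) has_real_derivative (sgn v \<bullet> (- d))) (at 0)"
    proof -
      have "((\<lambda>s. norm (v - s *\<^sub>R d)) has_derivative (\<lambda>s. (- (s *\<^sub>R d)) \<bullet> sgn (v - 0 *\<^sub>R d))) (at 0)"
        using v0 by (intro has_derivative_compose[of "\<lambda>s::real. v - s *\<^sub>R d" _ _ _ norm, OF _ has_derivative_norm])
          (auto intro!: derivative_eq_intros)
      then show ?thesis
        by (rule has_derivative_imp_has_field_derivative) (simp add: inner_commute)
    qed
    have "(\<lambda>n. (norm (v - inverse (real (Suc n)) *\<^sub>R d) - norm v) / inverse (real (Suc n))) \<longlonglongrightarrow> sgn v \<bullet> (- d)"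
    proof -
      have "((\<lambda>h. (norm (v - h *\<^sub>R d) - norm v) / h) \<longlongrightarrow> sgn v \<bullet> (- d)) (at 0)"
        using der by (simp add: DERIV_def)
      moreover have "filterlim (\<lambda>n. inverse (real (Suc n))) (at 0) sequentially"
        unfolding filterlim_at using LIMSEQ_inverse_real_of_nat by auto
      ultimately show ?thesis by (rule filterlim_compose)
    qed
    then have "(\<lambda>n. - ((norm (v - inverse (real (Suc n)) *\<^sub>R d) - norm v) / inverse (real (Suc n))) / \<epsilon>)
      \<longlonglongrightarrow> - (sgn v \<bullet> (- d)) / \<epsilon>"
      using assms by (intro tendsto_intros) auto
    moreover have "\<forall>\<^sub>F n in sequentially. real (Suc n) * (cutoff \<epsilon> (v - d /\<^sub>R real (Suc n)) - cutoff \<epsilon> v)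
      = - ((norm (v - inverse (real (Suc n)) *\<^sub>R d) - norm v) / inverse (real (Suc n))) / \<epsilon>"
      using order_tendstoD(1)[OF limn 3(1)] order_tendstoD(2)[OF limn 3(2)]
    proof eventually_elim
      case (elim n)
      have c: "cutoff \<epsilon> w = (1 - norm w) / \<epsilon>" if "1 - \<epsilon> < norm w" "norm w < 1" for w :: 'a
        using that assms by (auto simp: cutoff_def min_def max_def field_simps)
      show ?case
        unfolding inverse_eq_divide[symmetric] c[OF elim] c[OF 3] using assms by (simp add: field_simps)
    qed
    ultimately have "(\<lambda>n. real (Suc n) * (cutoff \<epsilon> (v - d /\<^sub>R real (Suc n)) - cutoff \<epsilon> v))
      \<longlonglongrightarrow> - (sgn v \<bullet> (- d)) / \<epsilon>"
      by (simp add: tendsto_cong)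
    then show ?thesis using 3 by (simp add: sgn_div_norm)
  qed
qed

text \<open>
  This takes the place of the divergence theorem on the ball. For a Lipschitz cutoff \<open>K\<close> of the ball,
  convexity bounds the integral of \<open>n * (H (v + d / n) - H v) * K v\<close> by that of \<open>(H (v + d) - H v) * K v\<close>.
  Translating the integral moves the difference quotient onto \<open>K\<close>, and \<open>n \<rightarrow> \<infinity>\<close> leaves an
  integral over a thin shell, which by homogeneity is the cone measure of the sphere up to an error
  that vanishes with the thickness of the shell.
\<close>

lemma ball_average_directional:
  fixes H :: "real ^ 'p \<Rightarrow> real"
  assumes conv: "convex_on UNIV H" and lip: "\<And>v w. \<bar>H v - H w\<bar> \<le> l * norm (v - w)"
  shows "real CARD('p) * (\<integral>u. H u * (u \<bullet> d) \<partial>sphere_uniform) \<le> H d - H 0 + 2 * l"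
proof -
  define Vol where "Vol = measure lborel (cball 0 1 :: (real^'p) set)"
  have Vol: "Vol > 0" unfolding Vol_def by (simp add: content_cball_pos)
  have l0: "l \<ge> 0"
    using order_trans[OF abs_ge_zero lip[of "axis undefined 1" 0]] by (simp add: norm_axis_1)
  have cont: "continuous_on UNIV H"
    by (rule lipschitz_on_continuous_on[of l]) (auto simp: lipschitz_on_def dist_norm l0 lip)
  have H[measurable]: "H \<in> borel_measurable borel"
    using cont by (rule borel_measurable_continuous_onI)
  define p where "p = CARD('p)"
  define J where "J = (\<integral>u. H u * (u \<bullet> d) \<partial>sphere_uniform)"
  \<comment> \<open>On the unit ball \<open>H (v + d)\<close> and \<open>H v\<close> each differ by
    at most \<open>l\<close> from their values at \<open>v = 0\<close>; this gives
    \<open>2 * l\<close>.\<close>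
  define c where "c = H d - H 0 + 2 * l"
  have Hb: "\<bar>H v\<bar> \<le> \<bar>H 0\<bar> + l * r" if "norm v \<le> r" for v r
    using lip[of v 0] mult_left_mono[OF that l0] by simp
  \<comment> \<open>The factor in front is the relative volume of the shell divided by its
    thickness. It tends to \<open>p\<close>, which is where the dimension in the estimator comes
    from. The maximum on the right is there because \<open>c\<close> may be negative; the mass of
    the cutoff then has to be bounded from below.\<close>
  have main: "((1 - (1 - \<epsilon>) ^ p) / \<epsilon>) * (J - l * \<epsilon> * norm d)
      \<le> max c (c * (1 - \<epsilon>) ^ p)" if \<epsilon>: "0 < \<epsilon>" "\<epsilon> < 1" for \<epsilon>
  proof -
    define K :: "real^'p \<Rightarrow> real" where "K = cutoff \<epsilon>"
    have Km[measurable]: "K \<in> borel_measurable borel" unfolding K_def by (rule cutoff_measurable)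
    have K01: "0 \<le> K v" "K v \<le> 1" for v using cutoff_bounds[of \<epsilon> v] by (auto simp: K_def)
    have Kout: "K v = 0" if "norm v > 1" for v
      using cutoff_outside[of \<epsilon> v] \<epsilon> that by (auto simp: K_def)
    define shell :: "real^'p \<Rightarrow> real"
      where "shell = (\<lambda>v. indicator (cball 0 1) v - indicator (cball 0 (1 - \<epsilon>)) v)"
    have shell: "shell v = (if 1 - \<epsilon> < norm v \<and> norm v \<le> 1 then 1 else 0)" for v
      using \<epsilon> by (auto simp: shell_def indicator_def)
    have shm[measurable]: "shell \<in> borel_measurable borel"
      unfolding shell_def by (intro borel_measurable_diff borel_measurable_indicator) simp_all
    define I where "I = (\<integral>v. H v * (shell v * ((v /\<^sub>R norm v) \<bullet> d) / \<epsilon>) \<partial>lborel)"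
    define D where "D = (\<lambda>n v. H v * (real (Suc n) * (K (v - d /\<^sub>R real (Suc n)) - K v)))"
    \<comment> \<open>The Lipschitz constant of the cutoff cancels the factor \<open>Suc n\<close>,
      so all quotients have a common bounded majorant supported in the ball of radius
      \<open>1 + norm d\<close>.\<close>
    have Dlim: "(\<lambda>n. \<integral>v. D n v \<partial>lborel) \<longlonglongrightarrow> I"
      unfolding I_def
    proof (rule integral_dominated_convergence)
      show "integrable lborel (\<lambda>v::real^'p. (\<bar>H 0\<bar> + l * (1 + norm d)) * (norm d / \<epsilon>) * indicator (cball 0 (1 + norm d)) v)"
        using emeasure_lborel_cball_finite[of "0::real^'p" "1 + norm d"]
        by (intro integrable_mult_right integrable_real_indicator) (auto simp: less_top)
      have "sphere 0 r \<in> null_sets (lborel :: (real^'p) measure)" for r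
        using negligible_sphere[of "0::real^'p" r] by (auto simp: null_sets_completion_iff negligible_iff_null_sets)
      then have "AE v in lborel. v \<notin> (sphere 0 1 \<union> sphere 0 (1 - \<epsilon>) :: (real^'p) set)"
        by (intro AE_not_in null_sets.Un)
      then show "AE v in lborel. (\<lambda>n. D n v) \<longlonglongrightarrow> H v * (shell v * ((v /\<^sub>R norm v) \<bullet> d) / \<epsilon>)"
      proof eventually_elim
        case (elim v)
        have "(\<lambda>n. D n v) \<longlonglongrightarrow> H v * (if 1 - \<epsilon> < norm v \<and> norm v \<le> 1 then ((v /\<^sub>R norm v) \<bullet> d) / \<epsilon> else 0)"
          unfolding D_def K_def using elim \<epsilon> by (intro tendsto_mult tendsto_const cutoff_difference_quotient) auto
        moreover have "(if 1 - \<epsilon> < norm v \<and> norm v \<le> 1 then ((v /\<^sub>R norm v) \<bullet> d) / \<epsilon> else 0)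
          = shell v * ((v /\<^sub>R norm v) \<bullet> d) / \<epsilon>"
          by (simp add: shell)
        ultimately show ?case by (simp only:)
      qed
      show "AE v in lborel. norm (D n v) \<le> (\<bar>H 0\<bar> + l * (1 + norm d)) * (norm d / \<epsilon>) * indicator (cball 0 (1 + norm d)) v" for n
      proof (rule AE_I2)
        fix v :: "real^'p"
        have dn: "norm (d /\<^sub>R real (Suc n)) \<le> norm d"
          using mult_right_mono[of "inverse (real (Suc n))" 1 "norm d"] by (simp add: inverse_le_1_iff)
        show "norm (D n v) \<le> (\<bar>H 0\<bar> + l * (1 + norm d)) * (norm d / \<epsilon>) * indicator (cball 0 (1 + norm d)) v"
        proof (cases "norm v \<le> 1 + norm d")
          case True
          have "\<bar>K (v - d /\<^sub>R real (Suc n)) - K v\<bar> \<le> norm (d /\<^sub>R real (Suc n)) / \<epsilon>"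
            using cutoff_lipschitz[OF \<epsilon>(1), of "v - d /\<^sub>R real (Suc n)" v] by (simp add: K_def)
          then have "real (Suc n) * \<bar>K (v - d /\<^sub>R real (Suc n)) - K v\<bar> \<le> real (Suc n) * (norm (d /\<^sub>R real (Suc n)) / \<epsilon>)"
            by (rule mult_left_mono) simp
          also have "\<dots> = norm d / \<epsilon>" by simp
          finally have "\<bar>real (Suc n) * (K (v - d /\<^sub>R real (Suc n)) - K v)\<bar> \<le> norm d / \<epsilon>"
            by (simp add: abs_mult)
          then have "\<bar>H v\<bar> * \<bar>real (Suc n) * (K (v - d /\<^sub>R real (Suc n)) - K v)\<bar>
              \<le> (\<bar>H 0\<bar> + l * (1 + norm d)) * (norm d / \<epsilon>)"
            using l0 by (intro mult_mono Hb[OF True]) auto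
          then show ?thesis
            using True by (simp only: D_def real_norm_def abs_mult) simp
        next
          case False
          have "norm (v - d /\<^sub>R real (Suc n)) > 1"
            using False dn norm_triangle_ineq2[of v "d /\<^sub>R real (Suc n)"] by linarith
          moreover have "norm v > 1" using False norm_ge_zero[of d] by linarith
          ultimately show ?thesis using False by (simp add: D_def Kout)
        qed
      qed
    qed (simp_all add: D_def)
    have Kint: "integrable lborel K"
      using K01 Kout by (intro integrable_bounded_support[of _ 1 1]) auto
    have intHK: "integrable lborel (\<lambda>v. H (a + v) * K (v - b))" for a b
    proof (rule integrable_bounded_support[of _ "\<bar>H 0\<bar> + l * (norm a + (1 + norm b))" "1 + norm b"])
      show "H (a + v) * K (v - b) = 0" if "norm v > 1 + norm b" for v
        using norm_triangle_ineq2[of v b] that Kout[of "v - b"] by auto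
      show "\<bar>H (a + v) * K (v - b)\<bar> \<le> \<bar>H 0\<bar> + l * (norm a + (1 + norm b))" for v
      proof (cases "norm v \<le> 1 + norm b")
        case True
        have "\<bar>H (a + v)\<bar> \<le> \<bar>H 0\<bar> + l * (norm a + (1 + norm b))"
          using norm_triangle_ineq[of a v] True by (intro Hb) linarith
        then have "\<bar>H (a + v)\<bar> * K (v - b) \<le> (\<bar>H 0\<bar> + l * (norm a + (1 + norm b))) * 1"
          using K01 l0 by (intro mult_mono) auto
        then show ?thesis using K01 by (simp add: abs_mult)
      next
        case False
        then show ?thesis
          using norm_triangle_ineq2[of v b] Kout[of "v - b"] l0 by auto
      qed
    qed simp
    have Dle: "(\<integral>v. D n v \<partial>lborel) \<le> c * (\<integral>v. K v \<partial>lborel)" for n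
    proof -
      define s where "s = 1 / real (Suc n)"
      have s: "0 < s" "s \<le> 1" "real (Suc n) * s = 1" by (auto simp: s_def)
      have "(\<integral>v. D n v \<partial>lborel) = real (Suc n) * (\<integral>v. H (0 + v) * K (v - s *\<^sub>R d) - H (0 + v) * K (v - 0) \<partial>lborel)"
        by (subst integral_mult_right_zero[symmetric]) (simp add: D_def s_def algebra_simps inverse_eq_divide)
      also have "(\<integral>v. H (0 + v) * K (v - s *\<^sub>R d) - H (0 + v) * K (v - 0) \<partial>lborel)
          = (\<integral>v. H (0 + v) * K (v - s *\<^sub>R d) \<partial>lborel) - (\<integral>v. H (0 + v) * K (v - 0) \<partial>lborel)"
        by (intro Bochner_Integration.integral_diff intHK)
      also have "(\<integral>v. H (0 + v) * K (v - s *\<^sub>R d) \<partial>lborel) = (\<integral>v. H (s *\<^sub>R d + v) * K (v - 0) \<partial>lborel)"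
        using lborel_integral_shift[of "\<lambda>v. H v * K (v - s *\<^sub>R d)" "s *\<^sub>R d"] by simp
      also have "\<dots> - (\<integral>v. H (0 + v) * K (v - 0) \<partial>lborel)
          = (\<integral>v. H (s *\<^sub>R d + v) * K (v - 0) - H (0 + v) * K (v - 0) \<partial>lborel)"
        by (intro Bochner_Integration.integral_diff[symmetric] intHK)
      also have "\<dots> \<le> (\<integral>v. s * c * K v \<partial>lborel)"
      proof (rule integral_mono)
        fix v :: "real^'p"
        show "H (s *\<^sub>R d + v) * K (v - 0) - H (0 + v) * K (v - 0) \<le> s * c * K v"
        proof (cases "norm v \<le> 1")
          case True
          have "H ((1 - s) *\<^sub>R v + s *\<^sub>R (v + d)) \<le> (1 - s) * H v + s * H (v + d)"
            using s by (intro convex_onD[OF conv]) auto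
          moreover have "(1 - s) *\<^sub>R v + s *\<^sub>R (v + d) = s *\<^sub>R d + v" by (simp add: algebra_simps)
          ultimately have "H (s *\<^sub>R d + v) - H v \<le> s * (H (v + d) - H v)" by (simp add: algebra_simps)
          also have "\<dots> \<le> s * c"
            using lip[of "v + d" d] lip[of v 0] mult_left_mono[OF True l0] s
            by (intro mult_left_mono) (auto simp: c_def)
          finally show ?thesis
            using mult_right_mono[OF _ K01(1)] by (fastforce simp: algebra_simps)
        next
          case False then show ?thesis by (simp add: Kout)
        qed
      qed (intro Bochner_Integration.integrable_diff intHK integrable_mult_right Kint)+
      finally have "(\<integral>v. D n v \<partial>lborel) \<le> real (Suc n) * (s * c * (\<integral>v. K v \<partial>lborel))"
        by (simp add: mult_left_mono)
      then show ?thesis using s(3) by (simp add: mult.assoc[symmetric])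
    qed
    have "I \<le> c * (\<integral>v. K v \<partial>lborel)"
      using Dlim by (rule LIMSEQ_le_const2) (use Dle in blast)
    also have "\<dots> \<le> Vol * max c (c * (1 - \<epsilon>) ^ p)"
    proof -
      have one: "(\<integral>v. indicator (cball 0 \<rho>) (v::real^'p) \<partial>lborel) = \<rho> ^ p * Vol" if "\<rho> > 0" for \<rho> :: real
        using ball_integral_radial[of "\<lambda>_. 1" \<rho>] that
        by (simp add: p_def Vol_def prob_space.prob_space[OF sphere_uniform_prob_space])
      have ii: "integrable lborel (indicator (cball 0 \<rho>) :: real^'p \<Rightarrow> real)" for \<rho>
        using emeasure_lborel_cball_finite[of "0::real^'p" \<rho>]
        by (intro integrable_real_indicator) (auto simp: less_top)
      have "(\<integral>v. K v \<partial>lborel) \<le> (\<integral>v. indicator (cball 0 1) (v::real^'p) \<partial>lborel)"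
        by (intro integral_mono Kint ii) (use K01 Kout in \<open>auto simp: indicator_def\<close>)
      then have up: "(\<integral>v. K v \<partial>lborel) \<le> Vol"
        unfolding one[OF zero_less_one] by simp
      have "(\<integral>v. indicator (cball 0 (1 - \<epsilon>)) (v::real^'p) \<partial>lborel) \<le> (\<integral>v. K v \<partial>lborel)"
        by (intro integral_mono Kint ii)
           (use \<epsilon> K01 in \<open>auto simp: indicator_def K_def cutoff_inside\<close>)
      then have lo: "(1 - \<epsilon>) ^ p * Vol \<le> (\<integral>v. K v \<partial>lborel)"
        using \<epsilon> by (subst (asm) one) auto
      show ?thesis
      proof (cases "c \<ge> 0")
        case True
        have "c * (\<integral>v. K v \<partial>lborel) \<le> c * Vol" using up True by (simp add: mult_left_mono)
        also have "\<dots> \<le> Vol * max c (c * (1 - \<epsilon>) ^ p)" using Vol by simp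
        finally show ?thesis .
      next
        case False
        have "c * (\<integral>v. K v \<partial>lborel) \<le> c * ((1 - \<epsilon>) ^ p * Vol)"
          using lo False by (intro mult_left_mono_neg) auto
        also have "\<dots> = Vol * (c * (1 - \<epsilon>) ^ p)" by simp
        also have "\<dots> \<le> Vol * max c (c * (1 - \<epsilon>) ^ p)" using Vol by (intro mult_left_mono) auto
        finally show ?thesis .
      qed
    qed
    finally have up: "I \<le> Vol * max c (c * (1 - \<epsilon>) ^ p)" .
    \<comment> \<open>On the shell, replacing \<open>v\<close> by its direction changes
      \<open>H\<close> by at most \<open>l * \<epsilon>\<close>. Subtracting this error in advance
      makes \<open>\<phi>\<close> a lower bound that depends on the direction only.\<close>
    define \<phi> where "\<phi> = (\<lambda>u. H u * (u \<bullet> d) - l * \<epsilon> * norm d)"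
    have \<phi>m[measurable]: "\<phi> \<in> borel_measurable borel" unfolding \<phi>_def by measurable
    \<comment> \<open>At the origin the quotient is 0, so equality fails there.\<close>
    have n1: "norm (v /\<^sub>R norm v) \<le> 1" for v :: "real^'p" by (cases "v = 0") auto
    define Cb where "Cb = (\<bar>H 0\<bar> + l * 1) * norm d"
    have Hd: "\<bar>H u * (u \<bullet> d)\<bar> \<le> Cb" if "norm u \<le> 1" for u
      unfolding Cb_def abs_mult using Hb[OF that] l0 that
      by (intro mult_mono) (auto intro!: order_trans[OF Cauchy_Schwarz_ineq2] mult_left_le_one_le)
    have nn: "0 \<le> l * \<epsilon> * norm d" "0 \<le> Cb" using l0 \<epsilon> by (auto simp: Cb_def)
    have \<phi>b: "\<bar>\<phi> u\<bar> \<le> Cb + l * \<epsilon> * norm d" if "norm u \<le> 1" for u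
      using Hd[OF that] nn unfolding \<phi>_def by linarith
    have intJ: "(\<integral>u. \<phi> u \<partial>sphere_uniform) = J - l * \<epsilon> * norm d"
    proof -
      interpret S: prob_space "sphere_uniform :: (real^'p) measure" by (rule sphere_uniform_prob_space)
      have "AE u in (sphere_uniform :: (real^'p) measure). norm u \<le> 1"
        unfolding sphere_uniform_def by (subst AE_distr_iff) (auto simp only: n1 AE_I2 intro: AE_I2, simp_all)
      then have "integrable sphere_uniform (\<lambda>u. H u * (u \<bullet> d))"
        by (intro S.integrable_const_bound[of _ Cb]) (use Hd in \<open>auto simp: sphere_uniform_def\<close>)
      then show ?thesis unfolding \<phi>_def J_def by (simp add: S.prob_space)
    qed
    have radial: "(\<integral>v. shell v * \<phi> (v /\<^sub>R norm v) \<partial>lborel) = (1 - (1 - \<epsilon>) ^ p) * Vol * (J - l * \<epsilon> * norm d)"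
    proof -
      have "integrable lborel (\<lambda>v. indicator (cball 0 \<rho>) v * \<phi> (v /\<^sub>R norm v))" for \<rho>
      proof (rule integrable_bounded_support[of _ "Cb + l * \<epsilon> * norm d" \<rho>])
        show "\<bar>indicator (cball 0 \<rho>) v * \<phi> (v /\<^sub>R norm v)\<bar> \<le> Cb + l * \<epsilon> * norm d" for v
          using \<phi>b[OF n1[of v]] nn by (cases "v \<in> cball 0 \<rho>") auto
      qed (auto intro!: borel_measurable_times borel_measurable_indicator)
      then have "(\<integral>v. shell v * \<phi> (v /\<^sub>R norm v) \<partial>lborel)
        = (\<integral>v. indicator (cball 0 1) v * \<phi> (v /\<^sub>R norm v) \<partial>lborel)
          - (\<integral>v. indicator (cball 0 (1 - \<epsilon>)) v * \<phi> (v /\<^sub>R norm v) \<partial>lborel)"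
        by (simp add: shell_def left_diff_distrib)
      also have "\<dots> = (1 - (1 - \<epsilon>) ^ p) * Vol * (J - l * \<epsilon> * norm d)"
        using \<epsilon> ball_integral_radial[OF \<phi>m, of 1] ball_integral_radial[OF \<phi>m, of "1 - \<epsilon>"]
        unfolding intJ p_def[symmetric] Vol_def[symmetric] by (simp only: power_one mult_1 left_diff_distrib mult.assoc)
      finally show ?thesis .
    qed
    have "(\<integral>v. shell v * \<phi> (v /\<^sub>R norm v) \<partial>lborel) \<le> (\<integral>v. shell v * (H v * ((v /\<^sub>R norm v) \<bullet> d)) \<partial>lborel)"
    proof (rule integral_mono)
      show "integrable lborel (\<lambda>v. shell v * \<phi> (v /\<^sub>R norm v))"
      proof (rule integrable_bounded_support[of _ "Cb + l * \<epsilon> * norm d" 1])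
        show "\<bar>shell v * \<phi> (v /\<^sub>R norm v)\<bar> \<le> Cb + l * \<epsilon> * norm d" for v
          using \<phi>b[OF n1[of v]] nn by (simp add: shell)
      qed (auto simp: shell)
      show "integrable lborel (\<lambda>v. shell v * (H v * ((v /\<^sub>R norm v) \<bullet> d)))"
      proof (rule integrable_bounded_support[of _ Cb 1])
        show "\<bar>shell v * (H v * ((v /\<^sub>R norm v) \<bullet> d))\<bar> \<le> Cb" for v
        proof (cases "norm v \<le> 1")
          case True
          have "\<bar>(v /\<^sub>R norm v) \<bullet> d\<bar> \<le> norm d"
            using Cauchy_Schwarz_ineq2[of "v /\<^sub>R norm v" d] mult_right_mono[OF n1[of v] norm_ge_zero[of d]] by simp
          then have "\<bar>H v * ((v /\<^sub>R norm v) \<bullet> d)\<bar> \<le> Cb"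
            unfolding Cb_def abs_mult using Hb[OF True] l0 by (intro mult_mono) auto
          then show ?thesis by (auto simp: shell)
        qed (use l0 in \<open>auto simp: shell Cb_def\<close>)
      qed (auto simp: shell)
      show "shell v * \<phi> (v /\<^sub>R norm v) \<le> shell v * (H v * ((v /\<^sub>R norm v) \<bullet> d))" for v
      proof (cases "1 - \<epsilon> < norm v \<and> norm v \<le> 1")
        case True
        define u where "u = v /\<^sub>R norm v"
        have v0: "norm v > 0" using True \<epsilon> by linarith
        have nu: "norm u = 1" using v0 by (simp add: u_def)
        have "v = norm v *\<^sub>R u" using v0 by (simp add: u_def)
        then have "norm (v - u) = norm ((norm v - 1) *\<^sub>R u)" by (metis scaleR_left_diff_distrib scaleR_one)
        then have vu: "norm (v - u) \<le> \<epsilon>" using True nu by simp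
        have "\<bar>(H u - H v) * (u \<bullet> d)\<bar> \<le> (l * \<epsilon>) * norm d"
          unfolding abs_mult using lip[of u v] mult_left_mono[OF vu l0] Cauchy_Schwarz_ineq2[of u d] nu l0 \<epsilon>
          by (intro mult_mono) (auto simp: norm_minus_commute)
        then have "\<phi> u \<le> H v * (u \<bullet> d)" unfolding \<phi>_def by (simp add: algebra_simps)
        then show ?thesis using True by (simp add: shell u_def)
      next
        case False
        then have "shell v = 0" by (auto simp: shell)
        then show ?thesis by simp
      qed
    qed
    also have "\<dots> = I * \<epsilon>"
      unfolding I_def using \<epsilon> by (subst integral_mult_left_zero[symmetric]) (simp add: field_simps)
    finally have "(1 - (1 - \<epsilon>) ^ p) * Vol * (J - l * \<epsilon> * norm d) \<le> Vol * max c (c * (1 - \<epsilon>) ^ p) * \<epsilon>"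
      using mult_right_mono[OF up, of \<epsilon>] \<epsilon> radial by linarith
    then have "Vol * (((1 - (1 - \<epsilon>) ^ p) / \<epsilon>) * (J - l * \<epsilon> * norm d)) \<le> Vol * max c (c * (1 - \<epsilon>) ^ p)"
      using \<epsilon> by (simp add: field_simps)
    then show ?thesis using Vol by (rule mult_left_le_imp_le)
  qed
  \<comment> \<open>The sequence starts at 1/2 because \<open>main\<close> needs \<epsilon> below
    1.\<close>
  have e0: "(\<lambda>n. inverse (real (Suc (Suc n)))) \<longlonglongrightarrow> 0"
    by (rule LIMSEQ_Suc[OF LIMSEQ_inverse_real_of_nat])
  have "(\<lambda>n. ((1 - (1 - inverse (real (Suc (Suc n)))) ^ p) / inverse (real (Suc (Suc n)))) * (J - l * inverse (real (Suc (Suc n))) * norm d))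
     \<longlonglongrightarrow> (real p) * (J - l * 0 * norm d)"
  proof -
    have "(1 - (1 - \<epsilon>) ^ p) / \<epsilon> = (\<Sum>i<p. (1 - \<epsilon>) ^ i)" if "\<epsilon> \<noteq> 0" for \<epsilon> :: real
      using that one_diff_power_eq[of "1 - \<epsilon>" p] by simp
    then have eq: "(1 - (1 - inverse (real (Suc (Suc n)))) ^ p) / inverse (real (Suc (Suc n)))
      = (\<Sum>i<p. (1 - inverse (real (Suc (Suc n)))) ^ i)" for n by simp
    have "(\<lambda>n. (\<Sum>i<p. (1 - inverse (real (Suc (Suc n)))) ^ i) * (J - l * inverse (real (Suc (Suc n))) * norm d))
      \<longlonglongrightarrow> (\<Sum>i<p. (1 - 0) ^ i) * (J - l * 0 * norm d)"
      by (intro tendsto_intros e0)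
    then show ?thesis unfolding eq by simp
  qed
  moreover have "(\<lambda>n. max c (c * (1 - inverse (real (Suc (Suc n)))) ^ p)) \<longlonglongrightarrow> max c (c * (1 - 0) ^ p)"
    by (intro tendsto_intros tendsto_max e0)
  ultimately have "real p * (J - l * 0 * norm d) \<le> max c (c * (1 - 0) ^ p)"
    by (rule LIMSEQ_le) (intro exI[of _ 0] allI impI main, auto simp: inverse_eq_divide)
  then show ?thesis by (simp add: p_def J_def c_def)
qed

text \<open>In units of \<delta> the function has Lipschitz constant \<open>L * \<delta>\<close>,
  while the vector \<open>d\<close> to the comparator becomes long. The error of the ball average
  depends on the former and not on the latter, so it is of order \<delta>.\<close>

lemma loss_estimate_inner_integral:
  fixes h :: "real ^ 'p \<Rightarrow> real"
  assumes conv: "convex_on UNIV h" and lip: "\<And>v w. \<bar>h v - h w\<bar> \<le> L * norm (v - w)" and \<delta>: "\<delta> > 0"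
  shows "(\<integral>u. loss_estimate \<delta> h x u \<bullet> (y - x) \<partial>sphere_uniform) \<le> h y - h x + 2 * L * \<delta>"
proof -
  define H where "H = (\<lambda>v. h (x + \<delta> *\<^sub>R v) - h x)"
  have cH: "convex_on UNIV H"
    unfolding convex_on_def
  proof (intro conjI ballI allI impI convex_UNIV)
    fix v w :: "real^'p" and a b :: real
    assume ab: "0 \<le> a" "0 \<le> b" "a + b = 1"
    have "h (a *\<^sub>R (x + \<delta> *\<^sub>R v) + b *\<^sub>R (x + \<delta> *\<^sub>R w)) \<le> a * h (x + \<delta> *\<^sub>R v) + b * h (x + \<delta> *\<^sub>R w)"
      using conv ab by (auto simp: convex_on_def)
    moreover have "a *\<^sub>R (x + \<delta> *\<^sub>R v) + b *\<^sub>R (x + \<delta> *\<^sub>R w) = (a + b) *\<^sub>R x + \<delta> *\<^sub>R (a *\<^sub>R v + b *\<^sub>R w)"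
      by (simp add: algebra_simps)
    moreover have "h x = a * h x + b * h x" using ab by (simp add: distrib_right[symmetric])
    ultimately show "H (a *\<^sub>R v + b *\<^sub>R w) \<le> a * H v + b * H w"
      using ab(3) unfolding H_def right_diff_distrib by simp
  qed
  have lH: "\<bar>H v - H w\<bar> \<le> (L * \<delta>) * norm (v - w)" for v w
    using lip[of "x + \<delta> *\<^sub>R v" "x + \<delta> *\<^sub>R w"] \<delta>
    by (simp add: H_def scaleR_diff_right[symmetric] mult.assoc)
  define d where "d = (y - x) /\<^sub>R \<delta>"
  have yx: "y - x = \<delta> *\<^sub>R d" using \<delta> by (simp add: d_def)
  have "(\<lambda>u. loss_estimate \<delta> h x u \<bullet> (y - x)) = (\<lambda>u. real CARD('p) * (H u * (u \<bullet> d)))"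
    unfolding yx loss_estimate_def H_def using \<delta> by (auto simp: fun_eq_iff)
  then have "(\<integral>u. loss_estimate \<delta> h x u \<bullet> (y - x) \<partial>sphere_uniform)
      = real CARD('p) * (\<integral>u. H u * (u \<bullet> d) \<partial>sphere_uniform)" by simp
  also have "\<dots> \<le> H d - H 0 + 2 * (L * \<delta>)"
    by (rule ball_average_directional[OF cH lH])
  also have "\<dots> = h y - h x + 2 * L * \<delta>"
    using \<delta> by (simp add: H_def yx[symmetric])
  finally show ?thesis .
qed

text \<open>The supremum of the supporting affine functions extends a convex function off its domain.\<close>

lemma convex_lipschitz_extension:
  fixes X :: "'a::real_inner set"
  assumes ne: "X \<noteq> {}"
    and sub: "\<And>x. x \<in> X \<Longrightarrow> \<exists>s. subgradient_on X f x s \<and> norm s \<le> L"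
  obtains h where "convex_on UNIV h" "\<And>v w. \<bar>h v - h w\<bar> \<le> L * norm (v - w)" "\<And>x. x \<in> X \<Longrightarrow> h x = f x"
proof -
  obtain s where s: "\<And>x. x \<in> X \<Longrightarrow> subgradient_on X f x (s x)" "\<And>x. x \<in> X \<Longrightarrow> norm (s x) \<le> L"
    using sub by metis
  define a where "a = (\<lambda>x z. f x + s x \<bullet> (z - x))"
  define h where "h = (\<lambda>z. SUP x\<in>X. a x z)"
  have aL: "a x z \<le> a x w + L * norm (z - w)" if "x \<in> X" for x z w
  proof -
    have "s x \<bullet> (z - w) \<le> norm (s x) * norm (z - w)" by (rule norm_cauchy_schwarz)
    also have "\<dots> \<le> L * norm (z - w)" using s(2)[OF that] by (simp add: mult_right_mono)
    finally show ?thesis by (simp add: a_def inner_diff_right)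
  qed
  have ax: "a x z \<le> f z" if "x \<in> X" "z \<in> X" for x z
    using s(1)[OF that(1)] that(2) by (auto simp: subgradient_on_def a_def)
  obtain x0 where x0: "x0 \<in> X" using ne by auto
  have bdd: "bdd_above ((\<lambda>x. a x z) ` X)" for z
    by (rule bdd_aboveI2[of _ _ "f x0 + L * norm (z - x0)"])
       (rule order_trans[OF aL add_right_mono[OF ax[OF _ x0]]])
  have up: "a x z \<le> h z" if "x \<in> X" for x z
    unfolding h_def by (intro cSUP_upper that bdd)
  have hL: "h z \<le> h w + L * norm (z - w)" for z w
    unfolding h_def[THEN fun_cong, of z]
    by (rule cSUP_least[OF ne]) (rule order_trans[OF aL add_right_mono[OF up]])
  show ?thesis
  proof
    show "convex_on UNIV h"
      unfolding convex_on_def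
    proof (intro conjI ballI allI impI convex_UNIV)
      fix v w :: 'a and c d :: real
      assume cd: "0 \<le> c" "0 \<le> d" "c + d = 1"
      show "h (c *\<^sub>R v + d *\<^sub>R w) \<le> c * h v + d * h w"
        unfolding h_def[THEN fun_cong, of "c *\<^sub>R v + d *\<^sub>R w"]
      proof (rule cSUP_least[OF ne])
        fix x assume x: "x \<in> X"
        have "x = c *\<^sub>R x + d *\<^sub>R x" "f x = c * f x + d * f x"
          using cd by (simp_all flip: scaleR_left_distrib distrib_right)
        then have "a x (c *\<^sub>R v + d *\<^sub>R w) = c * a x v + d * a x w"
          unfolding a_def by (smt (verit) distrib_left inner_add_right inner_diff_right inner_scaleR_right right_diff_distrib')
        also have "\<dots> \<le> c * h v + d * h w"
          using cd up[OF x] by (intro add_mono mult_left_mono) auto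
        finally show "a x (c *\<^sub>R v + d *\<^sub>R w) \<le> c * h v + d * h w" .
      qed
    qed
    show "\<bar>h v - h w\<bar> \<le> L * norm (v - w)" for v w
      using hL[of v w] hL[of w v] by (simp add: abs_le_iff norm_minus_commute)
    show "h x = f x" if "x \<in> X" for x
    proof (rule antisym)
      show "h x \<le> f x" unfolding h_def by (intro cSUP_least ne ax that)
      show "f x \<le> h x" using up[OF that, of x] by (simp add: a_def)
    qed
  qed
qed

text \<open>A coordinate vector competes in the supremum. On the reals \<open>SUP\<close> dominates
  its members only for sets bounded above, hence the crude bound by the sum of all column
  norms.\<close>

lemma norm_column_le_spectral_norm:
  assumes "k < d"
  shows "norm (A k) \<le> spectral_norm d A"
proof -
  define c where "c = (\<lambda>j. if j = k then 1 else 0 :: real)"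
  have L: "L2_set c {..<d} \<le> 1"
    using assms by (simp add: L2_set_def c_def if_distrib[of "\<lambda>t. t\<^sup>2"] cong: if_cong)
  have "norm (\<Sum>j<d. c j *\<^sub>R A j) \<le> spectral_norm d A"
    unfolding spectral_norm_def
  proof (rule cSUP_upper)
    show "bdd_above ((\<lambda>c. norm (\<Sum>k<d. c k *\<^sub>R A k)) ` {c. L2_set c {..<d} \<le> 1})"
    proof (rule bdd_aboveI2)
      fix c assume "c \<in> {c. L2_set c {..<d} \<le> 1}"
      then have "\<bar>c j\<bar> \<le> 1" if "j < d" for j
        using order_trans[OF member_le_L2_set[of "{..<d}" j "\<lambda>i. \<bar>c i\<bar>"], of 1] that
        by (simp add: L2_set_def)
      then show "norm (\<Sum>k<d. c k *\<^sub>R A k) \<le> (\<Sum>k<d. norm (A k))"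
        by (intro sum_norm_le) (auto simp: mult_left_le_one_le)
    qed
  qed (use L in simp)
  also have "(\<Sum>j<d. c j *\<^sub>R A j) = A k"
    using assms by (simp add: c_def if_distrib[of "\<lambda>t. t *\<^sub>R _"] cong: if_cong)
  finally show ?thesis .
qed

lemma convex_on_max_0:
  fixes h :: "'a::real_vector \<Rightarrow> real"
  assumes "convex_on UNIV h"
  shows "convex_on UNIV (\<lambda>x. max 0 (h x))"
  unfolding convex_on_def
proof (intro conjI ballI allI impI convex_UNIV)
  fix v w :: 'a and c d :: real
  assume cd: "0 \<le> c" "0 \<le> d" "c + d = 1"
  have "h (c *\<^sub>R v + d *\<^sub>R w) \<le> c * h v + d * h w"
    using assms cd by (auto simp: convex_on_def)
  also have "\<dots> \<le> c * max 0 (h v) + d * max 0 (h w)"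
    using cd by (intro add_mono mult_left_mono) auto
  finally show "max 0 (h (c *\<^sub>R v + d *\<^sub>R w)) \<le> c * max 0 (h v) + d * max 0 (h w)"
    using cd by simp
qed

section \<open>Consensus under time-varying mixing\<close>

text \<open>Both sides of the difference carry the same mass \<open>s\<close>, so it is a combination of the
  differences \<open>x k - x l\<close> with weights \<open>a k * b l / s\<close>.\<close>

lemma norm_diff_weighted_sums_le:
  fixes x :: "'n::finite \<Rightarrow> 'a::real_normed_vector"
  assumes a: "\<And>k. 0 \<le> a k" "sum a UNIV = s" and b: "\<And>k. 0 \<le> b k" "sum b UNIV = s"
    and D: "\<And>k l. norm (x k - x l) \<le> D"
  shows "norm ((\<Sum>k\<in>UNIV. a k *\<^sub>R x k) - (\<Sum>k\<in>UNIV. b k *\<^sub>R x k)) \<le> s * D"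
proof -
  have s0: "0 \<le> s" using a by (auto intro: sum_nonneg)
  show ?thesis
  proof (cases "s = 0")
    case True
    then have "a k = 0" "b k = 0" for k
      using a b by (simp_all add: sum_nonneg_eq_0_iff)
    then show ?thesis using True by simp
  next
    case False
    have "s *\<^sub>R ((\<Sum>k\<in>UNIV. a k *\<^sub>R x k) - (\<Sum>k\<in>UNIV. b k *\<^sub>R x k))
      = (\<Sum>k\<in>UNIV. \<Sum>l\<in>UNIV. (a k * b l) *\<^sub>R x k) - (\<Sum>l\<in>UNIV. \<Sum>k\<in>UNIV. (a k * b l) *\<^sub>R x l)"
      unfolding scaleR_diff_right
      by (simp add: scaleR_left.sum[symmetric] sum_distrib_left[symmetric] sum_distrib_right[symmetric] a b
          scaleR_sum_right mult.commute)
    also have "(\<Sum>l\<in>UNIV. \<Sum>k\<in>UNIV. (a k * b l) *\<^sub>R x l) = (\<Sum>k\<in>UNIV. \<Sum>l\<in>UNIV. (a k * b l) *\<^sub>R x l)"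
      by (rule sum.swap)
    finally have "norm (s *\<^sub>R ((\<Sum>k\<in>UNIV. a k *\<^sub>R x k) - (\<Sum>k\<in>UNIV. b k *\<^sub>R x k)))
      = norm (\<Sum>k\<in>UNIV. \<Sum>l\<in>UNIV. (a k * b l) *\<^sub>R (x k - x l))"
      by (simp add: sum_subtractf scaleR_diff_right)
    also have "\<dots> \<le> (\<Sum>k\<in>UNIV. \<Sum>l\<in>UNIV. (a k * b l) * D)"
    proof (intro sum_norm_le)
      fix k l
      show "norm ((a k * b l) *\<^sub>R (x k - x l)) \<le> (a k * b l) * D"
        using a(1)[of k] b(1)[of l] D[of k l] by (simp add: abs_mult mult_left_mono)
    qed
    also have "\<dots> = s * (s * D)"
      by (simp add: sum_distrib_left[symmetric] sum_distrib_right[symmetric] a b mult.assoc)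
    finally show ?thesis using False s0 by simp
  qed
qed

section \<open>Diameter of the agents' decisions and products of mixing matrices\<close>

definition disagreement :: "('n::finite \<Rightarrow> nat \<Rightarrow> 'a::real_normed_vector) \<Rightarrow> nat \<Rightarrow> real" where
  "disagreement x t = Max (range (\<lambda>(i, j). norm (x i t - x j t)))"

lemma disagreement_upper: "norm (x i t - x j t) \<le> disagreement x t"
  unfolding disagreement_def by (rule Max_ge) (auto intro!: image_eqI[of _ _ "(i, j)"])

lemma disagreement_le: "(\<And>i j. norm (x i t - x j t) \<le> D) \<Longrightarrow> disagreement x t \<le> D"
  unfolding disagreement_def by (subst Max_le_iff) auto

lemma disagreement_nonneg: "0 \<le> disagreement x t"
  using order_trans[OF norm_ge_zero disagreement_upper] .

text \<open>The entries of the product of the \<open>s\<close> matrices from \<open>W t\<close> to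
  \<open>W (t + s - 1)\<close>, the newest factor on the left. Row \<open>i\<close> tells how agent
  \<open>i\<close> after \<open>s\<close> rounds of exact averaging depends on the values at time
  \<open>t\<close>.\<close>

primrec transition :: "(nat \<Rightarrow> real ^ 'n ^ 'n) \<Rightarrow> nat \<Rightarrow> nat \<Rightarrow> 'n \<Rightarrow> 'n \<Rightarrow> real" where
  "transition W t 0 = (\<lambda>i j. if i = j then 1 else 0)"
| "transition W t (Suc s) = (\<lambda>i j. \<Sum>k\<in>UNIV. W (t + s) $ i $ k * transition W t s k j)"

locale mixing =
  fixes E :: "nat \<Rightarrow> ('n::finite \<times> 'n) set" and W :: "nat \<Rightarrow> real ^ 'n ^ 'n" and w :: real and B :: nat
  assumes mixing: "assumption2 E W w B"
begin

definition window :: nat where "window = CARD('n) * B"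

lemma w: "0 < w" "w < 1" and B: "B > 0"
  using mixing by (auto simp: assumption2_def)

lemma W_edge: "t \<ge> 1 \<Longrightarrow> (j, i) \<in> E t \<Longrightarrow> W t $ i $ j \<ge> w"
  and W_diag: "t \<ge> 1 \<Longrightarrow> W t $ i $ i \<ge> w"
  and W_nonneg: "t \<ge> 1 \<Longrightarrow> 0 \<le> W t $ i $ j"
  and W_row: "t \<ge> 1 \<Longrightarrow> (\<Sum>j\<in>UNIV. W t $ i $ j) = 1"
  and W_col: "t \<ge> 1 \<Longrightarrow> (\<Sum>i\<in>UNIV. W t $ i $ j) = 1"
  using mixing by (auto simp: assumption2_def doubly_stochastic_def split: if_splits)

lemma strongly_connected_window: "t \<ge> 1 \<Longrightarrow> strongly_connected (\<Union>l<B. E (t + l))"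
  using mixing by (auto simp: assumption2_def)

lemma transition_nonneg: "t \<ge> 1 \<Longrightarrow> 0 \<le> transition W t s i j"
  by (induction s arbitrary: i) (auto intro!: sum_nonneg mult_nonneg_nonneg W_nonneg)

lemma transition_row: "t \<ge> 1 \<Longrightarrow> (\<Sum>j\<in>UNIV. transition W t s i j) = 1"
proof (induction s arbitrary: i)
  case (Suc s)
  have "(\<Sum>j\<in>UNIV. transition W t (Suc s) i j)
      = (\<Sum>k\<in>UNIV. W (t + s) $ i $ k * (\<Sum>j\<in>UNIV. transition W t s k j))"
    by (simp add: sum_distrib_left) (rule sum.swap)
  then show ?case using Suc by (simp add: W_row)
qed simp

text \<open>The threshold shrinks by one factor \<open>w\<close> per round, which is exactly what a
  self-loop may cost. An agent once reached therefore stays reached, and following an edge is paid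
  for in the same way.\<close>

definition reached :: "nat \<Rightarrow> 'n \<Rightarrow> nat \<Rightarrow> 'n set" where
  "reached t j s = {i. transition W t s i j \<ge> w ^ s}"

lemma reached_step:
  assumes "t \<ge> 1" "k \<in> reached t j s" "W (t + s) $ i $ k \<ge> w"
  shows "i \<in> reached t j (Suc s)"
proof -
  have "w ^ Suc s \<le> W (t + s) $ i $ k * transition W t s k j"
    using assms w by (auto simp: reached_def intro!: mult_mono)
  also have "\<dots> \<le> transition W t (Suc s) i j"
    using assms(1) by (auto intro!: member_le_sum mult_nonneg_nonneg W_nonneg transition_nonneg)
  finally show ?thesis by (simp add: reached_def)
qed

lemma reached_mono: "t \<ge> 1 \<Longrightarrow> s \<le> s' \<Longrightarrow> reached t j s \<subseteq> reached t j s'"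
  by (rule lift_Suc_mono_le[of "reached t j"]) (use reached_step W_diag in auto)

text \<open>By strong connectivity some edge of the union graph leaves the set. It is present in one
  of the \<open>B\<close> rounds, and by the self-loops its tail is still reached in that
  round.\<close>

lemma reached_grows:
  assumes t: "t \<ge> 1" and ne: "reached t j s \<noteq> {}" "reached t j s \<noteq> UNIV"
  shows "reached t j s \<subset> reached t j (s + B)"
proof -
  let ?S = "reached t j s" and ?U = "\<Union>l<B. E ((t + s) + l)"
  obtain a b where ab: "a \<in> ?S" "b \<notin> ?S" using ne by auto
  have "(a, b) \<in> ?U\<^sup>*"
    using strongly_connected_window[of "t + s"] t by (auto simp: strongly_connected_def)
  then have "\<exists>c d. c \<in> ?S \<and> d \<notin> ?S \<and> (c, d) \<in> ?U"
    using ab by (induction rule: rtrancl_induct) auto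
  then obtain c d l where cd: "c \<in> ?S" "d \<notin> ?S" "l < B" "(c, d) \<in> E (t + s + l)" by auto
  have "c \<in> reached t j (s + l)" using cd(1) reached_mono[OF t, of s "s + l"] by auto
  then have "d \<in> reached t j (Suc (s + l))"
    by (rule reached_step[OF t]) (use W_edge[of "t + s + l"] t cd(4) in \<open>simp add: add.assoc\<close>)
  then have "d \<in> reached t j (s + B)"
    using reached_mono[OF t, of "Suc (s + l)" "s + B"] cd(3) by auto
  then show ?thesis using reached_mono[OF t, of s "s + B"] cd(2) by auto
qed

lemma transition_window:
  assumes "t \<ge> 1"
  shows "transition W t window i j \<ge> w ^ window"
proof -
  have "reached t j (c * B) = UNIV \<or> card (reached t j (c * B)) > c" for c
  proof (induction c)
    case 0
    have "j \<in> reached t j 0" by (simp add: reached_def)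
    then show ?case by (auto simp: card_gt_0_iff)
  next
    case (Suc c)
    show ?case
    proof (cases "reached t j (c * B) = UNIV")
      case True
      then show ?thesis using reached_mono[OF assms, of "c * B" "Suc c * B"] by auto
    next
      case False
      with Suc have c: "card (reached t j (c * B)) > c" by simp
      then have "reached t j (c * B) \<subset> reached t j (c * B + B)"
        using assms False by (intro reached_grows) auto
      then have "card (reached t j (c * B)) < card (reached t j (c * B + B))"
        by (intro psubset_card_mono) auto
      then show ?thesis using c by (simp add: add.commute)
    qed
  qed
  \<comment> \<open>The count starts above 0 because \<open>j\<close> reaches itself. If an agent
    were still missing after \<open>CARD('n)\<close> blocks of \<open>B\<close> rounds, more than
    \<open>CARD('n)\<close> agents would have been reached.\<close>
  from this[of "CARD('n)"] have "reached t j window = UNIV"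
    using card_mono[of "UNIV :: 'n set" "reached t j (CARD('n) * B)"] by (auto simp: window_def)
  then show ?thesis by (auto simp: reached_def)
qed

text \<open>Every entry of the product is at least \<open>w ^ window\<close>. Subtracting this
  common floor from two rows leaves their difference unchanged but reduces the mass that can
  disagree.\<close>

lemma window_contraction:
  fixes x :: "'n \<Rightarrow> 'a::real_normed_vector"
  assumes "t \<ge> 1" and D: "\<And>k l. norm (x k - x l) \<le> D"
  shows "norm ((\<Sum>k\<in>UNIV. transition W t window i k *\<^sub>R x k) - (\<Sum>k\<in>UNIV. transition W t window j k *\<^sub>R x k))
    \<le> (1 - w ^ window) * D"
proof -
  let ?a = "\<lambda>i k. transition W t window i k - w ^ window"
  have D0: "D \<ge> 0" using order_trans[OF norm_ge_zero D] .
  have "norm ((\<Sum>k\<in>UNIV. ?a i k *\<^sub>R x k) - (\<Sum>k\<in>UNIV. ?a j k *\<^sub>R x k)) \<le> (1 - real CARD('n) * w ^ window) * D"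
    by (rule norm_diff_weighted_sums_le)
       (use transition_window[OF assms(1)] transition_row[OF assms(1)] D in \<open>auto simp: sum_subtractf\<close>)
  also have "\<dots> \<le> (1 - w ^ window) * D"
    using D0 w mult_right_mono[of 1 "real CARD('n)" "w ^ window"] by (intro mult_right_mono) (auto simp: Suc_leI)
  finally show ?thesis
    by (simp add: scaleR_left_diff_distrib sum_subtractf)
qed

section \<open>Averaging with perturbations\<close>

context
  fixes x :: "'n \<Rightarrow> nat \<Rightarrow> 'a::real_normed_vector" and \<epsilon> :: "nat \<Rightarrow> real" and R :: real
  assumes step: "\<And>t i. t \<ge> 1 \<Longrightarrow> norm (x i (t + 1) - (\<Sum>j\<in>UNIV. W t $ i $ j *\<^sub>R x j t)) \<le> \<epsilon> t"
    and bound: "\<And>t i. t \<ge> 1 \<Longrightarrow> norm (x i t) \<le> R"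
begin

text \<open>Since the rows sum to one, later averaging does not amplify earlier perturbations; they
  merely add up.\<close>

lemma transition_error:
  assumes "t \<ge> 1"
  shows "norm (x i (t + s) - (\<Sum>j\<in>UNIV. transition W t s i j *\<^sub>R x j t)) \<le> (\<Sum>r<s. \<epsilon> (t + r))"
proof (induction s arbitrary: i)
  case 0
  then show ?case by (simp add: if_distrib[of "\<lambda>c. c *\<^sub>R _"] cong: if_cong)
next
  case (Suc s)
  let ?y = "\<lambda>i. \<Sum>j\<in>UNIV. transition W t s i j *\<^sub>R x j t"
  have eq: "(\<Sum>j\<in>UNIV. transition W t (Suc s) i j *\<^sub>R x j t) = (\<Sum>k\<in>UNIV. W (t + s) $ i $ k *\<^sub>R ?y k)"
    by (simp add: scaleR_sum_left scaleR_sum_right) (rule sum.swap)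
  have "norm ((\<Sum>k\<in>UNIV. W (t + s) $ i $ k *\<^sub>R x k (t + s)) - (\<Sum>k\<in>UNIV. W (t + s) $ i $ k *\<^sub>R ?y k))
    = norm (\<Sum>k\<in>UNIV. W (t + s) $ i $ k *\<^sub>R (x k (t + s) - ?y k))"
    by (simp add: scaleR_diff_right sum_subtractf)
  also have "\<dots> \<le> (\<Sum>k\<in>UNIV. W (t + s) $ i $ k * (\<Sum>r<s. \<epsilon> (t + r)))"
  proof (rule sum_norm_le)
    fix k
    show "norm (W (t + s) $ i $ k *\<^sub>R (x k (t + s) - ?y k)) \<le> W (t + s) $ i $ k * (\<Sum>r<s. \<epsilon> (t + r))"
      using W_nonneg[of "t + s" i k] assms Suc[of k] by (simp add: mult_left_mono)
  qed
  also have "\<dots> = (\<Sum>r<s. \<epsilon> (t + r))"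
    using assms by (simp add: sum_distrib_right[symmetric] W_row)
  finally show ?case
    unfolding eq using norm_triangle_le[OF add_mono] step[of "t + s" i] assms
    by (smt (verit, ccfv_threshold) Suc_eq_plus1 add_Suc_right diff_add_cancel lessThan_Suc
        norm_triangle_ineq sum.lessThan_Suc trans_le_add1 add_diff_eq diff_diff_eq2 add.assoc)
qed

lemma disagreement_recursion:
  assumes "t \<ge> 1"
  shows "disagreement x (t + window) \<le> (1 - w ^ window) * disagreement x t + 2 * (\<Sum>r<window. \<epsilon> (t + r))"
proof (rule disagreement_le)
  fix i j
  let ?y = "\<lambda>i. \<Sum>k\<in>UNIV. transition W t window i k *\<^sub>R x k t"
  have "norm (x i (t + window) - x j (t + window))
    = norm ((x i (t + window) - ?y i) + (?y i - ?y j) - (x j (t + window) - ?y j))"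
    by (simp add: algebra_simps)
  also have "\<dots> \<le> norm (x i (t + window) - ?y i) + norm (?y i - ?y j) + norm (x j (t + window) - ?y j)"
    by (rule order_trans[OF norm_triangle_ineq4 add_right_mono[OF norm_triangle_ineq]])
  also have "\<dots> \<le> (\<Sum>r<window. \<epsilon> (t + r)) + (1 - w ^ window) * disagreement x t + (\<Sum>r<window. \<epsilon> (t + r))"
    by (intro add_mono transition_error window_contraction assms disagreement_upper)
  finally show "norm (x i (t + window) - x j (t + window)) \<le> (1 - w ^ window) * disagreement x t + 2 * (\<Sum>r<window. \<epsilon> (t + r))"
    by simp
qed

text \<open>The recursion over one window is summed over all rounds. The shifted sums on the right
  are parts of the full sums, so moving the contracted sum to the left leaves the factor
  \<open>w ^ window\<close>. The rounds of the first window are bounded by \<open>2 * R\<close>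
  each, which is the origin of the term with \<open>R\<close>.\<close>

lemma sum_disagreement_le:
  "w ^ window * (\<Sum>t=1..T. disagreement x t) \<le> 2 * real window * (R + (\<Sum>t=1..T. \<epsilon> t))"
proof -
  let ?N = window and ?\<eta> = "w ^ window"
  have \<epsilon>0: "0 \<le> \<epsilon> t" if "t \<ge> 1" for t using order_trans[OF norm_ge_zero step[OF that]] .
  have \<eta>: "0 < ?\<eta>" "?\<eta> \<le> 1" using w by (auto simp: power_le_one)
  have dR: "disagreement x t \<le> 2 * R" if "t \<ge> 1" for t
    by (rule disagreement_le) (use bound[OF that] norm_triangle_ineq4 in \<open>smt (verit)\<close>)
  have first: "(\<Sum>t=1..n. disagreement x t) \<le> 2 * R * real n" for n
    using sum_bounded_above[of "{1..n}" "disagreement x" "2 * R"] dR by (simp add: mult.commute)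
  have R0: "0 \<le> R" using order_trans[OF norm_ge_zero bound[of 1]] by simp
  show ?thesis
  proof (cases "T \<le> ?N")
    case True
    have "?\<eta> * (\<Sum>t=1..T. disagreement x t) \<le> 1 * (\<Sum>t=1..T. disagreement x t)"
      using \<eta> by (intro mult_right_mono sum_nonneg disagreement_nonneg) auto
    also have "\<dots> \<le> 2 * R * real ?N"
      using order_trans[OF first[of T]] True R0 by (auto simp: mult_left_mono)
    also have "\<dots> \<le> 2 * real ?N * (R + (\<Sum>t=1..T. \<epsilon> t))"
      using \<epsilon>0 by (auto simp: distrib_left intro!: sum_nonneg mult_nonneg_nonneg)
    finally show ?thesis .
  next
    case False
    define S where "S = T - ?N"
    have T: "T = ?N + S" using False by (simp add: S_def)
    have "(\<Sum>t=1..T. disagreement x t) = (\<Sum>t=1..?N. disagreement x t) + (\<Sum>t=1..S. disagreement x (t + ?N))"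
      unfolding T using sum.ub_add_nat[of 1 ?N "disagreement x" S] sum.shift_bounds_cl_nat_ivl[of "disagreement x" 1 ?N S]
      by (simp add: add.commute)
    also have "(\<Sum>t=1..S. disagreement x (t + ?N)) \<le> (\<Sum>t=1..S. (1 - ?\<eta>) * disagreement x t + 2 * (\<Sum>r<?N. \<epsilon> (t + r)))"
      by (intro sum_mono disagreement_recursion) auto
    also have "\<dots> = (1 - ?\<eta>) * (\<Sum>t=1..S. disagreement x t) + 2 * (\<Sum>r<?N. \<Sum>t=1..S. \<epsilon> (t + r))"
      by (simp add: sum.distrib sum_distrib_left) (rule sum.swap)
    also have "\<dots> \<le> (1 - ?\<eta>) * (\<Sum>t=1..T. disagreement x t) + 2 * (\<Sum>r<?N. \<Sum>t=1..T. \<epsilon> t)"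
    proof (intro add_mono mult_left_mono sum_mono)
      show "(\<Sum>t=1..S. disagreement x t) \<le> (\<Sum>t=1..T. disagreement x t)"
        unfolding T by (intro sum_mono2 disagreement_nonneg) auto
      fix r assume r: "r \<in> {..<?N}"
      have "(\<Sum>t=1..S. \<epsilon> (t + r)) = (\<Sum>t=1+r..S+r. \<epsilon> t)"
        by (rule sum.shift_bounds_cl_nat_ivl[symmetric])
      also have "\<dots> \<le> (\<Sum>t=1..T. \<epsilon> t)"
        using r \<epsilon>0 unfolding T by (intro sum_mono2) auto
      finally show "(\<Sum>t=1..S. \<epsilon> (t + r)) \<le> (\<Sum>t=1..T. \<epsilon> t)" .
    qed (use \<eta> in auto)
    finally show ?thesis
      using first[of ?N] by (simp add: algebra_simps)
  qed
qed

end

definition consensus_const :: real where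
  "consensus_const = 2 * real window * (real CARD('n))\<^sup>2 / w ^ window"

lemma consensus_const_nonneg: "0 \<le> consensus_const"
  using w by (simp add: consensus_const_def)

lemma consensus:
  fixes x :: "'n \<Rightarrow> nat \<Rightarrow> 'a::real_normed_vector"
  assumes "\<And>t i. t \<ge> 1 \<Longrightarrow> norm (x i (t + 1) - (\<Sum>j\<in>UNIV. W t $ i $ j *\<^sub>R x j t)) \<le> \<epsilon> t"
    and "\<And>t i. t \<ge> 1 \<Longrightarrow> norm (x i t) \<le> R"
  shows "(\<Sum>t=1..T. \<Sum>i\<in>UNIV. \<Sum>j\<in>UNIV. norm (x i t - x j t)) \<le> consensus_const * (R + (\<Sum>t=1..T. \<epsilon> t))"
proof -
  have "(\<Sum>i\<in>UNIV. \<Sum>j\<in>UNIV. norm (x i t - x j t)) \<le> (\<Sum>i\<in>(UNIV::'n set). \<Sum>j\<in>(UNIV::'n set). disagreement x t)" for t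
    by (intro sum_mono disagreement_upper)
  then have "(\<Sum>t=1..T. \<Sum>i\<in>UNIV. \<Sum>j\<in>UNIV. norm (x i t - x j t)) \<le> (\<Sum>t=1..T. (real CARD('n))\<^sup>2 * disagreement x t)"
    by (intro sum_mono) (simp add: power2_eq_square mult.assoc)
  also have "\<dots> = (real CARD('n))\<^sup>2 * (\<Sum>t=1..T. disagreement x t)" by (simp add: sum_distrib_left)
  also have "\<dots> \<le> (real CARD('n))\<^sup>2 * (2 * real window * (R + (\<Sum>t=1..T. \<epsilon> t)) / w ^ window)"
    using sum_disagreement_le[OF assms, of T] w by (intro mult_left_mono) (auto simp: field_simps)
  also have "\<dots> = consensus_const * (R + (\<Sum>t=1..T. \<epsilon> t))"
    by (simp add: consensus_const_def)
  finally show ?thesis .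
qed

end

section \<open>Pathwise analysis of the primal-dual iteration\<close>

text \<open>Abel summation with a moving comparator. Increasing weights cost their increments times
  the squared diameter \<open>4 * R\<^sup>2\<close>; replacing one comparator by the next costs
  \<open>4 * R\<close> times their distance, as a difference of squares. The last squared distance
  stays on the left to make the induction work.\<close>

lemma weighted_telescope:
  fixes p v :: "nat \<Rightarrow> 'a::real_inner" and a :: "nat \<Rightarrow> real"
  assumes T: "T \<ge> 1"
    and a: "\<And>t. t \<ge> 1 \<Longrightarrow> 0 \<le> a t" "\<And>t. t \<ge> 1 \<Longrightarrow> a t \<le> a (Suc t)"
    and p: "\<And>t. t \<ge> 1 \<Longrightarrow> norm (p t) \<le> R" and v: "\<And>t. 1 \<le> t \<Longrightarrow> t \<le> T \<Longrightarrow> norm (v t) \<le> R"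
  shows "(\<Sum>t=1..T. a (Suc t) * ((norm (p t - v t))\<^sup>2 - (norm (p (Suc t) - v t))\<^sup>2))
      + a (Suc T) * (norm (p (Suc T) - v T))\<^sup>2
    \<le> a (Suc T) * (4 * R\<^sup>2 + 4 * R * (\<Sum>t=1..<T. norm (v (Suc t) - v t)))"
  using T v
proof (induction T rule: nat_induct_at_least)
  have sq: "(norm (p s - v t))\<^sup>2 \<le> 4 * R\<^sup>2" if "s \<ge> 1" "norm (v t) \<le> R" for s t
  proof -
    have "norm (p s - v t) \<le> 2 * R" using norm_triangle_ineq4[of "p s" "v t"] p[OF that(1)] that(2) by simp
    then have "(norm (p s - v t))\<^sup>2 \<le> (2 * R)\<^sup>2" by (intro power_mono) auto
    then show ?thesis by (simp add: power_mult_distrib)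
  qed
  {
    case base
    have "a (Suc 1) * (norm (p 1 - v 1))\<^sup>2 \<le> a (Suc 1) * (4 * R\<^sup>2)"
      using a(1)[of "Suc 1"] sq[of 1 1] base by (intro mult_left_mono) auto
    then show ?case by (simp add: algebra_simps)
  next
    case (Suc T)
    let ?S = "\<lambda>T. \<Sum>t=1..T. a (Suc t) * ((norm (p t - v t))\<^sup>2 - (norm (p (Suc t) - v t))\<^sup>2)"
    let ?P = "\<lambda>T. \<Sum>t=1..<T. norm (v (Suc t) - v t)"
    let ?n = "\<lambda>s t. (norm (p s - v t))\<^sup>2"
    have IH: "?S T + a (Suc T) * ?n (Suc T) T \<le> a (Suc T) * (4 * R\<^sup>2 + 4 * R * ?P T)"
      using Suc by auto
    have vb: "norm (v T) \<le> R" "norm (v (Suc T)) \<le> R" using Suc by auto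
    have R0: "0 \<le> R" using vb(1) norm_ge_zero order_trans by blast
    have "?n (Suc T) (Suc T) - ?n (Suc T) T = (v T - v (Suc T)) \<bullet> ((p (Suc T) - v (Suc T)) + (p (Suc T) - v T))"
      by (simp add: power2_norm_eq_inner algebra_simps inner_commute)
    also have "\<dots> \<le> norm (v T - v (Suc T)) * norm ((p (Suc T) - v (Suc T)) + (p (Suc T) - v T))"
      by (rule norm_cauchy_schwarz)
    also have "\<dots> \<le> norm (v T - v (Suc T)) * (4 * R)"
    proof (intro mult_left_mono norm_ge_zero)
      show "norm ((p (Suc T) - v (Suc T)) + (p (Suc T) - v T)) \<le> 4 * R"
        using vb p[of "Suc T"] norm_triangle_ineq[of "p (Suc T) - v (Suc T)" "p (Suc T) - v T"]
          norm_triangle_ineq4[of "p (Suc T)" "v (Suc T)"] norm_triangle_ineq4[of "p (Suc T)" "v T"] by simp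
    qed
    finally have d: "?n (Suc T) (Suc T) - ?n (Suc T) T \<le> 4 * R * norm (v (Suc T) - v T)"
      by (simp add: norm_minus_commute mult.commute)
    have "?S (Suc T) + a (Suc (Suc T)) * ?n (Suc (Suc T)) (Suc T) = ?S T + a (Suc (Suc T)) * ?n (Suc T) (Suc T)"
      by (simp add: algebra_simps)
    also have "\<dots> = (?S T + a (Suc T) * ?n (Suc T) T) + (a (Suc (Suc T)) - a (Suc T)) * ?n (Suc T) (Suc T)
        + a (Suc T) * (?n (Suc T) (Suc T) - ?n (Suc T) T)"
      by (simp add: algebra_simps)
    also have "\<dots> \<le> a (Suc T) * (4 * R\<^sup>2 + 4 * R * ?P T) + (a (Suc (Suc T)) - a (Suc T)) * (4 * R\<^sup>2)
        + a (Suc T) * (4 * R * norm (v (Suc T) - v T))"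
      using a[of "Suc T"] vb by (intro add_mono IH mult_left_mono sq d) auto
    also have "\<dots> = a (Suc (Suc T)) * (4 * R\<^sup>2) + a (Suc T) * (4 * R * (?P T + norm (v (Suc T) - v T)))"
      by (simp add: algebra_simps)
    also have "\<dots> \<le> a (Suc (Suc T)) * (4 * R\<^sup>2) + a (Suc (Suc T)) * (4 * R * (?P T + norm (v (Suc T) - v T)))"
      using a(2)[of "Suc T"] R0 by (intro add_left_mono mult_right_mono mult_nonneg_nonneg add_nonneg_nonneg sum_nonneg) auto
    also have "\<dots> = a (Suc (Suc T)) * (4 * R\<^sup>2 + 4 * R * ?P (Suc T))"
      using Suc.hyps by (simp add: algebra_simps)
    finally show ?case .
  }
qed

text \<open>The deterministic data are separated from the iterates, so constants built from them,
  such as \<open>budget\<close>, are the same for all sample points. \<open>G\<close> will bound the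
  gradient estimates and \<open>F\<close> the violations.\<close>

locale schedule = mixing E W w B
  for E :: "nat \<Rightarrow> ('n::finite \<times> 'n) set" and W w B +
  fixes X :: "'a::euclidean_space set" and R G F :: real and m :: "'n \<Rightarrow> nat"
    and \<alpha> \<beta> \<gamma> \<tau> \<xi> :: "nat \<Rightarrow> real"
  assumes X: "convex X" "closed X" "0 \<in> X" "X \<subseteq> cball 0 R"
    and \<alpha>: "\<And>t. t \<ge> 1 \<Longrightarrow> 0 < \<alpha> t" "\<And>t. t \<ge> 1 \<Longrightarrow> \<alpha> (Suc t) \<le> \<alpha> t"
    and \<beta>: "\<And>t. t \<ge> 1 \<Longrightarrow> 0 < \<beta> t" "\<And>t. t \<ge> 1 \<Longrightarrow> \<beta> (Suc t) \<le> \<beta> t"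
    and \<gamma>: "\<And>t. t \<ge> 1 \<Longrightarrow> 0 < \<gamma> t" "\<And>t. t \<ge> 1 \<Longrightarrow> \<beta> t * \<gamma> t \<le> 1"
    and \<beta>\<gamma>: "\<And>t. t \<ge> 1 \<Longrightarrow> 1 / \<gamma> (Suc t) \<le> 1 / \<gamma> t + \<beta> (Suc t)"
    and \<tau>: "\<And>t. t \<ge> 1 \<Longrightarrow> 0 \<le> \<tau> t"
    and \<xi>: "\<And>t. t \<ge> 1 \<Longrightarrow> 0 < \<xi> t" "\<And>t. t \<ge> 1 \<Longrightarrow> \<xi> t < 1" "\<And>t. t \<ge> 1 \<Longrightarrow> \<xi> (Suc t) \<le> \<xi> t"
begin

text \<open>The net weight of the squared dual variable of round \<open>t\<close> after summation:
  \<open>1 / \<gamma> t\<close> from the step into that round against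
  \<open>1 / \<gamma> (Suc t) - \<beta> (Suc t)\<close> from the step out of it.\<close>

definition dual_weight where "dual_weight t = 1 / \<gamma> t - 1 / \<gamma> (Suc t) + \<beta> (Suc t)"
definition qb where "qb = F + 2 * R * G"

abbreviation "m_total \<equiv> real (\<Sum>i\<in>UNIV. m i)"

text \<open>The deterministic right-hand side of the summed energy inequality. \<open>K\<close> is
  the rate at which disagreement is charged, \<open>p\<close> stands for the path length. The terms
  with \<open>consensus_const\<close> come from trading movement and disagreement for projection
  errors.\<close>

definition budget where
  "budget K T p = real CARD('n) * (G + (G + K) * consensus_const)\<^sup>2 * (\<Sum>t=1..T. \<alpha> (Suc t))
    + (G * real CARD('n) + (G + K) * consensus_const) * (\<Sum>t=1..T. \<tau> t) + (G + K) * consensus_const * R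
    + 2 * m_total * qb\<^sup>2 * (\<Sum>t=1..T. \<gamma> (Suc t)) + 2 * real CARD('n) * R * (\<Sum>t=1..T. \<tau> t / \<alpha> (Suc t))
    + real CARD('n) * (4 * R\<^sup>2 + 2 * R * p) / \<alpha> (Suc T)"

lemma dual_weight_nonneg: "t \<ge> 1 \<Longrightarrow> 0 \<le> dual_weight t"
  using \<beta>\<gamma>[of t] by (simp add: dual_weight_def)

lemma R_nonneg: "0 \<le> R"
  using X(3,4) by (auto simp: subset_iff)

lemma shrunk_subset: "0 \<le> s \<Longrightarrow> s \<le> 1 \<Longrightarrow> (*\<^sub>R) s ` X \<subseteq> X"
  using X(1,3) convexD[of X _ 0 s "1 - s"] by auto

lemma shrunk: "convex ((*\<^sub>R) s ` X)" "closed ((*\<^sub>R) s ` X)" "(*\<^sub>R) s ` X \<noteq> {}"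
  using X by (auto intro: convex_scaling closed_scaling)

end

text \<open>The estimates \<open>df\<close>, \<open>dg\<close> and the violations \<open>gp\<close>
  are arbitrary bounded data here. Neither convexity nor randomness enters before the expectation of
  \<open>lin\<close> is taken.\<close>

locale iterates = schedule E W w B X R G F m \<alpha> \<beta> \<gamma> \<tau> \<xi>
  for E :: "nat \<Rightarrow> ('n::finite \<times> 'n) set" and W w B and X :: "'a::euclidean_space set"
    and R G F m \<alpha> \<beta> \<gamma> \<tau> \<xi> +
  fixes x x' :: "'n \<Rightarrow> nat \<Rightarrow> 'a" and q :: "'n \<Rightarrow> nat \<Rightarrow> nat \<Rightarrow> real"
    and df :: "'n \<Rightarrow> nat \<Rightarrow> 'a" and dg :: "'n \<Rightarrow> nat \<Rightarrow> nat \<Rightarrow> 'a" and gp :: "'n \<Rightarrow> nat \<Rightarrow> nat \<Rightarrow> real"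
  assumes df: "\<And>t i. t \<ge> 1 \<Longrightarrow> norm (df i t) \<le> G"
    and dg: "\<And>t i k. t \<ge> 1 \<Longrightarrow> k < m i \<Longrightarrow> norm (dg i t k) \<le> G"
    and gp: "\<And>t i k. t \<ge> 1 \<Longrightarrow> k < m i \<Longrightarrow> 0 \<le> gp i t k" "\<And>t i k. t \<ge> 1 \<Longrightarrow> k < m i \<Longrightarrow> gp i t k \<le> F"
    and x_shrunk: "\<And>t i. t \<ge> 1 \<Longrightarrow> x i t \<in> (*\<^sub>R) (1 - \<xi> t) ` X"
    and x'_init: "\<And>i. x' i 1 = x i 1"
    and q_init: "\<And>i k. k < m i \<Longrightarrow> q i 1 k = 0"
    and x_step: "\<And>i t. t \<ge> 1 \<Longrightarrow> x i (Suc t) = closest_point ((*\<^sub>R) (1 - \<xi> (Suc t)) ` X)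
        ((\<Sum>j\<in>UNIV. W t $ i $ j *\<^sub>R x' j t) - \<alpha> (Suc t) *\<^sub>R (df i t + (\<Sum>k<m i. q i t k *\<^sub>R dg i t k)))"
    and q_step: "\<And>i t k. t \<ge> 1 \<Longrightarrow> k < m i \<Longrightarrow> q i (Suc t) k =
        max 0 ((1 - \<beta> (Suc t) * \<gamma> (Suc t)) * q i t k + \<gamma> (Suc t) * (gp i t k + dg i t k \<bullet> (x i (Suc t) - x i t)))"
    and x'_step: "\<And>i t. t \<ge> 1 \<Longrightarrow>
        x' i (Suc t) = (if norm (x i (Suc t) - x' i t) \<ge> \<tau> (Suc t) then x i (Suc t) else x' i t)"
begin

definition z where "z i t = (\<Sum>j\<in>UNIV. W t $ i $ j *\<^sub>R x' j t)"
definition e where "e i t = x i (Suc t) - z i t"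
definition b where "b i t k = gp i t k + dg i t k \<bullet> (x i (Suc t) - x i t)"
text \<open>All that the energy argument leaves to be averaged. The subtracted \<open>gp\<close>
  stems from the increment \<open>b\<close>, which contains the violation besides its linear
  correction.\<close>

definition lin where
  "lin i t v = df i t \<bullet> (x i t - v) + (\<Sum>k<m i. q i t k * (dg i t k \<bullet> (x i t - v) - gp i t k))"

section \<open>Bounds on the iterates and the one-round inequality\<close>

lemma x_in: "t \<ge> 1 \<Longrightarrow> x i t \<in> X"
  using x_shrunk[of t i] shrunk_subset[of "1 - \<xi> t"] \<xi>[of t] by auto

lemma x_norm: "t \<ge> 1 \<Longrightarrow> norm (x i t) \<le> R"
  using x_in[of t i] X(4) by (auto simp: subset_iff)

lemma x'_in: "t \<ge> 1 \<Longrightarrow> x' i t \<in> X"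
proof (induction t rule: nat_induct_at_least)
  case base then show ?case using x_in[of 1 i] by (simp add: x'_init[unfolded One_nat_def])
next
  case (Suc t) then show ?case using x_in[of "Suc t" i] by (simp add: x'_step)
qed

lemma x'_norm: "t \<ge> 1 \<Longrightarrow> norm (x' i t) \<le> R"
  using x'_in[of t i] X(4) by (auto simp: subset_iff)

lemma x'_close: "t \<ge> 1 \<Longrightarrow> norm (x' i t - x i t) \<le> \<tau> t"
proof (induction t rule: nat_induct_at_least)
  case base then show ?case using \<tau>[of 1] by (simp add: x'_init[unfolded One_nat_def])
next
  case (Suc t) then show ?case using \<tau>[of "Suc t"] by (auto simp: x'_step norm_minus_commute)
qed

lemma G_nonneg: "0 \<le> G"
  using order_trans[OF norm_ge_zero df[of 1]] by simp

lemma move_norm: "t \<ge> 1 \<Longrightarrow> norm (x i (Suc t) - x i t) \<le> 2 * R"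
  using norm_triangle_ineq4[of "x i (Suc t)" "x i t"] x_norm[of t i] x_norm[of "Suc t" i] by simp

lemma dg_inner_le:
  assumes "t \<ge> 1" "k < m i"
  shows "\<bar>dg i t k \<bullet> v\<bar> \<le> G * norm v"
  using order_trans[OF Cauchy_Schwarz_ineq2 mult_right_mono[OF dg[OF assms] norm_ge_zero]] .

lemma b_bound: "t \<ge> 1 \<Longrightarrow> k < m i \<Longrightarrow> \<bar>b i t k\<bar> \<le> qb"
  using gp[of t k i] dg_inner_le[of t k i "x i (Suc t) - x i t"] mult_left_mono[OF move_norm[of t i] G_nonneg]
  by (simp add: b_def qb_def mult_ac)

lemma qb_nonneg: "k < m i \<Longrightarrow> k < m i \<Longrightarrow> 0 \<le> qb"
  using b_bound[of 1 k i] by linarith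

text \<open>After multiplication by \<open>\<beta> (Suc t)\<close> the recursion, before taking the
  positive part, is a convex combination of the scaled old value and \<open>b\<close> with weight
  \<open>\<beta> (Suc t) * \<gamma> (Suc t)\<close>. Both are at most \<open>qb\<close>, the former
  because \<beta> does not increase.\<close>

lemma q_bounds: "t \<ge> 1 \<Longrightarrow> k < m i \<Longrightarrow> 0 \<le> q i t k \<and> \<beta> t * q i t k \<le> qb"
proof (induction t rule: nat_induct_at_least)
  case base then show ?case using qb_nonneg[of k i] by (simp add: q_init[unfolded One_nat_def])
next
  case (Suc t)
  let ?g = "\<gamma> (Suc t)" and ?b = "\<beta> (Suc t)"
  have g: "0 < ?g" "0 < ?b" "?b * ?g \<le> 1" using \<gamma>[of "Suc t"] \<beta>[of "Suc t"] by auto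
  have q0: "0 \<le> q i t k" "\<beta> t * q i t k \<le> qb" using Suc by auto
  have "?b * q i t k \<le> \<beta> t * q i t k" using q0 \<beta>(2)[of t] Suc by (intro mult_right_mono) auto
  then have bq: "?b * q i t k \<le> qb" using q0 by simp
  have "?b * ((1 - ?b * ?g) * q i t k + ?g * b i t k) = (1 - ?b * ?g) * (?b * q i t k) + (?b * ?g) * b i t k"
    by (simp add: algebra_simps)
  also have "\<dots> \<le> (1 - ?b * ?g) * qb + (?b * ?g) * qb"
    using bq b_bound[of t k i] Suc g by (intro add_mono mult_left_mono) auto
  finally have "?b * ((1 - ?b * ?g) * q i t k + ?g * b i t k) \<le> qb" by (simp add: algebra_simps)
  then show ?case
    using Suc g qb_nonneg[of k i] by (auto simp: q_step b_def max_def)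
qed

text \<open>Taking the positive part can only decrease the square. Expanding the square produces
  \<beta> times the squared dual variable twice: half of it lowers the weight of the old square on
  the left, the rest is nonpositive on the right. The remainder is quadratic in an increment of size
  at most \<open>2 * qb\<close>.\<close>

lemma dual_step:
  assumes t: "t \<ge> 1" and k: "k < m i"
  shows "((q i (Suc t) k)\<^sup>2 / \<gamma> (Suc t) - (1 / \<gamma> (Suc t) - \<beta> (Suc t)) * (q i t k)\<^sup>2) / 2
    \<le> q i t k * b i t k + 2 * \<gamma> (Suc t) * qb\<^sup>2"
proof -
  let ?g = "\<gamma> (Suc t)" and ?b = "\<beta> (Suc t)" and ?q = "q i t k" and ?r = "b i t k - \<beta> (Suc t) * q i t k"
  have g: "0 < ?g" "0 < ?b" using \<gamma>[of "Suc t"] \<beta>[of "Suc t"] by auto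
  have q0: "0 \<le> ?q" "\<beta> t * ?q \<le> qb" using q_bounds[OF t k] by auto
  have "?b * ?q \<le> \<beta> t * ?q" using q0 \<beta>(2)[of t] t by (intro mult_right_mono) auto
  then have bq: "0 \<le> ?b * ?q" "?b * ?q \<le> qb" using q0 g by simp_all
  have "\<bar>?r\<bar> \<le> 2 * qb" using b_bound[OF t k] bq by linarith
  then have "\<bar>?r\<bar>\<^sup>2 \<le> (2 * qb)\<^sup>2" by (intro power_mono) auto
  then have r: "?r\<^sup>2 \<le> 4 * qb\<^sup>2" by (simp add: power_mult_distrib)
  have "(q i (Suc t) k)\<^sup>2 \<le> ((1 - ?b * ?g) * ?q + ?g * b i t k)\<^sup>2"
    using t k by (simp add: q_step b_def max_def)
  also have "\<dots> = ?q\<^sup>2 + 2 * ?g * ?q * ?r + ?g\<^sup>2 * ?r\<^sup>2"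
    by (simp add: power2_eq_square algebra_simps)
  finally have "(q i (Suc t) k)\<^sup>2 / ?g \<le> (?q\<^sup>2 + 2 * ?g * ?q * ?r + ?g\<^sup>2 * ?r\<^sup>2) / ?g"
    using g by (intro divide_right_mono) auto
  also have "\<dots> = ?q\<^sup>2 / ?g + 2 * ?q * ?r + ?g * ?r\<^sup>2"
    using g by (simp add: add_divide_distrib power2_eq_square)
  finally have *: "(q i (Suc t) k)\<^sup>2 / ?g \<le> ?q\<^sup>2 / ?g + 2 * ?q * ?r + ?g * ?r\<^sup>2" .
  have "((q i (Suc t) k)\<^sup>2 / ?g - (1 / ?g - ?b) * ?q\<^sup>2) / 2 \<le> ?q * b i t k - ?b * ?q\<^sup>2 / 2 + ?g * ?r\<^sup>2 / 2"
  proof -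
    have "2 * ?q * ?r = 2 * (?q * b i t k) - 2 * (?b * ?q\<^sup>2)"
      by (simp add: algebra_simps power2_eq_square)
    moreover have "(1 / ?g - ?b) * ?q\<^sup>2 = ?q\<^sup>2 / ?g - ?b * ?q\<^sup>2"
      by (simp add: left_diff_distrib)
    moreover have "(a - u) / 2 \<le> p - s / 2 + r / 2" if "w = 2 * p - 2 * s" "u = d - s" "a \<le> d + w + r" for a d p r s u w :: real
    proof -
      have "a - u \<le> 2 * p - s + r" using that by simp
      then have "(a - u) / 2 \<le> (2 * p - s + r) / 2" by simp
      then show ?thesis by (simp add: add_divide_distrib diff_divide_distrib)
    qed
    ultimately show ?thesis using * by blast
  qed
  also have "\<dots> \<le> ?q * b i t k + 2 * ?g * qb\<^sup>2"
  proof -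
    have "?g * ?r\<^sup>2 \<le> ?g * (4 * qb\<^sup>2)" using g r by (intro mult_left_mono) auto
    moreover have "0 \<le> ?b * ?q\<^sup>2" using g by simp
    moreover have "a - s / 2 + h / 2 \<le> a + 2 * l" if "0 \<le> s" "h \<le> 4 * l" for a s h l :: real
      using that by linarith
    ultimately show ?thesis by (simp add: mult_ac)
  qed
  finally show ?thesis .
qed

text \<open>The variational inequality of the projection, rewritten by polarization. The negative
  square of \<open>e\<close> is the reserve from which movement and disagreement are paid
  later.\<close>

lemma primal_step:
  assumes t: "t \<ge> 1" and v: "v \<in> (*\<^sub>R) (1 - \<xi> (Suc t)) ` X"
  shows "(df i t + (\<Sum>k<m i. q i t k *\<^sub>R dg i t k)) \<bullet> (x i (Suc t) - v)
    \<le> ((norm (z i t - v))\<^sup>2 - (norm (x i (Suc t) - v))\<^sup>2 - (norm (e i t))\<^sup>2) / (2 * \<alpha> (Suc t))"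
proof -
  let ?w = "df i t + (\<Sum>k<m i. q i t k *\<^sub>R dg i t k)" and ?a = "\<alpha> (Suc t)"
  have a: "?a > 0" using \<alpha>[of "Suc t"] by simp
  have "(z i t - ?a *\<^sub>R ?w - x i (Suc t)) \<bullet> (v - x i (Suc t)) \<le> 0"
    unfolding x_step[OF t] z_def by (rule closest_point_dot[OF shrunk(1,2) v])
  then have "2 * ?a * (?w \<bullet> (x i (Suc t) - v)) \<le> 2 * ((x i (Suc t) - z i t) \<bullet> (v - x i (Suc t)))"
    by (simp add: algebra_simps)
  also have "\<dots> = (norm (z i t - v))\<^sup>2 - (norm (x i (Suc t) - v))\<^sup>2 - (norm (e i t))\<^sup>2"
    by (simp add: e_def power2_norm_eq_inner algebra_simps inner_commute)
  finally show ?thesis using a by (simp add: field_simps)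
qed

text \<open>The products \<open>q * (dg \<bullet> (x (t + 1) - x t))\<close> of the primal and the dual step cancel.\<close>

lemma drift_step:
  assumes t: "t \<ge> 1" and v: "v \<in> (*\<^sub>R) (1 - \<xi> (Suc t)) ` X"
  shows "(\<Sum>k<m i. ((q i (Suc t) k)\<^sup>2 / \<gamma> (Suc t) - (1 / \<gamma> (Suc t) - \<beta> (Suc t)) * (q i t k)\<^sup>2) / 2) + lin i t v
    \<le> 2 * real (m i) * qb\<^sup>2 * \<gamma> (Suc t) + G * norm (x i (Suc t) - x i t)
      + ((norm (z i t - v))\<^sup>2 - (norm (x i (Suc t) - v))\<^sup>2 - (norm (e i t))\<^sup>2) / (2 * \<alpha> (Suc t))"
proof -
  let ?d = "x i (Suc t) - x i t"
  have "(\<Sum>k<m i. ((q i (Suc t) k)\<^sup>2 / \<gamma> (Suc t) - (1 / \<gamma> (Suc t) - \<beta> (Suc t)) * (q i t k)\<^sup>2) / 2)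
      \<le> (\<Sum>k<m i. q i t k * b i t k + 2 * \<gamma> (Suc t) * qb\<^sup>2)"
    by (intro sum_mono dual_step t) auto
  also have "\<dots> = (\<Sum>k<m i. q i t k * b i t k) + 2 * real (m i) * qb\<^sup>2 * \<gamma> (Suc t)"
    by (simp add: sum.distrib)
  finally have 1: "(\<Sum>k<m i. ((q i (Suc t) k)\<^sup>2 / \<gamma> (Suc t) - (1 / \<gamma> (Suc t) - \<beta> (Suc t)) * (q i t k)\<^sup>2) / 2)
      \<le> (\<Sum>k<m i. q i t k * b i t k) + 2 * real (m i) * qb\<^sup>2 * \<gamma> (Suc t)" .
  have xv: "x i (Suc t) - v = (x i t - v) + ?d" by simp
  have "(df i t + (\<Sum>k<m i. q i t k *\<^sub>R dg i t k)) \<bullet> (x i (Suc t) - v)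
    = df i t \<bullet> ((x i t - v) + ?d) + (\<Sum>k<m i. q i t k * (dg i t k \<bullet> ((x i t - v) + ?d)))"
    unfolding xv by (simp only: inner_add_left inner_sum_left inner_scaleR_left)
  also have "\<dots> = lin i t v + df i t \<bullet> ?d + (\<Sum>k<m i. q i t k * b i t k)"
  proof -
    have "df i t \<bullet> (p + d) + (\<Sum>k<m i. q i t k * (dg i t k \<bullet> (p + d)))
      = df i t \<bullet> p + (\<Sum>k<m i. q i t k * (dg i t k \<bullet> p - gp i t k)) + df i t \<bullet> d
        + (\<Sum>k<m i. q i t k * (gp i t k + dg i t k \<bullet> d))" for p d
      by (simp add: inner_add_right distrib_left right_diff_distrib sum.distrib sum_subtractf)
    then show ?thesis unfolding lin_def b_def .
  qed
  finally have 2: "(df i t + (\<Sum>k<m i. q i t k *\<^sub>R dg i t k)) \<bullet> (x i (Suc t) - v)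
    = lin i t v + df i t \<bullet> ?d + (\<Sum>k<m i. q i t k * b i t k)" .
  have 3: "- (df i t \<bullet> ?d) \<le> G * norm ?d"
    using order_trans[OF Cauchy_Schwarz_ineq2 mult_right_mono[OF df[OF t] norm_ge_zero], of i ?d] by linarith
  show ?thesis using 1 2 3 primal_step[OF t v, of i] by linarith
qed

text \<open>Convexity of the square uses that rows sum to one; after exchanging the sums, the column
  sums let the weights disappear. Double stochasticity thus makes mixing harmless for the total
  squared distance. Passing from transmitted to current decisions costs \<open>\<tau> t\<close>
  times \<open>4 * R\<close>.\<close>

lemma mixing_square_le:
  assumes t: "t \<ge> 1" and v: "norm v \<le> R"
  shows "(\<Sum>i\<in>UNIV. (norm (z i t - v))\<^sup>2) \<le> (\<Sum>i\<in>UNIV. (norm (x i t - v))\<^sup>2) + 4 * real CARD('n) * R * \<tau> t"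
proof -
  have "(norm (z i t - v))\<^sup>2 \<le> (\<Sum>j\<in>UNIV. W t $ i $ j * (norm (x' j t - v))\<^sup>2)" for i
  proof -
    have "z i t - v = (\<Sum>j\<in>UNIV. W t $ i $ j *\<^sub>R (x' j t - v))"
      using W_row[OF t, of i] by (simp add: z_def scaleR_diff_right sum_subtractf flip: scaleR_left.sum)
    moreover have "(norm (\<Sum>j\<in>UNIV. W t $ i $ j *\<^sub>R (x' j t - v)))\<^sup>2 \<le> (\<Sum>j\<in>UNIV. W t $ i $ j * norm (x' j t - v))\<^sup>2"
      using W_nonneg[OF t] by (intro power_mono sum_norm_le) auto
    moreover have "(\<Sum>j\<in>UNIV. W t $ i $ j * norm (x' j t - v))\<^sup>2 \<le> (\<Sum>j\<in>UNIV. W t $ i $ j * (norm (x' j t - v))\<^sup>2)"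
      using convex_on_sum[of UNIV UNIV "\<lambda>r::real. r\<^sup>2" "\<lambda>j. W t $ i $ j" "\<lambda>j. norm (x' j t - v)"]
        W_nonneg[OF t] W_row[OF t] by (simp add: convex_power2)
    ultimately show ?thesis by simp
  qed
  then have "(\<Sum>i\<in>UNIV. (norm (z i t - v))\<^sup>2) \<le> (\<Sum>i\<in>UNIV. \<Sum>j\<in>UNIV. W t $ i $ j * (norm (x' j t - v))\<^sup>2)"
    by (rule sum_mono)
  also have "\<dots> = (\<Sum>j\<in>UNIV. \<Sum>i\<in>UNIV. W t $ i $ j * (norm (x' j t - v))\<^sup>2)" by (rule sum.swap)
  also have "\<dots> = (\<Sum>j\<in>UNIV. (norm (x' j t - v))\<^sup>2)"
    using W_col[OF t] by (simp flip: sum_distrib_right)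
  also have "\<dots> \<le> (\<Sum>j\<in>UNIV. (norm (x j t - v))\<^sup>2 + 4 * R * \<tau> t)"
  proof (rule sum_mono)
    fix j
    have "(norm (x' j t - v))\<^sup>2 - (norm (x j t - v))\<^sup>2 = (x' j t - x j t) \<bullet> ((x' j t - v) + (x j t - v))"
      by (simp add: power2_norm_eq_inner algebra_simps inner_commute)
    also have "\<dots> \<le> norm (x' j t - x j t) * norm ((x' j t - v) + (x j t - v))"
      by (rule norm_cauchy_schwarz)
    also have "\<dots> \<le> \<tau> t * (4 * R)"
    proof (intro mult_mono x'_close t)
      show "norm ((x' j t - v) + (x j t - v)) \<le> 4 * R"
        using v x_norm[OF t, of j] x'_norm[OF t, of j] norm_triangle_ineq[of "x' j t - v" "x j t - v"]
          norm_triangle_ineq4[of "x' j t" v] norm_triangle_ineq4[of "x j t" v] by simp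
    qed (use \<tau>[OF t] in auto)
    finally show "(norm (x' j t - v))\<^sup>2 \<le> (norm (x j t - v))\<^sup>2 + 4 * R * \<tau> t" by (simp add: mult_ac)
  qed
  also have "\<dots> = (\<Sum>i\<in>UNIV. (norm (x i t - v))\<^sup>2) + 4 * real CARD('n) * R * \<tau> t" by (simp add: sum.distrib)
  finally show ?thesis .
qed

section \<open>Disagreement and movement, and the summed energy inequality\<close>

definition D where "D t = (\<Sum>i\<in>UNIV. \<Sum>j\<in>UNIV. norm (x i t - x j t))"

lemma W_le_1: "(t::nat) \<ge> 1 \<Longrightarrow> W t $ i $ j \<le> 1"
  using member_le_sum[of j UNIV "\<lambda>j. W t $ i $ j"] W_nonneg W_row by simp

text \<open>The consensus estimate is applied to \<open>x\<close> itself: mixing transmitted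
  decisions in place of current ones counts as a perturbation of size \<open>\<tau> t\<close>.
  Summing the errors of all agents gives one perturbation bound valid for each.\<close>

lemma sum_D_le: "(\<Sum>t=1..T. D t) \<le> consensus_const * (R + (\<Sum>t=1..T. (\<Sum>i\<in>UNIV. norm (e i t)) + \<tau> t))"
  unfolding D_def
proof (rule consensus[OF _ x_norm])
  fix t i assume t: "(t::nat) \<ge> 1"
  have "norm (z i t - (\<Sum>j\<in>UNIV. W t $ i $ j *\<^sub>R x j t)) = norm (\<Sum>j\<in>UNIV. W t $ i $ j *\<^sub>R (x' j t - x j t))"
    by (simp add: z_def scaleR_diff_right sum_subtractf)
  also have "\<dots> \<le> (\<Sum>j\<in>UNIV. W t $ i $ j * \<tau> t)"
    using W_nonneg[OF t] x'_close[OF t] by (intro sum_norm_le) (auto intro!: mult_left_mono)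
  also have "\<dots> = \<tau> t" using W_row[OF t] by (simp flip: sum_distrib_right)
  finally have "norm (x i (t + 1) - (\<Sum>j\<in>UNIV. W t $ i $ j *\<^sub>R x j t)) \<le> norm (e i t) + \<tau> t"
    using norm_triangle_ineq[of "e i t" "z i t - (\<Sum>j\<in>UNIV. W t $ i $ j *\<^sub>R x j t)"] by (simp add: e_def)
  then show "norm (x i (t + 1) - (\<Sum>j\<in>UNIV. W t $ i $ j *\<^sub>R x j t)) \<le> (\<Sum>i\<in>UNIV. norm (e i t)) + \<tau> t"
    using member_le_sum[of i UNIV "\<lambda>i. norm (e i t)"] by simp
qed

lemma sum_move_le:
  assumes t: "t \<ge> 1"
  shows "(\<Sum>i\<in>UNIV. norm (x i (Suc t) - x i t)) \<le> (\<Sum>i\<in>UNIV. norm (e i t)) + real CARD('n) * \<tau> t + D t"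
proof -
  have "norm (x i (Suc t) - x i t) \<le> norm (e i t) + \<tau> t + (\<Sum>j\<in>UNIV. norm (x i t - x j t))" for i
  proof -
    have "z i t - x i t = (\<Sum>j\<in>UNIV. W t $ i $ j *\<^sub>R (x' j t - x i t))"
      using W_row[OF t, of i] by (simp add: z_def scaleR_diff_right sum_subtractf flip: scaleR_left.sum)
    also have "norm \<dots> \<le> (\<Sum>j\<in>UNIV. W t $ i $ j * \<tau> t + norm (x i t - x j t))"
    proof (rule sum_norm_le)
      fix j
      have "norm (x' j t - x i t) \<le> \<tau> t + norm (x i t - x j t)"
        using norm_triangle_ineq4[of "x' j t - x j t" "x i t - x j t"] x'_close[OF t, of j] by simp
      then have "W t $ i $ j * norm (x' j t - x i t) \<le> W t $ i $ j * \<tau> t + W t $ i $ j * norm (x i t - x j t)"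
        using mult_left_mono[OF _ W_nonneg[OF t]] by (fastforce simp: distrib_left)
      also have "W t $ i $ j * norm (x i t - x j t) \<le> norm (x i t - x j t)"
        using W_le_1[OF t, of i j] W_nonneg[OF t, of i j] by (intro mult_left_le_one_le) auto
      finally show "norm (W t $ i $ j *\<^sub>R (x' j t - x i t)) \<le> W t $ i $ j * \<tau> t + norm (x i t - x j t)"
        using W_nonneg[OF t, of i j] by simp
    qed
    also have "\<dots> = \<tau> t + (\<Sum>j\<in>UNIV. norm (x i t - x j t))"
      using W_row[OF t, of i] by (simp add: sum.distrib flip: sum_distrib_right)
    finally have "norm (z i t - x i t) \<le> \<tau> t + (\<Sum>j\<in>UNIV. norm (x i t - x j t))" .
    then show ?thesis using norm_triangle_ineq[of "e i t" "z i t - x i t"] by (simp add: e_def)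
  qed
  then have "(\<Sum>i\<in>UNIV. norm (x i (Suc t) - x i t)) \<le> (\<Sum>i\<in>UNIV. norm (e i t) + \<tau> t + (\<Sum>j\<in>UNIV. norm (x i t - x j t)))"
    by (rule sum_mono)
  then show ?thesis by (simp add: sum.distrib D_def)
qed

definition V where
  "V T = (\<Sum>i\<in>UNIV. \<Sum>k<m i. ((q i (Suc T) k)\<^sup>2 / \<gamma> (Suc T) + (\<Sum>t=1..T. dual_weight t * (q i t k)\<^sup>2)) / 2)"

text \<open>The factor 4 makes this half of what the primal step provides. One copy absorbs the
  terms linear in the projection errors, the other survives and serves the violation bound.\<close>

definition S where "S T = (\<Sum>t=1..T. \<Sum>i\<in>UNIV. (norm (e i t))\<^sup>2 / (4 * \<alpha> (Suc t)))"

lemma V_nonneg: "0 \<le> V T"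
  unfolding V_def using \<gamma>(1)[of "Suc T"] dual_weight_nonneg
  by (intro sum_nonneg divide_nonneg_pos add_nonneg_nonneg) (auto intro!: sum_nonneg)

lemma S_nonneg: "0 \<le> S T"
  unfolding S_def using \<alpha>(1) by (intro sum_nonneg divide_nonneg_pos) auto

lemma V_telescope:
  "(\<Sum>t=1..T. \<Sum>i\<in>UNIV. \<Sum>k<m i. ((q i (Suc t) k)\<^sup>2 / \<gamma> (Suc t) - (1 / \<gamma> (Suc t) - \<beta> (Suc t)) * (q i t k)\<^sup>2) / 2) = V T"
proof (induction T)
  case 0 show ?case by (simp add: V_def q_init[unfolded One_nat_def])
next
  case (Suc T)
  have "V (Suc T) - V T = (\<Sum>i\<in>UNIV. \<Sum>k<m i. ((q i (Suc (Suc T)) k)\<^sup>2 / \<gamma> (Suc (Suc T))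
      - (1 / \<gamma> (Suc (Suc T)) - \<beta> (Suc (Suc T))) * (q i (Suc T) k)\<^sup>2) / 2)"
    unfolding V_def sum_subtractf[symmetric]
    by (intro sum.cong refl) (simp add: dual_weight_def field_simps)
  then show ?case using Suc by simp
qed

text \<open>The comparator of round \<open>t\<close> is shrunk with the factor of round
  \<open>t + 1\<close>, since it must lie in the set onto which that round's update
  projects.\<close>

lemma energy:
  assumes T: "T \<ge> 1" and y: "\<And>t. 1 \<le> t \<Longrightarrow> t \<le> T \<Longrightarrow> y t \<in> X"
  defines "v \<equiv> \<lambda>t. (1 - \<xi> (Suc t)) *\<^sub>R y t"
  shows "V T + 2 * S T + (\<Sum>t=1..T. \<Sum>i\<in>UNIV. lin i t (v t))
    \<le> 2 * m_total * qb\<^sup>2 * (\<Sum>t=1..T. \<gamma> (Suc t)) + G * (\<Sum>t=1..T. \<Sum>i\<in>UNIV. norm (x i (Suc t) - x i t))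
      + 2 * real CARD('n) * R * (\<Sum>t=1..T. \<tau> t / \<alpha> (Suc t))
      + real CARD('n) * (4 * R\<^sup>2 + 2 * R * path_length y T) / \<alpha> (Suc T)"
proof -
  have v: "v t \<in> (*\<^sub>R) (1 - \<xi> (Suc t)) ` X" if "1 \<le> t" "t \<le> T" for t
    using y[OF that] unfolding v_def by (rule imageI)
  have vn: "norm (v t) \<le> R" if "1 \<le> t" "t \<le> T" for t
    using v[OF that] shrunk_subset[of "1 - \<xi> (Suc t)"] \<xi>[of "Suc t"] X(4) by fastforce
  let ?N = "\<lambda>i t. ((norm (x i t - v t))\<^sup>2 - (norm (x i (Suc t) - v t))\<^sup>2)"
  let ?V = "\<lambda>i t. \<Sum>k<m i. ((q i (Suc t) k)\<^sup>2 / \<gamma> (Suc t) - (1 / \<gamma> (Suc t) - \<beta> (Suc t)) * (q i t k)\<^sup>2) / 2"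
  let ?L = "\<lambda>t. (\<Sum>i\<in>UNIV. ?V i t) + (\<Sum>i\<in>UNIV. lin i t (v t)) + 2 * (\<Sum>i\<in>UNIV. (norm (e i t))\<^sup>2 / (4 * \<alpha> (Suc t)))"
  let ?U = "\<lambda>t. 2 * m_total * qb\<^sup>2 * \<gamma> (Suc t) + G * (\<Sum>i\<in>UNIV. norm (x i (Suc t) - x i t))
    + 2 * real CARD('n) * R * (\<tau> t / \<alpha> (Suc t)) + (\<Sum>i\<in>UNIV. (1 / \<alpha> (Suc t)) * ?N i t) / 2"
  have step: "?L t \<le> ?U t" if t: "1 \<le> t" "t \<le> T" for t
  proof -
    have a: "\<alpha> (Suc t) > 0" using \<alpha>(1)[of "Suc t"] by simp
    have "(\<Sum>i\<in>UNIV. ?V i t + lin i t (v t))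
      \<le> (\<Sum>i\<in>UNIV. 2 * real (m i) * qb\<^sup>2 * \<gamma> (Suc t) + G * norm (x i (Suc t) - x i t)
        + ((norm (z i t - v t))\<^sup>2 - (norm (x i (Suc t) - v t))\<^sup>2 - (norm (e i t))\<^sup>2) / (2 * \<alpha> (Suc t)))"
      by (intro sum_mono drift_step v that)
    also have "\<dots> = 2 * m_total * qb\<^sup>2 * \<gamma> (Suc t) + G * (\<Sum>i\<in>UNIV. norm (x i (Suc t) - x i t))
        + ((\<Sum>i\<in>UNIV. (norm (z i t - v t))\<^sup>2) - (\<Sum>i\<in>UNIV. (norm (x i (Suc t) - v t))\<^sup>2)
           - (\<Sum>i\<in>UNIV. (norm (e i t))\<^sup>2)) / (2 * \<alpha> (Suc t))"
      by (simp add: sum.distrib sum_subtractf sum_distrib_left[symmetric] sum_distrib_right[symmetric]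
          sum_divide_distrib[symmetric])
    also have "\<dots> \<le> 2 * m_total * qb\<^sup>2 * \<gamma> (Suc t) + G * (\<Sum>i\<in>UNIV. norm (x i (Suc t) - x i t))
        + ((\<Sum>i\<in>UNIV. (norm (x i t - v t))\<^sup>2) + 4 * real CARD('n) * R * \<tau> t - (\<Sum>i\<in>UNIV. (norm (x i (Suc t) - v t))\<^sup>2)
           - (\<Sum>i\<in>UNIV. (norm (e i t))\<^sup>2)) / (2 * \<alpha> (Suc t))"
      using a mixing_square_le[OF t(1) vn[OF t]] by (intro add_left_mono divide_right_mono) auto
    also have "\<dots> = ?U t - 2 * (\<Sum>i\<in>UNIV. (norm (e i t))\<^sup>2 / (4 * \<alpha> (Suc t)))"
      using a by (simp add: sum_subtractf sum_distrib_left[symmetric] sum_divide_distrib[symmetric] field_simps)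
    finally show ?thesis by (simp add: sum.distrib)
  qed
  have "(\<Sum>t=1..T. ?L t) \<le> (\<Sum>t=1..T. ?U t)"
    by (rule sum_mono) (use step in auto)
  moreover have "(\<Sum>t=1..T. ?L t) = V T + 2 * S T + (\<Sum>t=1..T. \<Sum>i\<in>UNIV. lin i t (v t))"
    unfolding sum.distrib V_telescope S_def sum_distrib_left[symmetric] by simp
  moreover have "(\<Sum>t=1..T. ?U t) = 2 * m_total * qb\<^sup>2 * (\<Sum>t=1..T. \<gamma> (Suc t)) + G * (\<Sum>t=1..T. \<Sum>i\<in>UNIV. norm (x i (Suc t) - x i t))
      + 2 * real CARD('n) * R * (\<Sum>t=1..T. \<tau> t / \<alpha> (Suc t)) + (\<Sum>i\<in>UNIV. \<Sum>t=1..T. (1 / \<alpha> (Suc t)) * ?N i t) / 2"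
    unfolding sum.distrib sum_distrib_left[symmetric] sum_divide_distrib[symmetric]
    by (simp only: sum.swap[of "\<lambda>i t. 1 / \<alpha> (Suc t) * ?N i t" "{1..T}" UNIV] sum_distrib_left)
  moreover have "(\<Sum>i\<in>UNIV. \<Sum>t=1..T. (1 / \<alpha> (Suc t)) * ?N i t) / 2
      \<le> real CARD('n) * (4 * R\<^sup>2 + 2 * R * path_length y T) / \<alpha> (Suc T)"
  proof -
    have aT: "\<alpha> (Suc T) > 0" using \<alpha>(1)[of "Suc T"] by simp
    have inv\<alpha>: "0 \<le> 1 / \<alpha> t" "1 / \<alpha> t \<le> 1 / \<alpha> (Suc t)" if "t \<ge> 1" for t
      using \<alpha>(1)[OF that] \<alpha>(1)[of "Suc t"] \<alpha>(2)[OF that] by (auto intro: frac_le)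
    \<comment> \<open>The shrinking factors vary monotonically within the unit interval, so they
      lengthen the path by at most \<open>R\<close>. This turns \<open>4 * R\<^sup>2\<close> into
      \<open>8 * R\<^sup>2\<close> before the final halving.\<close>
    have path: "(\<Sum>t=1..<T. norm (v (Suc t) - v t)) \<le> path_length y T + R"
    proof -
      have "norm (v (Suc t) - v t) \<le> norm (y (t + 1) - y t) + R * (\<xi> (Suc t) - \<xi> (Suc (Suc t)))"
        if t: "1 \<le> t" "t < T" for t
      proof -
        have "v (Suc t) - v t = (1 - \<xi> (Suc (Suc t))) *\<^sub>R (y (Suc t) - y t) + (\<xi> (Suc t) - \<xi> (Suc (Suc t))) *\<^sub>R y t"
          by (simp add: v_def algebra_simps)
        also have "norm \<dots> \<le> (1 - \<xi> (Suc (Suc t))) * norm (y (Suc t) - y t) + (\<xi> (Suc t) - \<xi> (Suc (Suc t))) * norm (y t)"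
          using \<xi>(2)[of "Suc (Suc t)"] \<xi>(3)[of "Suc t"] by (intro order_trans[OF norm_triangle_ineq]) simp
        also have "\<dots> \<le> 1 * norm (y (Suc t) - y t) + (\<xi> (Suc t) - \<xi> (Suc (Suc t))) * R"
          using \<xi>(1)[of "Suc (Suc t)"] \<xi>(3)[of "Suc t"] y[of t] t X(4)
          by (intro add_mono mult_right_mono mult_left_mono) (auto simp: subset_iff)
        finally show ?thesis by (simp add: mult.commute)
      qed
      then have "(\<Sum>t=1..<T. norm (v (Suc t) - v t)) \<le> (\<Sum>t=1..<T. norm (y (t + 1) - y t) + R * (\<xi> (Suc t) - \<xi> (Suc (Suc t))))"
        by (intro sum_mono) auto
      also have "\<dots> = path_length y T + R * (\<Sum>t=1..<T. \<xi> (Suc t) - \<xi> (Suc (Suc t)))"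
        by (simp add: path_length_def sum.distrib sum_distrib_left)
      also have "(\<Sum>t=1..<T. \<xi> (Suc t) - \<xi> (Suc (Suc t))) = \<xi> 2 - \<xi> (Suc T)"
        using T by (induction T rule: nat_induct_at_least) (simp_all add: numeral_2_eq_2)
      also have "\<dots> \<le> 1" using \<xi>(2)[of 2] \<xi>(1)[of "Suc T"] by simp
      finally show ?thesis using R_nonneg by (simp add: mult_left_mono)
    qed
    have "(\<Sum>t=1..T. (1 / \<alpha> (Suc t)) * ?N i t) \<le> (1 / \<alpha> (Suc T)) * (8 * R\<^sup>2 + 4 * R * path_length y T)" for i
    proof -
      have "(\<Sum>t=1..T. (1 / \<alpha> (Suc t)) * ?N i t) + (1 / \<alpha> (Suc T)) * (norm (x i (Suc T) - v T))\<^sup>2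
        \<le> (1 / \<alpha> (Suc T)) * (4 * R\<^sup>2 + 4 * R * (\<Sum>t=1..<T. norm (v (Suc t) - v t)))"
        by (rule weighted_telescope[where p = "x i" and v = v and a = "\<lambda>t. 1 / \<alpha> t", OF T])
           (use inv\<alpha> vn x_norm in auto)
      also have "\<dots> \<le> (1 / \<alpha> (Suc T)) * (4 * R\<^sup>2 + 4 * R * (path_length y T + R))"
        using aT path R_nonneg by (intro mult_left_mono add_left_mono) auto
      also have "\<dots> = (1 / \<alpha> (Suc T)) * (8 * R\<^sup>2 + 4 * R * path_length y T)"
        by (simp add: power2_eq_square algebra_simps)
      finally show ?thesis using aT
        by (smt (verit) divide_nonneg_pos mult_nonneg_nonneg zero_le_power2)
    qed
    then have "(\<Sum>i\<in>UNIV. \<Sum>t=1..T. (1 / \<alpha> (Suc t)) * ?N i t) \<le> (\<Sum>i\<in>(UNIV::'n set). (1 / \<alpha> (Suc T)) * (8 * R\<^sup>2 + 4 * R * path_length y T))"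
      by (rule sum_mono)
    then show ?thesis by (simp add: field_simps)
  qed
  ultimately show ?thesis by linarith
qed

text \<open>AM-GM with a free weight \<open>\<mu>\<close>: 1 for the regret, a power of \<open>T\<close> for the constraint violation.\<close>

lemma error_absorption:
  assumes "\<mu> > 0"
  shows "Q * (\<Sum>t=1..T. \<Sum>i\<in>UNIV. norm (e i t)) \<le> S T / \<mu> + real CARD('n) * Q\<^sup>2 * \<mu> * (\<Sum>t=1..T. \<alpha> (Suc t))"
proof -
  have "Q * norm (e i t) \<le> (norm (e i t))\<^sup>2 / (4 * \<alpha> (Suc t)) / \<mu> + Q\<^sup>2 * \<mu> * \<alpha> (Suc t)" for i t
  proof -
    have a: "\<alpha> (Suc t) > 0" using \<alpha>(1)[of "Suc t"] by simp
    \<comment> \<open>The choice that makes the cross term of the square, divided by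
      \<open>4 * \<mu> * \<alpha> (Suc t)\<close>, equal to \<open>Q * norm (e i t)\<close>.\<close>
    define A where "A = 2 * \<mu> * \<alpha> (Suc t) * Q"
    have "0 \<le> (norm (e i t) - A)\<^sup>2" by simp
    then have "2 * A * norm (e i t) \<le> (norm (e i t))\<^sup>2 + A\<^sup>2" by (simp add: power2_diff mult_ac)
    then have "2 * A * norm (e i t) / (4 * \<mu> * \<alpha> (Suc t)) \<le> ((norm (e i t))\<^sup>2 + A\<^sup>2) / (4 * \<mu> * \<alpha> (Suc t))"
      using a assms by (intro divide_right_mono) auto
    then show ?thesis using a assms by (simp add: A_def power2_eq_square field_simps)
  qed
  then have "(\<Sum>t=1..T. \<Sum>i\<in>UNIV. Q * norm (e i t))
    \<le> (\<Sum>t=1..T. \<Sum>i\<in>UNIV. (norm (e i t))\<^sup>2 / (4 * \<alpha> (Suc t)) / \<mu> + Q\<^sup>2 * \<mu> * \<alpha> (Suc t))"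
    by (intro sum_mono)
  also have "\<dots> = S T / \<mu> + real CARD('n) * Q\<^sup>2 * \<mu> * (\<Sum>t=1..T. \<alpha> (Suc t))"
    unfolding S_def sum_divide_distrib sum.distrib by (simp add: sum_distrib_left mult.assoc)
  finally show ?thesis by (simp add: sum_distrib_left)
qed

text \<open>Movement is first traded for projection errors, trigger errors and disagreement, then
  disagreement for the other two by the consensus estimate. What is left is linear in the projection
  errors with coefficient \<open>a + L\<close> and yields to AM-GM.\<close>

lemma drift_absorption:
  assumes a: "0 \<le> a" and K: "0 \<le> K" and \<mu>: "\<mu> > 0"
  defines "L \<equiv> (a + K) * consensus_const"
  shows "a * (\<Sum>t=1..T. \<Sum>i\<in>UNIV. norm (x i (Suc t) - x i t)) + K * (\<Sum>t=1..T. D t)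
    \<le> S T / \<mu> + real CARD('n) * (a + L)\<^sup>2 * \<mu> * (\<Sum>t=1..T. \<alpha> (Suc t))
      + (a * real CARD('n) + L) * (\<Sum>t=1..T. \<tau> t) + L * R"
proof -
  let ?e = "\<Sum>t=1..T. \<Sum>i\<in>UNIV. norm (e i t)" and ?\<tau> = "\<Sum>t=1..T. \<tau> t"
  have "(\<Sum>t=1..T. \<Sum>i\<in>UNIV. norm (x i (Suc t) - x i t)) \<le> (\<Sum>t=1..T. (\<Sum>i\<in>UNIV. norm (e i t)) + real CARD('n) * \<tau> t + D t)"
    by (rule sum_mono) (use sum_move_le in auto)
  also have "\<dots> = ?e + real CARD('n) * ?\<tau> + (\<Sum>t=1..T. D t)"
    by (simp add: sum.distrib sum_distrib_left)
  finally have "a * (\<Sum>t=1..T. \<Sum>i\<in>UNIV. norm (x i (Suc t) - x i t)) + K * (\<Sum>t=1..T. D t)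
    \<le> a * (?e + real CARD('n) * ?\<tau> + (\<Sum>t=1..T. D t)) + K * (\<Sum>t=1..T. D t)"
    using a by (intro add_right_mono mult_left_mono)
  also have "\<dots> = a * ?e + a * real CARD('n) * ?\<tau> + (a + K) * (\<Sum>t=1..T. D t)"
    by (simp add: algebra_simps)
  also have "\<dots> \<le> a * ?e + a * real CARD('n) * ?\<tau> + (a + K) * (consensus_const * (R + (?e + ?\<tau>)))"
    using a K sum_D_le[of T] by (intro add_left_mono mult_left_mono) (auto simp: sum.distrib)
  also have "\<dots> = (a + L) * ?e + (a * real CARD('n) + L) * ?\<tau> + L * R"
    by (simp add: L_def algebra_simps)
  finally show ?thesis using error_absorption[OF \<mu>, of "a + L" T] by linarith
qed

text \<open>\<open>V\<close> and \<open>S\<close> are kept on the left because the violation bound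
  lives off them. \<open>K\<close> is a slot for the Lipschitz constant with which evaluating losses
  at other agents' decisions is charged.\<close>

lemma regret_pathwise:
  assumes T: "T \<ge> 1" and y: "\<And>t. 1 \<le> t \<Longrightarrow> t \<le> T \<Longrightarrow> y t \<in> X" and K: "0 \<le> K"
  shows "V T + S T + K * (\<Sum>t=1..T. D t)
    \<le> budget K T (path_length y T) - (\<Sum>t=1..T. \<Sum>i\<in>UNIV. lin i t ((1 - \<xi> (Suc t)) *\<^sub>R y t))"
  using energy[where y = y, OF T y] drift_absorption[OF G_nonneg K zero_less_one, of T] unfolding budget_def
  by simp

text \<open>The weights in \<open>V\<close> are those that appear when the dual recursion is summed, so AM-GM turns the
  sum of the increments \<open>b\<close> into \<open>V\<close>.\<close>

lemma dual_sum_le: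
  assumes "\<mu> > 0"
  shows "(\<Sum>t=1..T. \<Sum>i\<in>UNIV. \<Sum>k<m i. b i t k)
    \<le> m_total * (\<mu> / 2) * (1 / \<gamma> 1 + (\<Sum>t=1..T. \<beta> (Suc t))) + V T / \<mu>"
proof -
  have amgm: "a \<le> \<mu> / 2 + a\<^sup>2 / 2 / \<mu>" for a :: real
  proof -
    have "0 \<le> (a - \<mu>)\<^sup>2" by simp
    then have "2 * \<mu> * a / (2 * \<mu>) \<le> (\<mu>\<^sup>2 + a\<^sup>2) / (2 * \<mu>)"
      using assms by (intro divide_right_mono) (auto simp: power2_diff mult_ac)
    then show ?thesis using assms by (simp add: power2_eq_square field_simps)
  qed
  have bq: "b i t k \<le> q i (Suc t) k / \<gamma> (Suc t) - (1 / \<gamma> (Suc t) - \<beta> (Suc t)) * q i t k"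
    if "t \<ge> 1" "k < m i" for i t k
  proof -
    have g: "\<gamma> (Suc t) > 0" using \<gamma>(1)[of "Suc t"] by simp
    have "(1 - \<beta> (Suc t) * \<gamma> (Suc t)) * q i t k + \<gamma> (Suc t) * b i t k \<le> q i (Suc t) k"
      using that by (simp add: q_step b_def)
    then show ?thesis using g by (simp add: field_simps)
  qed
  have tel: "(\<Sum>t=1..T. q i (Suc t) k / \<gamma> (Suc t) - (1 / \<gamma> (Suc t) - \<beta> (Suc t)) * q i t k)
      = q i (Suc T) k / \<gamma> (Suc T) + (\<Sum>t=1..T. dual_weight t * q i t k)" if k: "k < m i" for i k
  proof (induction T)
    case 0 show ?case using k by (simp add: q_init[unfolded One_nat_def])
  next
    case (Suc T) then show ?case by (simp add: dual_weight_def algebra_simps)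
  qed
  \<comment> \<open>The differences of \<open>1 / \<gamma>\<close> telescope, so the total weight is
    the initial \<open>1 / \<gamma> 1\<close> plus the sum of \<beta>. It multiplies the constant
    part \<open>\<mu> / 2\<close> of AM-GM.\<close>
  have csum: "1 / \<gamma> (Suc T) + (\<Sum>t=1..T. dual_weight t) = 1 / \<gamma> 1 + (\<Sum>t=1..T. \<beta> (Suc t))"
    by (induction T) (auto simp: dual_weight_def)
  have "(\<Sum>t=1..T. b i t k) \<le> \<mu> / 2 * (1 / \<gamma> 1 + (\<Sum>t=1..T. \<beta> (Suc t)))
      + ((q i (Suc T) k)\<^sup>2 / \<gamma> (Suc T) + (\<Sum>t=1..T. dual_weight t * (q i t k)\<^sup>2)) / 2 / \<mu>" if k: "k < m i" for i k
  proof -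
    have "(\<Sum>t=1..T. b i t k) \<le> (\<Sum>t=1..T. q i (Suc t) k / \<gamma> (Suc t) - (1 / \<gamma> (Suc t) - \<beta> (Suc t)) * q i t k)"
      using bq k by (intro sum_mono) auto
    also have "\<dots> = q i (Suc T) k / \<gamma> (Suc T) + (\<Sum>t=1..T. dual_weight t * q i t k)" by (rule tel[OF k])
    also have "\<dots> \<le> (\<mu> / 2 + (q i (Suc T) k)\<^sup>2 / 2 / \<mu>) / \<gamma> (Suc T) + (\<Sum>t=1..T. dual_weight t * (\<mu> / 2 + (q i t k)\<^sup>2 / 2 / \<mu>))"
      using \<gamma>(1)[of "Suc T"] dual_weight_nonneg
      by (intro add_mono divide_right_mono sum_mono mult_left_mono amgm) auto
    also have "\<dots> = \<mu> / 2 * (1 / \<gamma> (Suc T) + (\<Sum>t=1..T. dual_weight t))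
        + ((q i (Suc T) k)\<^sup>2 / \<gamma> (Suc T) + (\<Sum>t=1..T. dual_weight t * (q i t k)\<^sup>2)) / 2 / \<mu>"
      using \<gamma>(1)[of "Suc T"] assms
      by (simp add: distrib_left sum.distrib sum_distrib_left sum_distrib_right sum_divide_distrib add_divide_distrib mult_ac)
    finally show ?thesis unfolding csum .
  qed
  then have "(\<Sum>i\<in>UNIV. \<Sum>k<m i. \<Sum>t=1..T. b i t k) \<le> (\<Sum>i\<in>UNIV. \<Sum>k<m i. \<mu> / 2 * (1 / \<gamma> 1 + (\<Sum>t=1..T. \<beta> (Suc t)))
      + ((q i (Suc T) k)\<^sup>2 / \<gamma> (Suc T) + (\<Sum>t=1..T. dual_weight t * (q i t k)\<^sup>2)) / 2 / \<mu>)"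
    by (intro sum_mono) auto
  also have "\<dots> = m_total * (\<mu> / 2) * (1 / \<gamma> 1 + (\<Sum>t=1..T. \<beta> (Suc t))) + V T / \<mu>"
    by (simp add: V_def sum.distrib sum_divide_distrib[symmetric] sum_distrib_right[symmetric] mult.assoc)
  also have "(\<Sum>i\<in>UNIV. \<Sum>k<m i. \<Sum>t=1..T. b i t k) = (\<Sum>t=1..T. \<Sum>i\<in>UNIV. \<Sum>k<m i. b i t k)"
    by (simp only: sum.swap[of _ "{1..T}"])
  finally show ?thesis .
qed

text \<open>The dual recursion sees a violation only through its linearization \<open>b\<close>, so
  a violation is at most an increment plus \<open>G\<close> times the distance moved. The increments
  are paid by \<open>V\<close> and the movement by \<open>S\<close>; the two balances are
  independent, hence two weights.\<close>

lemma violation_pathwise: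
  assumes K: "0 \<le> K" and \<mu>: "\<mu> > 0" "\<mu>' > 0"
  defines "L \<equiv> (m_total * G + K) * consensus_const"
  shows "(\<Sum>t=1..T. \<Sum>i\<in>UNIV. \<Sum>k<m i. gp i t k) + K * (\<Sum>t=1..T. D t)
    \<le> m_total * (\<mu> / 2) * (1 / \<gamma> 1 + (\<Sum>t=1..T. \<beta> (Suc t))) + V T / \<mu>
      + S T / \<mu>' + real CARD('n) * (m_total * G + L)\<^sup>2 * \<mu>' * (\<Sum>t=1..T. \<alpha> (Suc t))
      + (m_total * G * real CARD('n) + L) * (\<Sum>t=1..T. \<tau> t) + L * R"
proof -
  let ?d = "\<lambda>i t. norm (x i (Suc t) - x i t)"
  have "(\<Sum>k<m i. gp i t k) \<le> (\<Sum>k<m i. b i t k) + m_total * G * ?d i t" if t: "t \<ge> 1" for i t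
  proof -
    have "(\<Sum>k<m i. gp i t k) \<le> (\<Sum>k<m i. b i t k + G * ?d i t)"
      using dg_inner_le[OF t, of _ i "x i (Suc t) - x i t"] by (intro sum_mono) (fastforce simp: b_def abs_le_iff)
    also have "\<dots> = (\<Sum>k<m i. b i t k) + real (m i) * G * ?d i t" by (simp add: sum.distrib)
    also have "\<dots> \<le> (\<Sum>k<m i. b i t k) + m_total * G * ?d i t"
      using member_le_sum[of i UNIV m] G_nonneg
      by (intro add_left_mono mult_right_mono) (auto simp flip: of_nat_sum)
    finally show ?thesis .
  qed
  then have "(\<Sum>t=1..T. \<Sum>i\<in>UNIV. \<Sum>k<m i. gp i t k) \<le> (\<Sum>t=1..T. \<Sum>i\<in>UNIV. (\<Sum>k<m i. b i t k) + m_total * G * ?d i t)"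
    by (intro sum_mono) auto
  also have "\<dots> = (\<Sum>t=1..T. \<Sum>i\<in>UNIV. \<Sum>k<m i. b i t k) + m_total * G * (\<Sum>t=1..T. \<Sum>i\<in>UNIV. ?d i t)"
    by (simp add: sum.distrib sum_distrib_left)
  finally have gp_le: "(\<Sum>t=1..T. \<Sum>i\<in>UNIV. \<Sum>k<m i. gp i t k)
    \<le> (\<Sum>t=1..T. \<Sum>i\<in>UNIV. \<Sum>k<m i. b i t k) + m_total * G * (\<Sum>t=1..T. \<Sum>i\<in>UNIV. ?d i t)" .
  have "0 \<le> m_total * G" by (rule mult_nonneg_nonneg[OF of_nat_0_le_iff G_nonneg])
  from gp_le dual_sum_le[OF \<mu>(1), of T] drift_absorption[OF this K \<mu>(2), of T]
  show ?thesis unfolding L_def by linarith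
qed

end

section \<open>Conditional expectation of the gradient estimates\<close>

text \<open>Fubini for the product of the two laws does the work of conditioning on
  \<open>Y\<close>. Boundedness is asked only along the samples, since the intended integrands are
  unbounded on the whole product space.\<close>

lemma (in prob_space) expectation_indep_le:
  fixes \<Phi> :: "'b \<times> 'b \<Rightarrow> real"
  assumes ind: "indep_var N Y K U"
    and [measurable]: "\<Phi> \<in> borel_measurable (N \<Otimes>\<^sub>M K)" "\<psi> \<in> borel_measurable N"
    and \<Phi>: "\<And>\<omega>. \<omega> \<in> space M \<Longrightarrow> \<bar>\<Phi> (Y \<omega>, U \<omega>)\<bar> \<le> C"
    and \<psi>: "\<And>\<omega>. \<omega> \<in> space M \<Longrightarrow> \<bar>\<psi> (Y \<omega>)\<bar> \<le> C'"
    and le: "\<And>y. y \<in> space N \<Longrightarrow> (\<integral>u. \<Phi> (y, u) \<partial>distr M K U) \<le> \<psi> y"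
  shows "expectation (\<lambda>\<omega>. \<Phi> (Y \<omega>, U \<omega>)) \<le> expectation (\<lambda>\<omega>. \<psi> (Y \<omega>))"
proof -
  have Y[measurable]: "Y \<in> measurable M N" and U[measurable]: "U \<in> measurable M K"
    using ind by (auto dest: indep_var_rv1 indep_var_rv2)
  interpret Y: prob_space "distr M N Y" by (rule prob_space_distr) simp
  interpret U: prob_space "distr M K U" by (rule prob_space_distr) simp
  interpret P: pair_prob_space "distr M N Y" "distr M K U" ..
  have eq: "distr M N Y \<Otimes>\<^sub>M distr M K U = distr M (N \<Otimes>\<^sub>M K) (\<lambda>\<omega>. (Y \<omega>, U \<omega>))"
    using ind by (simp add: indep_var_distribution_eq)
  have int: "integrable M (\<lambda>\<omega>. \<Phi> (Y \<omega>, U \<omega>))"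
    using \<Phi> by (intro integrable_const_bound[of _ C]) auto
  then have int2: "integrable (distr M N Y \<Otimes>\<^sub>M distr M K U) \<Phi>"
    unfolding eq by (subst integrable_distr_eq) auto
  have "expectation (\<lambda>\<omega>. \<Phi> (Y \<omega>, U \<omega>)) = (\<integral>p. \<Phi> p \<partial>(distr M N Y \<Otimes>\<^sub>M distr M K U))"
    unfolding eq by (subst integral_distr) auto
  also have "\<dots> = (\<integral>y. (\<integral>u. \<Phi> (y, u) \<partial>distr M K U) \<partial>distr M N Y)"
    using P.integral_fst'[OF int2] by simp
  also have "\<dots> \<le> (\<integral>y. \<psi> y \<partial>distr M N Y)"
  proof (rule integral_mono)
    show "integrable (distr M N Y) (\<lambda>y. \<integral>u. \<Phi> (y, u) \<partial>distr M K U)"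
      using P.integrable_fst'[OF int2] by simp
    show "integrable (distr M N Y) \<psi>"
      using \<psi> by (subst integrable_distr_eq) (auto intro!: integrable_const_bound[of _ C'])
    show "(\<integral>u. \<Phi> (y, u) \<partial>distr M K U) \<le> \<psi> y" if "y \<in> space (distr M N Y)" for y
      using le that by simp
  qed
  also have "\<dots> = expectation (\<lambda>\<omega>. \<psi> (Y \<omega>))" by (rule integral_distr) auto
  finally show ?thesis .
qed

lemma borel_measurable_lipschitz:
  fixes h :: "'a::euclidean_space \<Rightarrow> real"
  assumes "\<And>v w. \<bar>h v - h w\<bar> \<le> L * norm (v - w)"
  shows "h \<in> borel_measurable borel"
proof -
  obtain b :: 'a where "b \<in> Basis" using nonempty_Basis by blast
  then have "0 \<le> L" using order_trans[OF abs_ge_zero assms[of b 0]] by simp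
  then have "continuous_on UNIV h"
    by (intro lipschitz_on_continuous_on[of L]) (auto simp: lipschitz_on_def dist_norm assms)
  then show ?thesis by (rule borel_measurable_continuous_onI)
qed

text \<open>The difference of two values is of order \<delta> and cancels the division by
  \<delta>.\<close>

lemma norm_loss_estimate_le:
  fixes h :: "real ^ 'p \<Rightarrow> real"
  assumes lip: "\<And>v w. \<bar>h v - h w\<bar> \<le> L * norm (v - w)" and "\<delta> > 0" "norm v = 1"
  shows "norm (loss_estimate \<delta> h x v) \<le> real CARD('p) * L"
proof -
  have "\<bar>h (x + \<delta> *\<^sub>R v) - h x\<bar> \<le> L * \<delta>" using lip[of "x + \<delta> *\<^sub>R v" x] assms by simp
  then have "real CARD('p) / \<delta> * \<bar>h (x + \<delta> *\<^sub>R v) - h x\<bar> \<le> real CARD('p) / \<delta> * (L * \<delta>)"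
    using \<open>\<delta> > 0\<close> by (intro mult_left_mono) auto
  then show ?thesis using assms by (simp add: loss_estimate_def abs_mult)
qed

section \<open>The filtration generated by the draws\<close>

locale sphere_draws = prob_space M for M :: "'w measure" +
  fixes u :: "'n::finite \<Rightarrow> nat \<Rightarrow> 'w \<Rightarrow> real ^ 'p"
  assumes iid: "iid_sphere_draws M u"
begin

text \<open>The draws of all agents strictly before round \<open>t\<close>. They determine the
  iterates of round \<open>t\<close> but are independent of the directions drawn in it.\<close>

definition past :: "nat \<Rightarrow> 'w measure" where
  "past t = sigma (space M) (\<Union>(i, s)\<in>UNIV \<times> {1..<t}. {u i s -` A \<inter> space M | A. A \<in> sets borel})"

lemma draw_measurable: "t \<ge> 1 \<Longrightarrow> u i t \<in> borel_measurable M"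
  and draw_distr: "t \<ge> 1 \<Longrightarrow> distr M borel (u i t) = sphere_uniform"
  and draw_norm: "t \<ge> 1 \<Longrightarrow> \<omega> \<in> space M \<Longrightarrow> norm (u i t \<omega>) = 1"
  using iid by (auto simp: iid_sphere_draws_def indep_vars_def)

lemma space_past [simp]: "space (past t) = space M"
  by (simp add: past_def space_measure_of_conv)

lemma sets_past:
  "sets (past t) = sigma_sets (space M) (\<Union>(i, s)\<in>UNIV \<times> {1..<t}. {u i s -` A \<inter> space M | A. A \<in> sets borel})"
  unfolding past_def by (rule sets_measure_of) auto

lemma past_mono: "s \<le> t \<Longrightarrow> subalgebra (past t) (past s)"
  unfolding subalgebra_def sets_past space_past by (intro conjI refl sigma_sets_mono' UN_mono) auto

lemma subalgebra_past: "subalgebra M (past t)"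
  unfolding subalgebra_def sets_past space_past
  by (intro conjI refl sets.sigma_sets_subset) (auto intro!: measurable_sets[OF draw_measurable])

lemma past_imp_measurable: "f \<in> measurable (past t) N \<Longrightarrow> f \<in> measurable M N"
  by (rule measurable_from_subalg[OF subalgebra_past])

lemma draw_past: "1 \<le> s \<Longrightarrow> s < t \<Longrightarrow> u i s \<in> borel_measurable (past t)"
  by (rule measurableI) (auto simp: sets_past intro!: sigma_sets.Basic UN_I[of "(i, s)"])

text \<open>The earlier draws and the single draw \<open>(i, t)\<close> form disjoint blocks of an
  independent family, so the \<sigma>-algebras they generate are independent. The function
  \<open>f\<close> allows the draw to be recoded into another space.\<close>

lemma indep_past:
  assumes t: "t \<ge> 1" and Y: "Y \<in> measurable (past t) N" and f: "f \<in> measurable borel K"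
  shows "indep_var N Y K (\<lambda>\<omega>. f (u i t \<omega>))"
proof -
  let ?E = "\<lambda>(i, s). {u i s -` A \<inter> space M | A. A \<in> sets borel}"
  let ?I = "case_bool (UNIV \<times> {1..<t}) {(i, t)}"
  have "indep_sets (\<lambda>p. {(\<lambda>(i, t). u i t) p -` A \<inter> space M | A. A \<in> sets borel}) (UNIV \<times> {1..})"
    using iid by (simp add: iid_sphere_draws_def indep_vars_def2)
  then have "indep_sets ?E (UNIV \<times> {1..})" by (simp add: case_prod_beta')
  then have "indep_sets ?E (\<Union>b. ?I b)"
    by (rule indep_sets_mono_index[rotated]) (use t in \<open>auto split: bool.splits\<close>)
  then have "indep_sets (\<lambda>b. sigma_sets (space M) (\<Union>p\<in>?I b. ?E p)) UNIV"
  proof (rule indep_sets_collect_sigma)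
    have "Int_stable {u i s -` A \<inter> space M | A. A \<in> sets borel}" for i s
    proof (rule Int_stableI, clarify)
      fix A A' :: "(real^'p) set" assume "A \<in> sets borel" "A' \<in> sets borel"
      then show "\<exists>A''. (u i s -` A \<inter> space M) \<inter> (u i s -` A' \<inter> space M) = u i s -` A'' \<inter> space M \<and> A'' \<in> sets borel"
        by (intro exI[of _ "A \<inter> A'"]) auto
    qed
    then show "Int_stable (?E p)" for p by (cases p) simp
    show "disjoint_family ?I" by (auto simp: disjoint_family_on_def split: bool.splits)
  qed
  then have "indep_sets (case_bool (sigma_sets (space M) {Y -` A \<inter> space M | A. A \<in> sets N})
      (sigma_sets (space M) {(\<lambda>\<omega>. f (u i t \<omega>)) -` A \<inter> space M | A. A \<in> sets K})) UNIV"
  proof (rule indep_sets_mono_sets)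
    fix b :: bool
    have "{Y -` A \<inter> space M | A. A \<in> sets N} \<subseteq> sets (past t)"
      using measurable_sets[OF Y] by auto
    then have "sigma_sets (space M) {Y -` A \<inter> space M | A. A \<in> sets N} \<subseteq> sets (past t)"
      using sets.sigma_sets_subset[of _ "past t"] by simp
    moreover have "(\<lambda>\<omega>. f (u i t \<omega>)) -` A \<inter> space M \<in> {u i t -` A \<inter> space M | A. A \<in> sets borel}"
      if "A \<in> sets K" for A
      using measurable_sets[OF f that] by (auto intro!: exI[of _ "f -` A"])
    then have "sigma_sets (space M) {(\<lambda>\<omega>. f (u i t \<omega>)) -` A \<inter> space M | A. A \<in> sets K}
      \<subseteq> sigma_sets (space M) {u i t -` A \<inter> space M | A. A \<in> sets borel}"
      by (intro sigma_sets_mono') blast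
    ultimately show "(case b of True \<Rightarrow> sigma_sets (space M) {Y -` A \<inter> space M | A. A \<in> sets N}
        | False \<Rightarrow> sigma_sets (space M) {(\<lambda>\<omega>. f (u i t \<omega>)) -` A \<inter> space M | A. A \<in> sets K})
      \<subseteq> sigma_sets (space M) (\<Union>p\<in>?I b. ?E p)"
      by (cases b) (auto simp: sets_past)
  qed
  then show ?thesis
    using past_imp_measurable[OF Y] measurable_compose[OF draw_measurable[OF t] f]
    by (simp add: indep_var_eq indep_set_def)
qed

text \<open>The weight \<rho> will be 1 for the losses and a dual variable for the constraints.
  Being nonnegative and known before the draw, it preserves the one-sided bound for the spherical
  average.\<close>

lemma loss_estimate_expectation:
  fixes h :: "real ^ 'p \<Rightarrow> real"
  assumes t: "t \<ge> 1" and \<delta>: "\<delta> > 0"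
    and h: "convex_on UNIV h" "\<And>v w. \<bar>h v - h w\<bar> \<le> L * norm (v - w)"
    and x: "x \<in> borel_measurable (past t)" "\<And>\<omega>. \<omega> \<in> space M \<Longrightarrow> norm (x \<omega>) \<le> R"
    and \<rho>: "\<rho> \<in> borel_measurable (past t)" "\<And>\<omega>. \<omega> \<in> space M \<Longrightarrow> 0 \<le> \<rho> \<omega>" "\<And>\<omega>. \<omega> \<in> space M \<Longrightarrow> \<rho> \<omega> \<le> C"
    and y: "norm y \<le> R"
  shows "expectation (\<lambda>\<omega>. \<rho> \<omega> * (h (x \<omega>) - h y - 2 * L * \<delta>))
    \<le> expectation (\<lambda>\<omega>. \<rho> \<omega> * (loss_estimate \<delta> h (x \<omega>) (u i t \<omega>) \<bullet> (x \<omega> - y)))"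
    and "integrable M (\<lambda>\<omega>. \<rho> \<omega> * (loss_estimate \<delta> h (x \<omega>) (u i t \<omega>) \<bullet> (x \<omega> - y)))"
proof -
  have hm[measurable]: "h \<in> borel_measurable borel" using h(2) by (rule borel_measurable_lipschitz)
  have [measurable]: "x \<in> borel_measurable M" "\<rho> \<in> borel_measurable M" "u i t \<in> borel_measurable M"
    using past_imp_measurable[OF x(1)] past_imp_measurable[OF \<rho>(1)] draw_measurable[OF t] .
  define \<Phi> where "\<Phi> = (\<lambda>p :: ((real^'p) \<times> real) \<times> (real^'p) \<times> real.
    max 0 (snd (fst p)) * (loss_estimate \<delta> h (fst (fst p)) (fst (snd p)) \<bullet> (y - fst (fst p))))"
  define \<psi> where "\<psi> = (\<lambda>p :: (real^'p) \<times> real. max 0 (snd p) * (h y - h (fst p) + 2 * L * \<delta>))"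
  define p where "p = real CARD('p)"
  have xy: "norm (y - x \<omega>) \<le> 2 * R" if "\<omega> \<in> space M" for \<omega>
    using norm_triangle_ineq4[of y "x \<omega>"] y x(2)[OF that] by simp
  have est: "norm (loss_estimate \<delta> h (x \<omega>) (u i t \<omega>)) \<le> p * L" if "\<omega> \<in> space M" for \<omega>
    unfolding p_def by (rule norm_loss_estimate_le[OF h(2) \<delta> draw_norm[OF t that]])
  have bnd: "\<bar>\<rho> \<omega> * (loss_estimate \<delta> h (x \<omega>) (u i t \<omega>) \<bullet> (y - x \<omega>))\<bar> \<le> C * (p * L * (2 * R))"
    if "\<omega> \<in> space M" for \<omega>
  proof -
    have "\<bar>loss_estimate \<delta> h (x \<omega>) (u i t \<omega>) \<bullet> (y - x \<omega>)\<bar>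
      \<le> norm (loss_estimate \<delta> h (x \<omega>) (u i t \<omega>)) * norm (y - x \<omega>)" by (rule Cauchy_Schwarz_ineq2)
    also have "\<dots> \<le> (p * L) * (2 * R)"
      using est[OF that] xy[OF that] order_trans[OF norm_ge_zero est[OF that]] by (intro mult_mono) auto
    finally show ?thesis
      unfolding abs_mult using \<rho>(2,3)[OF that] by (intro mult_mono) auto
  qed
  have le_meas: "(\<lambda>\<omega>. \<rho> \<omega> * (loss_estimate \<delta> h (x \<omega>) (u i t \<omega>) \<bullet> (y - x \<omega>))) \<in> borel_measurable M"
    unfolding loss_estimate_def by measurable
  then have "integrable M (\<lambda>\<omega>. \<rho> \<omega> * (loss_estimate \<delta> h (x \<omega>) (u i t \<omega>) \<bullet> (y - x \<omega>)))"
    using bnd by (intro integrable_const_bound[of _ "C * (p * L * (2 * R))"]) auto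
  then have "integrable M (\<lambda>\<omega>. - (\<rho> \<omega> * (loss_estimate \<delta> h (x \<omega>) (u i t \<omega>) \<bullet> (y - x \<omega>))))"
    by simp
  then show "integrable M (\<lambda>\<omega>. \<rho> \<omega> * (loss_estimate \<delta> h (x \<omega>) (u i t \<omega>) \<bullet> (x \<omega> - y)))"
    by (simp add: inner_diff_right algebra_simps)
  let ?B = "borel \<Otimes>\<^sub>M borel :: ((real^'p) \<times> real) measure"
  have "expectation (\<lambda>\<omega>. \<Phi> ((x \<omega>, \<rho> \<omega>), (u i t \<omega>, 0))) \<le> expectation (\<lambda>\<omega>. \<psi> (x \<omega>, \<rho> \<omega>))"
  proof (rule expectation_indep_le[where Y = "\<lambda>\<omega>. (x \<omega>, \<rho> \<omega>)" and N = ?B and K = ?B])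
    show "indep_var ?B (\<lambda>\<omega>. (x \<omega>, \<rho> \<omega>)) ?B (\<lambda>\<omega>. (u i t \<omega>, 0))"
      using x(1) \<rho>(1) by (intro indep_past[OF t]) auto
    show \<Phi>m[measurable]: "\<Phi> \<in> borel_measurable (?B \<Otimes>\<^sub>M ?B)"
      unfolding \<Phi>_def loss_estimate_def by measurable
    show "\<psi> \<in> borel_measurable (borel \<Otimes>\<^sub>M borel)"
      unfolding \<psi>_def by measurable
    show "\<bar>\<Phi> ((x \<omega>, \<rho> \<omega>), (u i t \<omega>, 0))\<bar> \<le> C * (p * L * (2 * R))" if "\<omega> \<in> space M" for \<omega>
      using bnd[OF that] \<rho>(2)[OF that] by (simp add: \<Phi>_def)
    show "\<bar>\<psi> (x \<omega>, \<rho> \<omega>)\<bar> \<le> C * (\<bar>L * (2 * R)\<bar> + \<bar>2 * L * \<delta>\<bar>)" if "\<omega> \<in> space M" for \<omega>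
    proof -
      have L0: "0 \<le> L" using order_trans[OF abs_ge_zero h(2)[of "axis undefined 1" 0]] by (simp add: norm_axis_1)
      have "\<bar>h y - h (x \<omega>)\<bar> \<le> L * (2 * R)"
        using order_trans[OF h(2)[of y "x \<omega>"] mult_left_mono[OF xy[OF that] L0]] .
      then have "\<bar>h y - h (x \<omega>) + 2 * L * \<delta>\<bar> \<le> \<bar>L * (2 * R)\<bar> + \<bar>2 * L * \<delta>\<bar>" by linarith
      then show ?thesis
        unfolding \<psi>_def abs_mult using \<rho>(2,3)[OF that] by (intro mult_mono) auto
    qed
    have "(\<integral>v. \<Phi> (a, v) \<partial>distr M ?B (\<lambda>\<omega>. (u i t \<omega>, 0))) = (\<integral>v. \<Phi> (a, (v, 0)) \<partial>distr M borel (u i t))" for a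
    proof -
      have "(\<lambda>v. \<Phi> (a, (v, 0))) \<in> borel_measurable borel"
        by (rule measurable_compose[OF _ \<Phi>m])
           (auto intro!: measurable_Pair simp: space_pair_measure simp del: borel_prod)
      moreover have "(\<lambda>v. \<Phi> (a, v)) \<in> borel_measurable ?B"
        by (rule measurable_compose[OF _ \<Phi>m])
           (auto intro!: measurable_Pair simp: space_pair_measure simp del: borel_prod)
      ultimately show ?thesis
        by (simp add: integral_distr del: borel_prod)
    qed
    moreover have "(\<integral>v. \<Phi> (a, (v, 0)) \<partial>distr M borel (u i t)) \<le> \<psi> a" for a
      unfolding draw_distr[OF t] \<Phi>_def \<psi>_def fst_conv snd_conv integral_mult_right_zero
      by (intro mult_left_mono loss_estimate_inner_integral[OF h \<delta>]) auto
    ultimately show "(\<integral>v. \<Phi> (a, v) \<partial>distr M ?B (\<lambda>\<omega>. (u i t \<omega>, 0))) \<le> \<psi> a" for a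
      by simp
  qed
  also have "expectation (\<lambda>\<omega>. \<Phi> ((x \<omega>, \<rho> \<omega>), (u i t \<omega>, 0)))
    = - expectation (\<lambda>\<omega>. \<rho> \<omega> * (loss_estimate \<delta> h (x \<omega>) (u i t \<omega>) \<bullet> (x \<omega> - y)))"
    unfolding integral_minus[symmetric]
    by (intro Bochner_Integration.integral_cong refl) (use \<rho>(2) in \<open>simp add: \<Phi>_def inner_diff_right algebra_simps\<close>)
  also have "expectation (\<lambda>\<omega>. \<psi> (x \<omega>, \<rho> \<omega>)) = - expectation (\<lambda>\<omega>. \<rho> \<omega> * (h (x \<omega>) - h y - 2 * L * \<delta>))"
    unfolding integral_minus[symmetric]
    by (intro Bochner_Integration.integral_cong refl) (use \<rho>(2) in \<open>simp add: \<psi>_def algebra_simps\<close>)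
  finally show "expectation (\<lambda>\<omega>. \<rho> \<omega> * (h (x \<omega>) - h y - 2 * L * \<delta>))
    \<le> expectation (\<lambda>\<omega>. \<rho> \<omega> * (loss_estimate \<delta> h (x \<omega>) (u i t \<omega>) \<bullet> (x \<omega> - y)))" by simp
qed

end

section \<open>Expected regret and constraint violation\<close>

text \<open>An induction that replaces the integral test: the increment of
  \<open>t powr (1 - s) / (1 - s)\<close> is at least \<open>t powr - s\<close>. After division this
  is Young's inequality for the ratio of consecutive integers and 1.\<close>

lemma sum_powr_le:
  assumes s: "0 \<le> s" "s < 1"
  shows "(\<Sum>t=1..T. real t powr - s) \<le> real T powr (1 - s) / (1 - s)"
proof (induction T)
  case (Suc T)
  define N where "N = real T + 1"
  have N: "N > 0" by (simp add: N_def)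
  have "real T powr (1 - s) \<le> N powr (1 - s) - (1 - s) * N powr - s"
  proof (cases "T = 0")
    case True
    then show ?thesis using s by (simp add: N_def)
  next
    case False
    have "(real T / N) powr (1 - s) * 1 powr s \<le> (1 - s) * (real T / N) + s * 1"
      using s False N by (intro Youngs_inequality_0) auto
    also have "\<dots> = 1 - (1 - s) / N" using N by (simp add: N_def field_simps)
    finally have "real T powr (1 - s) / N powr (1 - s) \<le> 1 - (1 - s) / N"
      using N by (simp add: powr_divide)
    then have "real T powr (1 - s) \<le> (1 - (1 - s) / N) * N powr (1 - s)"
      using N by (simp add: field_simps)
    also have "\<dots> = N powr (1 - s) - (1 - s) * (N powr (1 - s) / N powr 1)"
      using N by (simp add: field_simps)
    also have "N powr (1 - s) / N powr 1 = N powr - s" using powr_diff[of N "1 - s" 1] by simp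
    finally show ?thesis .
  qed
  then have "N powr - s \<le> (N powr (1 - s) - real T powr (1 - s)) / (1 - s)"
    using s by (simp add: pos_le_divide_eq mult.commute)
  then have "real T powr (1 - s) / (1 - s) + N powr - s \<le> N powr (1 - s) / (1 - s)"
    by (simp add: diff_divide_distrib)
  then show ?case using Suc by (simp add: N_def add.commute)
qed simp

lemma sum_inverse_le: "T \<ge> 1 \<Longrightarrow> (\<Sum>t=1..T. 1 / real t) \<le> 1 + ln (real T)"
proof (induction T rule: nat_induct_at_least)
  case (Suc T)
  have "ln (real T / real (Suc T)) \<le> real T / real (Suc T) - 1"
    using Suc by (intro ln_le_minus_one) auto
  also have "\<dots> = - 1 / real (Suc T)" by (simp add: field_simps)
  finally have "1 / real (Suc T) \<le> ln (real (Suc T)) - ln (real T)"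
    using Suc by (simp add: ln_div)
  then show ?case using Suc by simp
qed simp

lemma sum_powr_bounded:
  assumes "s > 1"
  obtains C where "C \<ge> 0" "\<And>T. (\<Sum>t=1..T. real t powr - s) \<le> C"
proof
  have "summable (\<lambda>t. real t powr - s)" using assms by (simp add: summable_real_powr_iff)
  then show "(\<Sum>t=1..T. real t powr - s) \<le> (\<Sum>t. real t powr - s)" for T
    by (intro sum_le_suminf) auto
  from this[of 0] show "0 \<le> (\<Sum>t. real t powr - s)" by simp
qed

section \<open>The stochastic model and its extended data\<close>

locale bandit = sphere_draws M u
  for M :: "'w measure" and u :: "'n::finite \<Rightarrow> nat \<Rightarrow> 'w \<Rightarrow> real ^ 'p" +
  fixes X :: "(real ^ 'p) set" and r R F\<^sub>1 F\<^sub>2 :: real and m :: "'n \<Rightarrow> nat"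
    and f :: "'n \<Rightarrow> nat \<Rightarrow> real ^ 'p \<Rightarrow> real" and g :: "'n \<Rightarrow> nat \<Rightarrow> real ^ 'p \<Rightarrow> nat \<Rightarrow> real"
    and E :: "nat \<Rightarrow> ('n \<times> 'n) set" and W :: "nat \<Rightarrow> real ^ 'n ^ 'n" and w :: real and B :: nat
    and \<alpha>\<^sub>0 \<theta>\<^sub>1 \<theta>\<^sub>2 \<theta>\<^sub>3 \<tau>\<^sub>0 :: real and \<alpha> \<beta> \<gamma> \<tau> \<xi> \<delta> :: "nat \<Rightarrow> real"
    and x\<^sub>1 :: "'n \<Rightarrow> real ^ 'p"
    and x x' :: "'w \<Rightarrow> 'n \<Rightarrow> nat \<Rightarrow> real ^ 'p" and q :: "'w \<Rightarrow> 'n \<Rightarrow> nat \<Rightarrow> nat \<Rightarrow> real"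
  assumes A1: "assumption1 X r R m f g F\<^sub>1 F\<^sub>2" and A2: "assumption2 E W w B"
    and feas: "feasibility X m g"
    and \<alpha>\<^sub>0: "\<alpha>\<^sub>0 > 0" and \<theta>\<^sub>1: "\<theta>\<^sub>1 \<in> {0<..<1}" and \<theta>\<^sub>2: "\<theta>\<^sub>2 \<in> {0<..<1}"
    and \<theta>\<^sub>3: "\<theta>\<^sub>3 > 0" and \<tau>\<^sub>0: "\<tau>\<^sub>0 \<ge> 0"
    and \<alpha>: "\<And>t. t \<ge> 1 \<Longrightarrow> \<alpha> t = \<alpha>\<^sub>0 / real t powr \<theta>\<^sub>1"
    and \<beta>: "\<And>t. t \<ge> 1 \<Longrightarrow> \<beta> t = 1 / real t powr \<theta>\<^sub>2"
    and \<gamma>: "\<And>t. t \<ge> 1 \<Longrightarrow> \<gamma> t = 1 / real t powr (1 - \<theta>\<^sub>2)"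
    and \<xi>: "\<And>t. t \<ge> 1 \<Longrightarrow> \<xi> t = 1 / (real t + 1)"
    and \<delta>: "\<And>t. t \<ge> 1 \<Longrightarrow> \<delta> t = r / (real t + 1)"
    and \<tau>: "\<And>t. t \<ge> 1 \<Longrightarrow> \<tau> t = \<tau>\<^sub>0 / real t powr \<theta>\<^sub>3"
    and algo: "\<And>\<omega>. \<omega> \<in> space M \<Longrightarrow>
      algorithm1 X r m f g W \<alpha> \<beta> \<gamma> \<tau> \<xi> \<delta> x\<^sub>1 (\<lambda>i t. u i t \<omega>) (x \<omega>) (x' \<omega>) (q \<omega>)"
begin

lemma X: "convex X" "closed X" "cball 0 r \<subseteq> X" "X \<subseteq> cball 0 R" and rR: "r > 0" "R > 0"
  using A1 by (auto simp: assumption1_def)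

lemma X_0: "0 \<in> X"
  using X(3) rR by auto

lemma f_diff: "t \<ge> 1 \<Longrightarrow> a \<in> X \<Longrightarrow> b \<in> X \<Longrightarrow> \<bar>f i t a - f i t b\<bar> \<le> F\<^sub>1"
  using A1 by (auto simp: assumption1_def)

lemma f_sub: "t \<ge> 1 \<Longrightarrow> a \<in> X \<Longrightarrow> \<exists>s. subgradient_on X (f i t) a s \<and> norm s \<le> F\<^sub>2"
  using A1 by (auto simp: assumption1_def)

lemma g_sub:
  assumes "t \<ge> 1" "a \<in> X" "k < m i"
  shows "\<exists>s. subgradient_on X (\<lambda>a. g i t a k) a s \<and> norm s \<le> F\<^sub>2"
proof -
  obtain A where A: "\<forall>k<m i. subgradient_on X (\<lambda>x'. g i t x' k) a (A k)" "spectral_norm (m i) A \<le> F\<^sub>2"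
    using A1 assms unfolding assumption1_def by blast
  show ?thesis
    using A(1) assms(3) order_trans[OF norm_column_le_spectral_norm[OF assms(3)] A(2)] by blast
qed

lemma g_bound:
  assumes "t \<ge> 1" "a \<in> X" "k < m i"
  shows "\<bar>g i t a k\<bar> \<le> F\<^sub>1"
proof -
  have "\<bar>g i t a k\<bar> \<le> L2_set (\<lambda>k. \<bar>g i t a k\<bar>) {..<m i}"
    using assms by (intro member_le_L2_set) auto
  also have "\<dots> = L2_set (g i t a) {..<m i}" by (simp add: L2_set_def)
  also have "\<dots> \<le> F\<^sub>1" using A1 assms by (auto simp: assumption1_def)
  finally show ?thesis .
qed

lemma F_nonneg: "0 \<le> F\<^sub>1" "0 \<le> F\<^sub>2"
  using f_diff[of 1 0 0] f_sub[of 1 0] X_0 by (auto intro: order_trans[OF norm_ge_zero])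

text \<open>The losses and constraints are only known on \<open>X\<close>; replacing them by global convex Lipschitz
  extensions does not change the algorithm, whose queries stay in \<open>X\<close>, and makes it measurable.\<close>

definition f_ext where
  "f_ext i t = (SOME h. convex_on UNIV h \<and> (\<forall>v w. \<bar>h v - h w\<bar> \<le> F\<^sub>2 * norm (v - w)) \<and> (\<forall>a\<in>X. h a = f i t a))"

definition g_ext where
  "g_ext i t k = (SOME h. convex_on UNIV h \<and> (\<forall>v w. \<bar>h v - h w\<bar> \<le> F\<^sub>2 * norm (v - w)) \<and> (\<forall>a\<in>X. h a = g i t a k))"

definition viol where "viol i t k a = max 0 (g_ext i t k a)"

lemma f_ext:
  assumes "t \<ge> 1"
  shows f_ext_convex: "convex_on UNIV (f_ext i t)"
    and f_ext_lipschitz: "\<bar>f_ext i t a - f_ext i t b\<bar> \<le> F\<^sub>2 * norm (a - b)"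
    and f_ext_eq: "a \<in> X \<Longrightarrow> f_ext i t a = f i t a"
proof -
  have "\<exists>h. convex_on UNIV h \<and> (\<forall>v w. \<bar>h v - h w\<bar> \<le> F\<^sub>2 * norm (v - w)) \<and> (\<forall>a\<in>X. h a = f i t a)"
    using convex_lipschitz_extension[of X "f i t" F\<^sub>2] f_sub[OF assms] X_0 by (metis empty_iff)
  from someI_ex[OF this] show "convex_on UNIV (f_ext i t)"
    "\<bar>f_ext i t a - f_ext i t b\<bar> \<le> F\<^sub>2 * norm (a - b)" "a \<in> X \<Longrightarrow> f_ext i t a = f i t a"
    unfolding f_ext_def by auto
qed

lemma viol:
  assumes "t \<ge> 1" "k < m i"
  shows viol_convex: "convex_on UNIV (viol i t k)"
    and viol_lipschitz: "\<bar>viol i t k a - viol i t k b\<bar> \<le> F\<^sub>2 * norm (a - b)"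
    and viol_eq: "a \<in> X \<Longrightarrow> viol i t k a = max 0 (g i t a k)"
proof -
  have "\<exists>h. convex_on UNIV h \<and> (\<forall>v w. \<bar>h v - h w\<bar> \<le> F\<^sub>2 * norm (v - w)) \<and> (\<forall>a\<in>X. h a = g i t a k)"
    using convex_lipschitz_extension[of X "\<lambda>a. g i t a k" F\<^sub>2] g_sub[OF assms(1) _ assms(2)] X_0 by (metis empty_iff)
  from someI_ex[OF this] have g: "convex_on UNIV (g_ext i t k)"
    "\<And>a b. \<bar>g_ext i t k a - g_ext i t k b\<bar> \<le> F\<^sub>2 * norm (a - b)" "\<And>a. a \<in> X \<Longrightarrow> g_ext i t k a = g i t a k"
    unfolding g_ext_def by auto
  show "convex_on UNIV (viol i t k)"
    unfolding viol_def using g(1) by (rule convex_on_max_0)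
  show "\<bar>viol i t k a - viol i t k b\<bar> \<le> F\<^sub>2 * norm (a - b)"
    using g(2)[of a b] unfolding viol_def by linarith
  show "a \<in> X \<Longrightarrow> viol i t k a = max 0 (g i t a k)" by (simp add: viol_def g(3))
qed

lemma viol_nonneg: "0 \<le> viol i t k a"
  by (simp add: viol_def)

sublocale sched: schedule E W w B X R "real CARD('p) * F\<^sub>2" F\<^sub>1 m \<alpha> \<beta> \<gamma> \<tau> \<xi>
proof
  fix t :: nat assume t: "t \<ge> 1"
  have mono: "real t powr s \<le> real (Suc t) powr s" if "0 \<le> s" for s
    using that by (intro powr_mono2) auto
  show "0 < \<alpha> t" "0 < \<beta> t" "0 < \<gamma> t" "0 \<le> \<tau> t" "0 < \<xi> t" "\<xi> t < 1" "\<xi> (Suc t) \<le> \<xi> t"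
    using t \<alpha>\<^sub>0 \<tau>\<^sub>0 by (auto simp: \<alpha> \<beta> \<gamma> \<tau> \<xi> intro!: divide_left_mono)
  show "\<alpha> (Suc t) \<le> \<alpha> t" "\<beta> (Suc t) \<le> \<beta> t"
    using t \<alpha>\<^sub>0 \<theta>\<^sub>1 \<theta>\<^sub>2 mono[of \<theta>\<^sub>1] mono[of \<theta>\<^sub>2] by (auto simp: \<alpha> \<beta> intro!: divide_left_mono)
  have "\<beta> t * \<gamma> t = 1 / real t"
    using t by (simp add: \<beta> \<gamma> flip: powr_add)
  then show "\<beta> t * \<gamma> t \<le> 1" using t by simp
  have split: "real s powr (1 - \<theta>\<^sub>2) = real s * (1 / real s powr \<theta>\<^sub>2)" if "s \<ge> 1" for s :: nat
    using that by (simp add: powr_diff)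
  \<comment> \<open>Splitting off one of \<open>t + 1\<close> equal summands shows that
    \<open>1 / \<gamma>\<close> grows by at most \<open>\<beta> (Suc t)\<close>. This is the reason
    for giving \<beta> and \<gamma> complementary exponents.\<close>
  have "real (Suc t) powr (1 - \<theta>\<^sub>2) = real t * (1 / real (Suc t) powr \<theta>\<^sub>2) + 1 / real (Suc t) powr \<theta>\<^sub>2"
    using split[of "Suc t"] by (simp add: add_divide_distrib)
  also have "\<dots> \<le> real t * (1 / real t powr \<theta>\<^sub>2) + 1 / real (Suc t) powr \<theta>\<^sub>2"
    using t mono[of \<theta>\<^sub>2] \<theta>\<^sub>2 by (intro add_right_mono mult_left_mono divide_left_mono) auto
  finally show "1 / \<gamma> (Suc t) \<le> 1 / \<gamma> t + \<beta> (Suc t)"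
    using t split[of t] by (simp add: \<gamma> \<beta>)
qed (use A2 X X_0 in auto)

section \<open>Iterates and query points stay in the constraint set\<close>

context
  fixes \<omega> assumes \<omega>: "\<omega> \<in> space M"
begin

lemma x_shrunk: "t \<ge> 1 \<Longrightarrow> x \<omega> i t \<in> (*\<^sub>R) (1 - \<xi> t) ` X"
proof (induction t rule: nat_induct_at_least)
  case base then show ?case using algo[OF \<omega>] by (simp add: algorithm1_def)
next
  case (Suc t)
  have "\<exists>a. x \<omega> i (Suc t) = closest_point ((*\<^sub>R) (1 - \<xi> (Suc t)) ` X) a"
    using algo[OF \<omega>] Suc by (auto simp: algorithm1_def Let_def)
  then show ?case
    using closest_point_in_set[OF sched.shrunk(2,3)] by metis
qed

lemma x_in: "t \<ge> 1 \<Longrightarrow> x \<omega> i t \<in> X"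
  using x_shrunk[of t i] sched.shrunk_subset[of "1 - \<xi> t"] sched.\<xi>[of t] by auto

text \<open>Since \<open>\<delta> t\<close> equals \<open>\<xi> t * r\<close>, the query is a convex
  combination of a point of \<open>X\<close> and a point of the inscribed sphere of radius
  \<open>r\<close>.\<close>

lemma perturbed_in:
  assumes t: "t \<ge> 1"
  shows "x \<omega> i t + \<delta> t *\<^sub>R u i t \<omega> \<in> X"
proof -
  obtain a where a: "a \<in> X" "x \<omega> i t = (1 - \<xi> t) *\<^sub>R a" using x_shrunk[OF t] by auto
  have "r *\<^sub>R u i t \<omega> \<in> X"
    using X(3) draw_norm[OF t \<omega>, of i] rR by (auto simp: subset_iff)
  then have "(1 - \<xi> t) *\<^sub>R a + \<xi> t *\<^sub>R (r *\<^sub>R u i t \<omega>) \<in> X"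
    using a X(1) sched.\<xi>(1,2)[OF t] by (intro convexD) auto
  moreover have "\<xi> t * r = \<delta> t" using t by (simp add: \<xi> \<delta>)
  ultimately show ?thesis by (simp add: a)
qed

lemma loss_estimate_eq:
  "t \<ge> 1 \<Longrightarrow> loss_estimate (\<delta> t) (f i t) (x \<omega> i t) (u i t \<omega>) = loss_estimate (\<delta> t) (f_ext i t) (x \<omega> i t) (u i t \<omega>)"
  by (simp add: loss_estimate_def f_ext_eq x_in perturbed_in)

lemma constr_estimate_eq:
  "t \<ge> 1 \<Longrightarrow> k < m i \<Longrightarrow>
    constr_estimate (\<delta> t) (g i t) (x \<omega> i t) (u i t \<omega>) k = loss_estimate (\<delta> t) (viol i t k) (x \<omega> i t) (u i t \<omega>)"
  by (simp add: constr_estimate_def loss_estimate_def viol_eq x_in perturbed_in)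

end

abbreviation df where "df \<omega> i t \<equiv> loss_estimate (\<delta> t) (f_ext i t) (x \<omega> i t) (u i t \<omega>)"
abbreviation dg where "dg \<omega> i t k \<equiv> loss_estimate (\<delta> t) (viol i t k) (x \<omega> i t) (u i t \<omega>)"

lemma algo_ext:
  assumes \<omega>: "\<omega> \<in> space M"
  shows "x \<omega> i 1 = x\<^sub>1 i" "x' \<omega> i 1 = x \<omega> i 1" "k < m i \<Longrightarrow> q \<omega> i 1 k = 0"
    and "t \<ge> 1 \<Longrightarrow> x \<omega> i (Suc t) = closest_point ((*\<^sub>R) (1 - \<xi> (Suc t)) ` X)
        ((\<Sum>j\<in>UNIV. W t $ i $ j *\<^sub>R x' \<omega> j t) - \<alpha> (Suc t) *\<^sub>R (df \<omega> i t + (\<Sum>k<m i. q \<omega> i t k *\<^sub>R dg \<omega> i t k)))"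
    and "t \<ge> 1 \<Longrightarrow> k < m i \<Longrightarrow> q \<omega> i (Suc t) k =
        max 0 ((1 - \<beta> (Suc t) * \<gamma> (Suc t)) * q \<omega> i t k
          + \<gamma> (Suc t) * (viol i t k (x \<omega> i t) + dg \<omega> i t k \<bullet> (x \<omega> i (Suc t) - x \<omega> i t)))"
    and "t \<ge> 1 \<Longrightarrow> x' \<omega> i (Suc t) = (if norm (x \<omega> i (Suc t) - x' \<omega> i t) \<ge> \<tau> (Suc t) then x \<omega> i (Suc t) else x' \<omega> i t)"
  using algo[OF \<omega>] \<omega>
  by (simp_all add: algorithm1_def Let_def loss_estimate_eq constr_estimate_eq viol_eq x_in)

lemma \<delta>_pos: "t \<ge> 1 \<Longrightarrow> \<delta> t > 0"
  using rR by (simp add: \<delta>)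

lemma iterates_axioms:
  assumes \<omega>: "\<omega> \<in> space M"
  shows "iterates E W w B X R (real CARD('p) * F\<^sub>2) F\<^sub>1 m \<alpha> \<beta> \<gamma> \<tau> \<xi> (x \<omega>) (x' \<omega>) (q \<omega>) (df \<omega>) (dg \<omega>)
    (\<lambda>i t k. viol i t k (x \<omega> i t))"
proof
  fix t :: nat and i k assume t: "t \<ge> 1"
  show "norm (df \<omega> i t) \<le> real CARD('p) * F\<^sub>2"
    by (intro norm_loss_estimate_le f_ext_lipschitz t \<delta>_pos draw_norm \<omega>)
  show "norm (dg \<omega> i t k) \<le> real CARD('p) * F\<^sub>2" if "k < m i"
    by (intro norm_loss_estimate_le viol_lipschitz t that \<delta>_pos draw_norm \<omega>)
  show "viol i t k (x \<omega> i t) \<le> F\<^sub>1" if "k < m i"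
    using abs_le_D1[OF g_bound[OF t x_in[OF \<omega> t] that]] F_nonneg
    unfolding viol_eq[OF t that x_in[OF \<omega> t]] by simp
qed (use algo_ext[OF \<omega>] x_shrunk[OF \<omega>] viol_nonneg in auto)

text \<open>The three families feed into each other, so the induction is joint. Projection onto a
  closed convex set is continuous, hence measurable. The recursions hold only on
  \<open>space M\<close> and for \<open>k < m i\<close>, so each step passes through
  \<open>measurable_cong\<close>.\<close>

lemma iterates_measurable:
  assumes "t \<ge> 1"
  shows "(\<forall>i. (\<lambda>\<omega>. x \<omega> i t) \<in> borel_measurable (past t)) \<and> (\<forall>i. (\<lambda>\<omega>. x' \<omega> i t) \<in> borel_measurable (past t))
    \<and> (\<forall>i. \<forall>k<m i. (\<lambda>\<omega>. q \<omega> i t k) \<in> borel_measurable (past t))"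
  using assms
proof (induction t rule: nat_induct_at_least)
  case base
  have "(\<lambda>\<omega>. x \<omega> i 1) \<in> borel_measurable (past 1) \<longleftrightarrow> (\<lambda>\<omega>. x\<^sub>1 i) \<in> borel_measurable (past 1)" for i
    by (rule measurable_cong) (use algo_ext in auto)
  moreover have "(\<lambda>\<omega>. x' \<omega> i 1) \<in> borel_measurable (past 1) \<longleftrightarrow> (\<lambda>\<omega>. x\<^sub>1 i) \<in> borel_measurable (past 1)" for i
    by (rule measurable_cong) (use algo_ext in auto)
  moreover have "(\<lambda>\<omega>. q \<omega> i 1 k) \<in> borel_measurable (past 1) \<longleftrightarrow> (\<lambda>\<omega>. 0::real) \<in> borel_measurable (past 1)"
    if "k < m i" for i k
    by (rule measurable_cong) (use algo_ext(3) that in auto)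
  ultimately show ?case by simp
next
  case (Suc t)
  let ?P = "past (Suc t)"
  have sub: "h \<in> measurable ?P N" if "h \<in> measurable (past t) N" for h and N :: "'c measure"
    using that by (rule measurable_from_subalg[OF past_mono, rotated]) simp
  have xm[measurable]: "(\<lambda>\<omega>. x \<omega> i t) \<in> borel_measurable ?P" "(\<lambda>\<omega>. x' \<omega> i t) \<in> borel_measurable ?P" for i
    using Suc by (auto intro: sub)
  have qm: "(\<lambda>\<omega>. q \<omega> i t k) \<in> borel_measurable ?P" if "k < m i" for i k
    using Suc that by (auto intro: sub)
  have um[measurable]: "u i t \<in> borel_measurable ?P" for i
    using Suc by (intro draw_past) auto
  have fm[measurable]: "f_ext i t \<in> borel_measurable borel" for i
    by (rule borel_measurable_lipschitz[OF f_ext_lipschitz]) (use Suc in simp)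
  have gm: "viol i t k \<in> borel_measurable borel" if "k < m i" for i k
    by (rule borel_measurable_lipschitz[OF viol_lipschitz]) (use Suc that in simp_all)
  have df[measurable]: "(\<lambda>\<omega>. df \<omega> i t) \<in> borel_measurable ?P" for i
    unfolding loss_estimate_def by measurable
  have dg: "(\<lambda>\<omega>. dg \<omega> i t k) \<in> borel_measurable ?P" if "k < m i" for i k
  proof -
    note [measurable] = gm[OF that]
    show ?thesis unfolding loss_estimate_def by measurable
  qed
  have cpm: "closest_point ((*\<^sub>R) s ` X) \<in> borel_measurable borel" for s
    by (intro borel_measurable_continuous_onI continuous_on_closest_point sched.shrunk)
  have x: "(\<lambda>\<omega>. x \<omega> i (Suc t)) \<in> borel_measurable ?P" for i
  proof -
    let ?a = "\<lambda>\<omega>. (\<Sum>j\<in>UNIV. W t $ i $ j *\<^sub>R x' \<omega> j t) - \<alpha> (Suc t) *\<^sub>R (df \<omega> i t + (\<Sum>k<m i. q \<omega> i t k *\<^sub>R dg \<omega> i t k))"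
    have "?a \<in> borel_measurable ?P"
      by (intro borel_measurable_diff borel_measurable_sum borel_measurable_scaleR borel_measurable_add borel_measurable_const
          xm df qm dg) auto
    from measurable_compose[OF this cpm[of "1 - \<xi> (Suc t)"]]
    show ?thesis
      by (rule measurable_cong[THEN iffD1, rotated]) (use algo_ext(4) Suc in auto)
  qed
  have x': "(\<lambda>\<omega>. x' \<omega> i (Suc t)) \<in> borel_measurable ?P" for i
  proof -
    note [measurable] = x
    have "(\<lambda>\<omega>. if norm (x \<omega> i (Suc t) - x' \<omega> i t) \<ge> \<tau> (Suc t) then x \<omega> i (Suc t) else x' \<omega> i t) \<in> borel_measurable ?P"
      by measurable
    then show ?thesis
      by (rule measurable_cong[THEN iffD1, rotated]) (use algo_ext(6) Suc in auto)
  qed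
  have q: "(\<lambda>\<omega>. q \<omega> i (Suc t) k) \<in> borel_measurable ?P" if k: "k < m i" for i k
  proof -
    note [measurable] = x qm[OF k] dg[OF k] gm[OF k]
    have "(\<lambda>\<omega>. max 0 ((1 - \<beta> (Suc t) * \<gamma> (Suc t)) * q \<omega> i t k
        + \<gamma> (Suc t) * (viol i t k (x \<omega> i t) + dg \<omega> i t k \<bullet> (x \<omega> i (Suc t) - x \<omega> i t)))) \<in> borel_measurable ?P"
      by measurable
    then show ?thesis
      by (rule measurable_cong[THEN iffD1, rotated]) (use algo_ext(5) Suc k in auto)
  qed
  show ?case using x x' q by blast
qed

section \<open>Integrability and the expectation of the linear terms\<close>

lemma x_past: "t \<ge> 1 \<Longrightarrow> (\<lambda>\<omega>. x \<omega> i t) \<in> borel_measurable (past t)"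
  and q_past: "t \<ge> 1 \<Longrightarrow> k < m i \<Longrightarrow> (\<lambda>\<omega>. q \<omega> i t k) \<in> borel_measurable (past t)"
  using iterates_measurable by auto

lemma x_measurable: "t \<ge> 1 \<Longrightarrow> (\<lambda>\<omega>. x \<omega> i t) \<in> borel_measurable M"
  using past_imp_measurable[OF x_past] .

lemma x_norm: "t \<ge> 1 \<Longrightarrow> \<omega> \<in> space M \<Longrightarrow> norm (x \<omega> i t) \<le> R"
  using x_in[of \<omega> t i] X(4) by (auto simp: subset_iff)

lemma q_bounds:
  assumes "t \<ge> 1" "\<omega> \<in> space M" "k < m i"
  shows "0 \<le> q \<omega> i t k" "q \<omega> i t k \<le> sched.qb * real t powr \<theta>\<^sub>2"
proof -
  interpret I: iterates E W w B X R "real CARD('p) * F\<^sub>2" F\<^sub>1 m \<alpha> \<beta> \<gamma> \<tau> \<xi> "x \<omega>" "x' \<omega>" "q \<omega>" "df \<omega>" "dg \<omega>"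
    "\<lambda>i t k. viol i t k (x \<omega> i t)"
    using assms(2) by (rule iterates_axioms)
  show "0 \<le> q \<omega> i t k" "q \<omega> i t k \<le> sched.qb * real t powr \<theta>\<^sub>2"
    using I.q_bounds[OF assms(1,3)] assms(1) by (simp_all add: \<beta> field_simps)
qed

lemma qb_nonneg: "0 \<le> sched.qb"
  using F_nonneg rR by (simp add: sched.qb_def)

lemma lipschitz_integrable:
  fixes h :: "real ^ 'p \<Rightarrow> real"
  assumes "\<And>v w. \<bar>h v - h w\<bar> \<le> F\<^sub>2 * norm (v - w)" and t: "t \<ge> 1"
  shows "integrable M (\<lambda>\<omega>. h (x \<omega> i t))"
proof (rule integrable_const_bound[of _ "\<bar>h 0\<bar> + F\<^sub>2 * R"])
  show "AE \<omega> in M. norm (h (x \<omega> i t)) \<le> \<bar>h 0\<bar> + F\<^sub>2 * R"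
  proof (rule AE_I2)
    fix \<omega> assume "\<omega> \<in> space M"
    then show "norm (h (x \<omega> i t)) \<le> \<bar>h 0\<bar> + F\<^sub>2 * R"
      using assms(1)[of "x \<omega> i t" 0] mult_left_mono[OF x_norm[OF t] F_nonneg(2), of \<omega> i] by simp
  qed
  show "(\<lambda>\<omega>. h (x \<omega> i t)) \<in> borel_measurable M"
    using measurable_compose[OF x_measurable[OF t] borel_measurable_lipschitz[OF assms(1)]] .
qed

lemma f_ext_integrable: "t \<ge> 1 \<Longrightarrow> integrable M (\<lambda>\<omega>. f_ext j t (x \<omega> i t))"
  by (intro lipschitz_integrable f_ext_lipschitz)

lemma viol_integrable: "t \<ge> 1 \<Longrightarrow> k < m j \<Longrightarrow> integrable M (\<lambda>\<omega>. viol j t k (x \<omega> i t))"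
  by (intro lipschitz_integrable viol_lipschitz)

text \<open>The pathwise \<open>lin\<close> as a function of the sample point, to be
  integrated.\<close>

definition lin where
  "lin \<omega> i t v = df \<omega> i t \<bullet> (x \<omega> i t - v)
    + (\<Sum>k<m i. q \<omega> i t k * (dg \<omega> i t k \<bullet> (x \<omega> i t - v) - viol i t k (x \<omega> i t)))"

text \<open>The price of smoothing and of shrinking the comparator; the dual variable, which may grow like
  \<open>t powr \<theta>\<^sub>2\<close>, amplifies it.\<close>

definition bias where
  "bias i t = (1 + real (m i) * (sched.qb * real t powr \<theta>\<^sub>2)) * (F\<^sub>2 * (R * \<xi> (Suc t) + 2 * \<delta> t))"

text \<open>The estimates are compared with the shrunk point \<open>v\<close>, and the Lipschitz
  bound carries the result to \<open>y\<close>. For a constraint the average returns the weighted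
  violation at the iterate, which cancels the one subtracted in \<open>lin\<close>. There remains
  the dual variable times the violation at \<open>v\<close> plus the smoothing error; it is small
  because the violation at \<open>y\<close> is zero.\<close>

lemma lin_expectation:
  assumes t: "t \<ge> 1" and y: "y \<in> X" "\<And>k. k < m i \<Longrightarrow> g i t y k \<le> 0"
  defines "v \<equiv> (1 - \<xi> (Suc t)) *\<^sub>R y"
  shows "integrable M (\<lambda>\<omega>. lin \<omega> i t v)"
    and "expectation (\<lambda>\<omega>. f_ext i t (x \<omega> i t)) - f i t y - bias i t \<le> expectation (\<lambda>\<omega>. lin \<omega> i t v)"
proof -
  have \<xi>1: "0 < \<xi> (Suc t)" "\<xi> (Suc t) < 1" using sched.\<xi>[of "Suc t"] by auto
  have yR: "norm y \<le> R" using y(1) X(4) by (auto simp: subset_iff)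
  have "(1 - \<xi> (Suc t)) * norm y \<le> 1 * norm y" using \<xi>1 by (intro mult_right_mono) auto
  then have vR: "norm v \<le> R" using \<xi>1 yR by (simp add: v_def)
  have "v - y = - (\<xi> (Suc t) *\<^sub>R y)" by (simp add: v_def algebra_simps)
  then have vy: "F\<^sub>2 * norm (v - y) \<le> F\<^sub>2 * (R * \<xi> (Suc t))"
    using \<xi>1 yR F_nonneg by (intro mult_left_mono) (auto simp: mult.commute)
  have estf: "expectation (\<lambda>\<omega>. 1 * (f_ext i t (x \<omega> i t) - f_ext i t v - 2 * F\<^sub>2 * \<delta> t))
      \<le> expectation (\<lambda>\<omega>. 1 * (df \<omega> i t \<bullet> (x \<omega> i t - v)))"
    "integrable M (\<lambda>\<omega>. 1 * (df \<omega> i t \<bullet> (x \<omega> i t - v)))"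
    by (rule loss_estimate_expectation[OF t \<delta>_pos[OF t] f_ext_convex[OF t] f_ext_lipschitz[OF t] x_past[OF t] _ _ _ _ vR,
          where C = 1]; simp add: x_norm[OF t])+
  have estq: "expectation (\<lambda>\<omega>. q \<omega> i t k * (viol i t k (x \<omega> i t) - viol i t k v - 2 * F\<^sub>2 * \<delta> t))
      \<le> expectation (\<lambda>\<omega>. q \<omega> i t k * (dg \<omega> i t k \<bullet> (x \<omega> i t - v)))" if k: "k < m i" for k
    by (rule loss_estimate_expectation(1)[OF t \<delta>_pos[OF t] viol_convex[OF t k] viol_lipschitz[OF t k] x_past[OF t] _
          q_past[OF t k] q_bounds(1)[OF t _ k] q_bounds(2)[OF t _ k] vR]; (assumption | rule x_norm[OF t]))
  have estqi: "integrable M (\<lambda>\<omega>. q \<omega> i t k * (dg \<omega> i t k \<bullet> (x \<omega> i t - v)))" if k: "k < m i" for k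
    by (rule loss_estimate_expectation(2)[OF t \<delta>_pos[OF t] viol_convex[OF t k] viol_lipschitz[OF t k] x_past[OF t] _
          q_past[OF t k] q_bounds(1)[OF t _ k] q_bounds(2)[OF t _ k] vR]; (assumption | rule x_norm[OF t]))
  let ?Q = "sched.qb * real t powr \<theta>\<^sub>2" and ?b = "F\<^sub>2 * (R * \<xi> (Suc t) + 2 * \<delta> t)"
  have b0: "0 \<le> ?b" using F_nonneg rR \<xi>1 \<delta>_pos[OF t] by simp
  have qi: "integrable M (\<lambda>\<omega>. q \<omega> i t k)" if "k < m i" for k
    using q_bounds[OF t _ that] past_imp_measurable[OF q_past[OF t that]]
    by (intro integrable_const_bound[of _ ?Q]) auto
  have qvi: "integrable M (\<lambda>\<omega>. q \<omega> i t k * viol i t k (x \<omega> i t))" if k: "k < m i" for k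
  proof (rule Bochner_Integration.integrable_bound[OF integrable_mult_right[OF viol_integrable[OF t k, of i], of ?Q]])
    show "(\<lambda>\<omega>. q \<omega> i t k * viol i t k (x \<omega> i t)) \<in> borel_measurable M"
      using past_imp_measurable[OF q_past[OF t k]] viol_integrable[OF t k] by simp
    show "AE \<omega> in M. norm (q \<omega> i t k * viol i t k (x \<omega> i t)) \<le> norm (?Q * viol i t k (x \<omega> i t))"
    proof (rule AE_I2)
      fix \<omega> assume \<omega>: "\<omega> \<in> space M"
      have "q \<omega> i t k * viol i t k (x \<omega> i t) \<le> ?Q * viol i t k (x \<omega> i t)"
        by (intro mult_right_mono q_bounds(2)[OF t \<omega> k] viol_nonneg)
      then show "norm (q \<omega> i t k * viol i t k (x \<omega> i t)) \<le> norm (?Q * viol i t k (x \<omega> i t))"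
        using q_bounds(1)[OF t \<omega> k] viol_nonneg[of i t k "x \<omega> i t"] qb_nonneg by (simp add: abs_mult)
    qed
  qed
  have lin_k: "- (?Q * ?b) \<le> expectation (\<lambda>\<omega>. q \<omega> i t k * (dg \<omega> i t k \<bullet> (x \<omega> i t - v)) - q \<omega> i t k * viol i t k (x \<omega> i t))"
    if k: "k < m i" for k
  proof -
    let ?V = "viol i t k"
    have "?V y = 0" using y t k by (simp add: viol_eq)
    then have "?V v \<le> F\<^sub>2 * (R * \<xi> (Suc t))"
      using viol_lipschitz[OF t k, of v y] vy by (simp add: abs_le_iff)
    then have Vb: "?V v + 2 * F\<^sub>2 * \<delta> t \<le> ?b" by (simp add: algebra_simps)
    have V0: "0 \<le> ?V v + 2 * F\<^sub>2 * \<delta> t" using viol_nonneg[of i t k v] F_nonneg \<delta>_pos[OF t] by simp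
    have "expectation (\<lambda>\<omega>. q \<omega> i t k) \<le> expectation (\<lambda>\<omega>. ?Q)"
      using q_bounds[OF t _ k] by (intro integral_mono qi[OF k]) auto
    then have Eq: "expectation (\<lambda>\<omega>. q \<omega> i t k) \<le> ?Q" by (simp add: prob_space)
    have "- (?Q * ?b) \<le> - (expectation (\<lambda>\<omega>. q \<omega> i t k) * (?V v + 2 * F\<^sub>2 * \<delta> t))"
      using Eq Vb V0 qb_nonneg by (simp, intro mult_mono) auto
    also have "\<dots> = expectation (\<lambda>\<omega>. q \<omega> i t k * (?V (x \<omega> i t) - ?V v - 2 * F\<^sub>2 * \<delta> t)) - expectation (\<lambda>\<omega>. q \<omega> i t k * ?V (x \<omega> i t))"
    proof -
      have "(\<lambda>\<omega>. q \<omega> i t k * (?V (x \<omega> i t) - ?V v - 2 * F\<^sub>2 * \<delta> t))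
        = (\<lambda>\<omega>. q \<omega> i t k * ?V (x \<omega> i t) - q \<omega> i t k * (?V v + 2 * F\<^sub>2 * \<delta> t))"
        by (simp add: algebra_simps)
      then show ?thesis using qvi[OF k] qi[OF k] by simp
    qed
    also have "\<dots> \<le> expectation (\<lambda>\<omega>. q \<omega> i t k * (dg \<omega> i t k \<bullet> (x \<omega> i t - v))) - expectation (\<lambda>\<omega>. q \<omega> i t k * ?V (x \<omega> i t))"
      by (intro diff_right_mono estq[OF k])
    also have "\<dots> = expectation (\<lambda>\<omega>. q \<omega> i t k * (dg \<omega> i t k \<bullet> (x \<omega> i t - v)) - q \<omega> i t k * ?V (x \<omega> i t))"
      by (intro Bochner_Integration.integral_diff[symmetric] estqi[OF k] qvi[OF k])
    finally show ?thesis .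
  qed
  have int_k: "integrable M (\<lambda>\<omega>. q \<omega> i t k * (dg \<omega> i t k \<bullet> (x \<omega> i t - v)) - q \<omega> i t k * viol i t k (x \<omega> i t))"
    if k: "k < m i" for k
    by (intro Bochner_Integration.integrable_diff estqi[OF k] qvi[OF k])
  have lin: "(\<lambda>\<omega>. lin \<omega> i t v) = (\<lambda>\<omega>. df \<omega> i t \<bullet> (x \<omega> i t - v)
      + (\<Sum>k<m i. q \<omega> i t k * (dg \<omega> i t k \<bullet> (x \<omega> i t - v)) - q \<omega> i t k * viol i t k (x \<omega> i t)))"
    by (simp add: lin_def right_diff_distrib)
  have intf: "integrable M (\<lambda>\<omega>. df \<omega> i t \<bullet> (x \<omega> i t - v))" using estf(2) by simp
  show "integrable M (\<lambda>\<omega>. lin \<omega> i t v)"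
    unfolding lin using intf int_k by (intro Bochner_Integration.integrable_add Bochner_Integration.integrable_sum) auto
  have "expectation (\<lambda>\<omega>. f_ext i t (x \<omega> i t)) - f i t y - ?b \<le> expectation (\<lambda>\<omega>. f_ext i t (x \<omega> i t) - f_ext i t v - 2 * F\<^sub>2 * \<delta> t)"
    using f_ext_lipschitz[OF t, of i v y] vy f_ext_eq[OF t y(1), of i] f_ext_integrable[OF t, of i i]
    by (simp add: prob_space abs_le_iff algebra_simps)
  also have "\<dots> \<le> expectation (\<lambda>\<omega>. df \<omega> i t \<bullet> (x \<omega> i t - v))"
    using estf(1) by simp
  finally have 1: "expectation (\<lambda>\<omega>. f_ext i t (x \<omega> i t)) - f i t y - ?b \<le> expectation (\<lambda>\<omega>. df \<omega> i t \<bullet> (x \<omega> i t - v))" .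
  have "(\<Sum>k<m i. - (?Q * ?b)) \<le> (\<Sum>k<m i. expectation (\<lambda>\<omega>. q \<omega> i t k * (dg \<omega> i t k \<bullet> (x \<omega> i t - v)) - q \<omega> i t k * viol i t k (x \<omega> i t)))"
    by (intro sum_mono lin_k) auto
  then have 2: "- (real (m i) * (?Q * ?b)) \<le> (\<Sum>k<m i. expectation (\<lambda>\<omega>. q \<omega> i t k * (dg \<omega> i t k \<bullet> (x \<omega> i t - v)) - q \<omega> i t k * viol i t k (x \<omega> i t)))"
    by simp
  have 3: "expectation (\<lambda>\<omega>. lin \<omega> i t v) = expectation (\<lambda>\<omega>. df \<omega> i t \<bullet> (x \<omega> i t - v))
      + (\<Sum>k<m i. expectation (\<lambda>\<omega>. q \<omega> i t k * (dg \<omega> i t k \<bullet> (x \<omega> i t - v)) - q \<omega> i t k * viol i t k (x \<omega> i t)))"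
    unfolding lin using intf int_k
    by (subst Bochner_Integration.integral_add) (auto simp: Bochner_Integration.integral_sum)
  have "bias i t = ?b + real (m i) * (?Q * ?b)" by (simp add: bias_def algebra_simps)
  with 1 2 3 show "expectation (\<lambda>\<omega>. f_ext i t (x \<omega> i t)) - f i t y - bias i t \<le> expectation (\<lambda>\<omega>. lin \<omega> i t v)"
    by linarith
qed

section \<open>Performance measures in terms of each agent's own functions\<close>

definition disagree where "disagree \<omega> t = (\<Sum>i\<in>UNIV. \<Sum>j\<in>UNIV. norm (x \<omega> i t - x \<omega> j t))"

definition regret_terms where
  "regret_terms \<omega> T y = (\<Sum>t=1..T. \<Sum>i\<in>UNIV. lin \<omega> i t ((1 - \<xi> (Suc t)) *\<^sub>R y t))"

definition total_bias where "total_bias T = (\<Sum>t=1..T. \<Sum>i\<in>UNIV. bias i t)"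

lemma feasible: "y \<in> feasible_seqs X m g T \<Longrightarrow> 1 \<le> t \<Longrightarrow> t \<le> T \<Longrightarrow> y t \<in> X \<and> (\<forall>i. \<forall>k<m i. g i t (y t) k \<le> 0)"
  by (auto simp: feasible_seqs_def constr_index_def global_constr_def)

lemma regret_terms_expectation:
  assumes y: "y \<in> feasible_seqs X m g T"
  shows "integrable M (\<lambda>\<omega>. regret_terms \<omega> T y)"
    and "(\<Sum>t=1..T. \<Sum>i\<in>UNIV. expectation (\<lambda>\<omega>. f_ext i t (x \<omega> i t)) - f i t (y t)) - total_bias T
      \<le> expectation (\<lambda>\<omega>. regret_terms \<omega> T y)"
proof -
  have i: "integrable M (\<lambda>\<omega>. lin \<omega> i t ((1 - \<xi> (Suc t)) *\<^sub>R y t))" if "t \<in> {1..T}" for t i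
    using feasible[OF y] that by (intro lin_expectation(1)) auto
  show "integrable M (\<lambda>\<omega>. regret_terms \<omega> T y)"
    unfolding regret_terms_def by (intro Bochner_Integration.integrable_sum i)
  have "(\<Sum>t=1..T. \<Sum>i\<in>UNIV. expectation (\<lambda>\<omega>. f_ext i t (x \<omega> i t)) - f i t (y t)) - total_bias T
    = (\<Sum>t=1..T. \<Sum>i\<in>UNIV. expectation (\<lambda>\<omega>. f_ext i t (x \<omega> i t)) - f i t (y t) - bias i t)"
    by (simp add: total_bias_def sum_subtractf)
  also have "\<dots> \<le> (\<Sum>t=1..T. \<Sum>i\<in>UNIV. expectation (\<lambda>\<omega>. lin \<omega> i t ((1 - \<xi> (Suc t)) *\<^sub>R y t)))"
    using feasible[OF y] by (intro sum_mono lin_expectation(2)) auto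
  also have "\<dots> = expectation (\<lambda>\<omega>. regret_terms \<omega> T y)"
    unfolding regret_terms_def using i
    by (subst Bochner_Integration.integral_sum) (auto intro!: sum.cong Bochner_Integration.integrable_sum)
  finally show "(\<Sum>t=1..T. \<Sum>i\<in>UNIV. expectation (\<lambda>\<omega>. f_ext i t (x \<omega> i t)) - f i t (y t)) - total_bias T
      \<le> expectation (\<lambda>\<omega>. regret_terms \<omega> T y)" .
qed

text \<open>The regret evaluates every loss at every agent's decision, the pathwise analysis only at
  its owner's. The exchange costs the Lipschitz constant times the distance of the two
  agents.\<close>

lemma net_reg_le:
  assumes \<omega>: "\<omega> \<in> space M"
  shows "real CARD('n) * net_reg f T (x \<omega>) y
    \<le> (\<Sum>t=1..T. \<Sum>i\<in>UNIV. f_ext i t (x \<omega> i t) - f i t (y t)) + F\<^sub>2 * (\<Sum>t=1..T. disagree \<omega> t)"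
proof -
  let ?n = "real CARD('n)"
  have n: "?n \<ge> 1" by (simp add: Suc_leI)
  have step: "(\<Sum>i\<in>UNIV. global_loss f t (x \<omega> i t)) - ?n * global_loss f t (y t)
    \<le> (\<Sum>i\<in>UNIV. f_ext i t (x \<omega> i t) - f i t (y t)) + F\<^sub>2 * disagree \<omega> t" if t: "t \<ge> 1" for t
  proof -
    have "(\<Sum>i\<in>UNIV. global_loss f t (x \<omega> i t)) = (\<Sum>i\<in>UNIV. \<Sum>j\<in>UNIV. f_ext j t (x \<omega> i t)) / ?n"
      using t by (simp add: global_loss_def sum_divide_distrib f_ext_eq x_in[OF \<omega>])
    also have "\<dots> \<le> (\<Sum>i\<in>(UNIV::'n set). \<Sum>j\<in>UNIV. f_ext j t (x \<omega> j t) + F\<^sub>2 * norm (x \<omega> i t - x \<omega> j t)) / ?n"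
    proof (intro divide_right_mono sum_mono)
      show "f_ext j t (x \<omega> i t) \<le> f_ext j t (x \<omega> j t) + F\<^sub>2 * norm (x \<omega> i t - x \<omega> j t)" for i j
        using f_ext_lipschitz[OF t, of j "x \<omega> i t" "x \<omega> j t"] by (simp add: abs_le_iff)
    qed simp
    also have "\<dots> = (\<Sum>j\<in>UNIV. f_ext j t (x \<omega> j t)) + F\<^sub>2 * disagree \<omega> t / ?n"
      by (simp add: sum.distrib add_divide_distrib disagree_def sum_distrib_left[symmetric])
    also have "F\<^sub>2 * disagree \<omega> t / ?n \<le> F\<^sub>2 * disagree \<omega> t / 1"
      using n F_nonneg by (intro divide_left_mono mult_nonneg_nonneg) (auto simp: disagree_def intro!: sum_nonneg)
    finally show ?thesis by (simp add: global_loss_def sum_subtractf)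
  qed
  have "?n * net_reg f T (x \<omega>) y = (\<Sum>t=1..T. (\<Sum>i\<in>UNIV. global_loss f t (x \<omega> i t)) - ?n * global_loss f t (y t))"
    unfolding net_reg_def right_diff_distrib sum_subtractf sum_distrib_left
    by (subst sum.swap) simp
  also have "\<dots> \<le> (\<Sum>t=1..T. (\<Sum>i\<in>UNIV. f_ext i t (x \<omega> i t) - f i t (y t)) + F\<^sub>2 * disagree \<omega> t)"
    using step by (intro sum_mono) auto
  finally show ?thesis by (simp add: sum.distrib sum_distrib_left)
qed

text \<open>The Euclidean norm is at most the sum of the entries. Each constraint is then moved to
  the decision of its owner, as for the losses.\<close>

lemma net_ccv_le:
  assumes \<omega>: "\<omega> \<in> space M"
  shows "net_ccv m g T (x \<omega>)
    \<le> (\<Sum>t=1..T. \<Sum>i\<in>UNIV. \<Sum>k<m i. viol i t k (x \<omega> i t)) + sched.m_total * F\<^sub>2 * (\<Sum>t=1..T. disagree \<omega> t)"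
proof -
  let ?n = "real CARD('n)"
  have n: "?n \<ge> 1" by (simp add: Suc_leI)
  have step: "(\<Sum>i\<in>UNIV. L2_set (\<lambda>jk. max 0 (global_constr g t (x \<omega> i t) jk)) (constr_index m))
    \<le> ?n * (\<Sum>j\<in>UNIV. \<Sum>k<m j. viol j t k (x \<omega> j t)) + sched.m_total * F\<^sub>2 * disagree \<omega> t" if t: "t \<ge> 1" for t
  proof -
    have "(\<Sum>i\<in>UNIV. L2_set (\<lambda>jk. max 0 (global_constr g t (x \<omega> i t) jk)) (constr_index m))
      \<le> (\<Sum>i\<in>UNIV. \<Sum>j\<in>UNIV. \<Sum>k<m j. viol j t k (x \<omega> i t))"
    proof (rule sum_mono)
      fix i
      have "L2_set (\<lambda>jk. max 0 (global_constr g t (x \<omega> i t) jk)) (constr_index m)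
        \<le> (\<Sum>jk\<in>constr_index m. max 0 (global_constr g t (x \<omega> i t) jk))"
        by (rule L2_set_le_sum) auto
      also have "\<dots> = (\<Sum>(j, k)\<in>constr_index m. viol j t k (x \<omega> i t))"
        using t by (intro sum.cong refl) (auto simp: global_constr_def constr_index_def viol_eq x_in[OF \<omega>])
      also have "\<dots> = (\<Sum>j\<in>UNIV. \<Sum>k<m j. viol j t k (x \<omega> i t))"
        unfolding constr_index_def by (subst sum.Sigma) auto
      finally show "L2_set (\<lambda>jk. max 0 (global_constr g t (x \<omega> i t) jk)) (constr_index m) \<le> \<dots>" .
    qed
    also have "\<dots> \<le> (\<Sum>i\<in>UNIV. \<Sum>j\<in>UNIV. (\<Sum>k<m j. viol j t k (x \<omega> j t)) + sched.m_total * F\<^sub>2 * norm (x \<omega> i t - x \<omega> j t))"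
    proof (intro sum_mono)
      fix i j
      have "(\<Sum>k<m j. viol j t k (x \<omega> i t)) \<le> (\<Sum>k<m j. viol j t k (x \<omega> j t) + F\<^sub>2 * norm (x \<omega> i t - x \<omega> j t))"
        using viol_lipschitz[OF t, of _ j "x \<omega> i t" "x \<omega> j t"] by (intro sum_mono) (fastforce simp: abs_le_iff)
      also have "\<dots> = (\<Sum>k<m j. viol j t k (x \<omega> j t)) + real (m j) * (F\<^sub>2 * norm (x \<omega> i t - x \<omega> j t))"
        by (simp add: sum.distrib)
      also have "\<dots> \<le> (\<Sum>k<m j. viol j t k (x \<omega> j t)) + sched.m_total * (F\<^sub>2 * norm (x \<omega> i t - x \<omega> j t))"
        using member_le_sum[of j UNIV m] F_nonneg
        by (intro add_left_mono mult_right_mono) (auto simp flip: of_nat_sum)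
      finally show "(\<Sum>k<m j. viol j t k (x \<omega> i t)) \<le> (\<Sum>k<m j. viol j t k (x \<omega> j t)) + sched.m_total * F\<^sub>2 * norm (x \<omega> i t - x \<omega> j t)"
        by (simp add: mult.assoc)
    qed
    also have "\<dots> = ?n * (\<Sum>j\<in>UNIV. \<Sum>k<m j. viol j t k (x \<omega> j t)) + sched.m_total * F\<^sub>2 * disagree \<omega> t"
      unfolding disagree_def sum.distrib by (simp add: sum_distrib_left)
    finally show ?thesis .
  qed
  have "net_ccv m g T (x \<omega>) = (\<Sum>t=1..T. \<Sum>i\<in>UNIV. L2_set (\<lambda>jk. max 0 (global_constr g t (x \<omega> i t) jk)) (constr_index m)) / ?n"
    unfolding net_ccv_def by (subst sum.swap) simp
  also have "\<dots> \<le> (\<Sum>t=1..T. ?n * (\<Sum>j\<in>UNIV. \<Sum>k<m j. viol j t k (x \<omega> j t)) + sched.m_total * F\<^sub>2 * disagree \<omega> t) / ?n"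
    using step by (intro divide_right_mono sum_mono) auto
  also have "\<dots> = (\<Sum>t=1..T. \<Sum>i\<in>UNIV. \<Sum>k<m i. viol i t k (x \<omega> i t)) + sched.m_total * F\<^sub>2 * (\<Sum>t=1..T. disagree \<omega> t) / ?n"
    by (simp add: sum.distrib add_divide_distrib sum_distrib_left[symmetric])
  also have "sched.m_total * F\<^sub>2 * (\<Sum>t=1..T. disagree \<omega> t) / ?n \<le> sched.m_total * F\<^sub>2 * (\<Sum>t=1..T. disagree \<omega> t) / 1"
    using n F_nonneg
    by (intro divide_left_mono mult_nonneg_nonneg sum_nonneg) (auto simp: disagree_def intro!: sum_nonneg)
  finally show ?thesis by simp
qed

lemma net_reg_integrable: "integrable M (\<lambda>\<omega>. net_reg f T (x \<omega>) y)"
proof -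
  have "integrable M (\<lambda>\<omega>. global_loss f t (x \<omega> i t))" if t: "t \<ge> 1" for i t
  proof -
    have "integrable M (\<lambda>\<omega>. (\<Sum>j\<in>UNIV. f_ext j t (x \<omega> i t)) / real CARD('n))"
      by (intro integrable_divide Bochner_Integration.integrable_sum f_ext_integrable t)
    then show ?thesis
      by (rule Bochner_Integration.integrable_cong[THEN iffD1, rotated 2]) (use t in \<open>auto simp: global_loss_def f_ext_eq x_in\<close>)
  qed
  then show ?thesis
    unfolding net_reg_def
    by (intro Bochner_Integration.integrable_diff integrable_divide Bochner_Integration.integrable_sum) auto
qed

lemma net_ccv_integrable: "integrable M (\<lambda>\<omega>. net_ccv m g T (x \<omega>))"
proof -
  have "integrable M (\<lambda>\<omega>. L2_set (\<lambda>jk. max 0 (global_constr g t (x \<omega> i t) jk)) (constr_index m))" if t: "t \<ge> 1" for i t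
  proof -
    let ?v = "\<lambda>\<omega> jk. viol (fst jk) t (snd jk) (x \<omega> i t)"
    have fin: "finite (constr_index m)" by (simp add: constr_index_def)
    have vi: "integrable M (\<lambda>\<omega>. ?v \<omega> jk)" if "jk \<in> constr_index m" for jk
      using that by (intro viol_integrable t) (auto simp: constr_index_def)
    have "integrable M (\<lambda>\<omega>. L2_set (?v \<omega>) (constr_index m))"
    proof (rule Bochner_Integration.integrable_bound)
      show "integrable M (\<lambda>\<omega>. \<Sum>jk\<in>constr_index m. ?v \<omega> jk)"
        by (intro Bochner_Integration.integrable_sum vi)
      show "(\<lambda>\<omega>. L2_set (?v \<omega>) (constr_index m)) \<in> borel_measurable M"
        unfolding L2_set_def using borel_measurable_integrable[OF vi]
        by (intro measurable_compose[OF _ borel_measurable_sqrt] borel_measurable_sum borel_measurable_power) auto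
      show "AE \<omega> in M. norm (L2_set (?v \<omega>) (constr_index m)) \<le> norm (\<Sum>jk\<in>constr_index m. ?v \<omega> jk)"
        using viol_nonneg by (intro AE_I2) (auto simp: sum_nonneg intro!: L2_set_le_sum)
    qed
    then show ?thesis
      by (rule Bochner_Integration.integrable_cong[THEN iffD1, rotated 2])
        (use t in \<open>auto simp: global_constr_def constr_index_def viol_eq x_in intro!: L2_set_cong\<close>)
  qed
  then show ?thesis
    unfolding net_ccv_def by (intro integrable_divide Bochner_Integration.integrable_sum) auto
qed

text \<open>Pathwise, the true losses and the linear terms stand side by side with opposite signs.
  Only in expectation do they cancel, up to the bias.\<close>

lemma net_reg_expectation:
  assumes T: "T \<ge> 1" and y: "y \<in> feasible_seqs X m g T"
  shows "expectation (\<lambda>\<omega>. net_reg f T (x \<omega>) y)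
    \<le> (sched.budget F\<^sub>2 T (path_length y T) + total_bias T) / real CARD('n)"
proof -
  let ?n = "real CARD('n)" and ?B = "sched.budget F\<^sub>2 T (path_length y T)"
  let ?F = "\<lambda>\<omega>. \<Sum>t=1..T. \<Sum>i\<in>UNIV. f_ext i t (x \<omega> i t) - f i t (y t)"
  have Fi: "integrable M ?F"
    by (intro Bochner_Integration.integrable_sum Bochner_Integration.integrable_diff f_ext_integrable integrable_const) auto
  have EF: "expectation ?F = (\<Sum>t=1..T. \<Sum>i\<in>UNIV. expectation (\<lambda>\<omega>. f_ext i t (x \<omega> i t)) - f i t (y t))"
    using f_ext_integrable
    by (subst Bochner_Integration.integral_sum)
       (auto intro!: sum.cong Bochner_Integration.integrable_sum simp: Bochner_Integration.integral_sum prob_space)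
  have "?n * net_reg f T (x \<omega>) y \<le> ?F \<omega> + (?B - regret_terms \<omega> T y)" if \<omega>: "\<omega> \<in> space M" for \<omega>
  proof -
    interpret I: iterates E W w B X R "real CARD('p) * F\<^sub>2" F\<^sub>1 m \<alpha> \<beta> \<gamma> \<tau> \<xi> "x \<omega>" "x' \<omega>" "q \<omega>" "df \<omega>" "dg \<omega>"
      "\<lambda>i t k. viol i t k (x \<omega> i t)"
      using \<omega> by (rule iterates_axioms)
    have "I.V T + I.S T + F\<^sub>2 * (\<Sum>t=1..T. disagree \<omega> t) \<le> ?B - regret_terms \<omega> T y"
      using I.regret_pathwise[of T y F\<^sub>2] T feasible[OF y] F_nonneg
      by (simp add: disagree_def I.D_def regret_terms_def lin_def I.lin_def)
    then show ?thesis using net_reg_le[OF \<omega>, of T y] I.V_nonneg[of T] I.S_nonneg[of T] by linarith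
  qed
  then have "expectation (\<lambda>\<omega>. ?n * net_reg f T (x \<omega>) y) \<le> expectation (\<lambda>\<omega>. ?F \<omega> + (?B - regret_terms \<omega> T y))"
    by (intro integral_mono net_reg_integrable integrable_mult_right Bochner_Integration.integrable_add
        Bochner_Integration.integrable_diff integrable_const Fi regret_terms_expectation[OF y])
  also have "\<dots> = expectation ?F + (?B - expectation (\<lambda>\<omega>. regret_terms \<omega> T y))"
    using Fi regret_terms_expectation(1)[OF y] by (simp add: prob_space)
  also have "\<dots> \<le> ?B + total_bias T"
    using regret_terms_expectation(2)[OF y] unfolding EF by simp
  finally have "?n * expectation (\<lambda>\<omega>. net_reg f T (x \<omega>) y) \<le> ?B + total_bias T" by simp
  then show ?thesis by (simp add: field_simps)
qed

text \<open>A static feasible comparator has path length 0, so the regret inequality turns into a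
  bound on the expectation of \<open>V T + S T\<close>. \<open>U\<close> is that bound, and \<mu>
  and \<mu>' weigh the two parts.\<close>

lemma net_ccv_expectation:
  assumes T: "T \<ge> 1" and \<mu>: "\<mu> > 0" "\<mu>' > 0"
  defines "L \<equiv> (sched.m_total * (real CARD('p) * F\<^sub>2) + sched.m_total * F\<^sub>2) * sched.consensus_const"
  defines "U \<equiv> sched.budget 0 T 0 + total_bias T + real CARD('n) * F\<^sub>1 * real T"
  shows "expectation (\<lambda>\<omega>. net_ccv m g T (x \<omega>))
    \<le> sched.m_total * (\<mu> / 2) * (1 / \<gamma> 1 + (\<Sum>t=1..T. \<beta> (Suc t))) + U / \<mu> + U / \<mu>'
      + real CARD('n) * (sched.m_total * (real CARD('p) * F\<^sub>2) + L)\<^sup>2 * \<mu>' * (\<Sum>t=1..T. \<alpha> (Suc t))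
      + (sched.m_total * (real CARD('p) * F\<^sub>2) * real CARD('n) + L) * (\<Sum>t=1..T. \<tau> t) + L * R"
    (is "_ \<le> ?a + U / \<mu> + U / \<mu>' + ?b + ?c + ?d")
proof -
  obtain y0 where y0: "(\<lambda>_. y0) \<in> feasible_seqs X m g T"
    using feas T by (fastforce simp: feasibility_def static_feasible_seqs_def)
  have p0: "path_length (\<lambda>_. y0) T = 0" by (simp add: path_length_def)
  let ?K = "sched.m_total * F\<^sub>2"
  have K: "0 \<le> ?K" using F_nonneg by (intro mult_nonneg_nonneg of_nat_0_le_iff)
  define Z where "Z = (\<lambda>\<omega>. sched.budget 0 T 0 - regret_terms \<omega> T (\<lambda>_. y0))"
  have Zi: "integrable M Z" unfolding Z_def using regret_terms_expectation(1)[OF y0] by simp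
  have "net_ccv m g T (x \<omega>) \<le> ?a + Z \<omega> / \<mu> + Z \<omega> / \<mu>' + ?b + ?c + ?d" if \<omega>: "\<omega> \<in> space M" for \<omega>
  proof -
    interpret I: iterates E W w B X R "real CARD('p) * F\<^sub>2" F\<^sub>1 m \<alpha> \<beta> \<gamma> \<tau> \<xi> "x \<omega>" "x' \<omega>" "q \<omega>" "df \<omega>" "dg \<omega>"
      "\<lambda>i t k. viol i t k (x \<omega> i t)"
      using \<omega> by (rule iterates_axioms)
    have "I.V T + I.S T + 0 * (\<Sum>t=1..T. I.D t) \<le> sched.budget 0 T (path_length (\<lambda>_. y0) T) - regret_terms \<omega> T (\<lambda>_. y0)"
      using I.regret_pathwise[of T "\<lambda>_. y0" 0] T feasible[OF y0]
      by (simp add: regret_terms_def lin_def I.lin_def)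
    then have "I.V T + I.S T \<le> Z \<omega>" by (simp add: Z_def p0)
    then have "I.V T / \<mu> \<le> Z \<omega> / \<mu>" "I.S T / \<mu>' \<le> Z \<omega> / \<mu>'"
      using \<mu> I.V_nonneg[of T] I.S_nonneg[of T] by (auto intro!: divide_right_mono)
    moreover have "net_ccv m g T (x \<omega>) \<le> ?a + I.V T / \<mu> + I.S T / \<mu>' + ?b + ?c + ?d"
      using I.violation_pathwise[OF K \<mu>, of T] net_ccv_le[OF \<omega>, of T] unfolding L_def
      by (simp only: disagree_def I.D_def)
    ultimately show ?thesis by linarith
  qed
  then have "expectation (\<lambda>\<omega>. net_ccv m g T (x \<omega>)) \<le> expectation (\<lambda>\<omega>. ?a + Z \<omega> / \<mu> + Z \<omega> / \<mu>' + ?b + ?c + ?d)"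
    by (intro integral_mono net_ccv_integrable Bochner_Integration.integrable_add integrable_divide integrable_const Zi)
  also have "\<dots> = ?a + expectation Z / \<mu> + expectation Z / \<mu>' + ?b + ?c + ?d"
    using Zi by (simp add: prob_space)
  finally have le: "expectation (\<lambda>\<omega>. net_ccv m g T (x \<omega>))
    \<le> ?a + expectation Z / \<mu> + expectation Z / \<mu>' + ?b + ?c + ?d" .
  have "expectation Z \<le> U"
  proof -
    \<comment> \<open>The losses of the iterates may undercut those of \<open>y0\<close>, but by at
      most \<open>F\<^sub>1\<close> per agent and round. This is the source of the linear term in
      \<open>U\<close>.\<close>
    have "- F\<^sub>1 \<le> expectation (\<lambda>\<omega>. f_ext i t (x \<omega> i t)) - f i t y0" if t: "t \<in> {1..T}" for i t
    proof -
      have t1: "t \<ge> 1" using t by simp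
      have "expectation (\<lambda>\<omega>. f i t y0 - F\<^sub>1) \<le> expectation (\<lambda>\<omega>. f_ext i t (x \<omega> i t))"
      proof (rule integral_mono)
        fix \<omega> assume "\<omega> \<in> space M"
        then have "x \<omega> i t \<in> X" "y0 \<in> X" using x_in t1 feasible[OF y0 t1] t by auto
        then show "f i t y0 - F\<^sub>1 \<le> f_ext i t (x \<omega> i t)"
          using f_diff[OF t1, of "x \<omega> i t" y0 i] f_ext_eq[OF t1, of "x \<omega> i t" i] by (simp add: abs_le_iff)
      qed (use f_ext_integrable[OF t1] in auto)
      then show ?thesis by (simp add: prob_space)
    qed
    then have "(\<Sum>t=1..T. \<Sum>i\<in>(UNIV::'n set). - F\<^sub>1) \<le> (\<Sum>t=1..T. \<Sum>i\<in>UNIV. expectation (\<lambda>\<omega>. f_ext i t (x \<omega> i t)) - f i t y0)"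
      by (intro sum_mono)
    then have "- (real CARD('n) * F\<^sub>1 * real T) \<le> expectation (\<lambda>\<omega>. regret_terms \<omega> T (\<lambda>_. y0)) + total_bias T"
      using regret_terms_expectation(2)[OF y0] by (simp add: mult_ac)
    then show ?thesis
      using regret_terms_expectation(1)[OF y0] by (simp add: Z_def U_def prob_space)
  qed
  then have "expectation Z / \<mu> \<le> U / \<mu>" "expectation Z / \<mu>' \<le> U / \<mu>'"
    using \<mu> by (auto intro!: divide_right_mono)
  with le show ?thesis by linarith
qed

end

section \<open>Rates\<close>

text \<open>Here \<open>c\<close> is the quantity actually bounded and \<open>c'\<close> the term
  displayed in the rate. What \<open>c'\<close> cannot cover, for instance at \<open>T = 1\<close>
  where a logarithm vanishes, is charged to \<open>b\<close>.\<close>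

lemma absorb_term:
  fixes a b c c' d C k :: real
  assumes "z \<le> C * (a + b + c + d)" "c \<le> k * (b + c')" "0 \<le> a" "0 \<le> b" "0 \<le> c'" "0 \<le> d" "0 \<le> C" "0 \<le> k"
  shows "z \<le> C * (1 + k) * (a + b + c' + d)"
proof -
  have "a + b + c + d \<le> a + b + k * (b + c') + d" using assms by simp
  also have "\<dots> \<le> (1 + k) * (a + b + c' + d)"
    using assms mult_nonneg_nonneg[of k a] mult_nonneg_nonneg[of k d] by (simp add: algebra_simps)
  finally have "C * (a + b + c + d) \<le> C * ((1 + k) * (a + b + c' + d))"
    using assms by (intro mult_left_mono)
  with assms(1) show ?thesis by (simp add: mult.assoc)
qed

context bandit
begin

section \<open>Sums of the parameter sequences\<close>

lemma sum_\<alpha>_le: "(\<Sum>t=1..T. \<alpha> (Suc t)) \<le> \<alpha>\<^sub>0 * real T powr (1 - \<theta>\<^sub>1) / (1 - \<theta>\<^sub>1)"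
proof -
  have "(\<Sum>t=1..T. \<alpha> (Suc t)) \<le> (\<Sum>t=1..T. \<alpha> t)" by (intro sum_mono sched.\<alpha>) auto
  also have "\<dots> = \<alpha>\<^sub>0 * (\<Sum>t=1..T. real t powr - \<theta>\<^sub>1)"
    unfolding sum_distrib_left by (intro sum.cong refl) (simp add: \<alpha> powr_minus divide_inverse)
  also have "\<dots> \<le> \<alpha>\<^sub>0 * (real T powr (1 - \<theta>\<^sub>1) / (1 - \<theta>\<^sub>1))"
    using \<theta>\<^sub>1 \<alpha>\<^sub>0 by (intro mult_left_mono sum_powr_le) auto
  finally show ?thesis by simp
qed

lemma sum_\<beta>_le: "(\<Sum>t=1..T. \<beta> (Suc t)) \<le> real T powr (1 - \<theta>\<^sub>2) / (1 - \<theta>\<^sub>2)"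
proof -
  have "(\<Sum>t=1..T. \<beta> (Suc t)) \<le> (\<Sum>t=1..T. \<beta> t)" by (intro sum_mono sched.\<beta>) auto
  also have "\<dots> = (\<Sum>t=1..T. real t powr - \<theta>\<^sub>2)"
    by (intro sum.cong refl) (simp add: \<beta> powr_minus divide_inverse)
  also have "\<dots> \<le> real T powr (1 - \<theta>\<^sub>2) / (1 - \<theta>\<^sub>2)"
    using \<theta>\<^sub>2 by (intro sum_powr_le) auto
  finally show ?thesis .
qed

lemma sum_\<theta>\<^sub>2_le: "(\<Sum>t=1..T. real t powr - (1 - \<theta>\<^sub>2)) \<le> real T powr \<theta>\<^sub>2 / \<theta>\<^sub>2"
  using sum_powr_le[of "1 - \<theta>\<^sub>2" T] \<theta>\<^sub>2 by simp

lemma sum_\<gamma>_le: "(\<Sum>t=1..T. \<gamma> (Suc t)) \<le> real T powr \<theta>\<^sub>2 / \<theta>\<^sub>2"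
proof -
  have "(\<Sum>t=1..T. \<gamma> (Suc t)) \<le> (\<Sum>t=1..T. real t powr - (1 - \<theta>\<^sub>2))"
  proof (rule sum_mono)
    fix t assume t: "t \<in> {1..T}"
    have "\<gamma> (Suc t) = real (Suc t) powr - (1 - \<theta>\<^sub>2)" using \<gamma>[of "Suc t"] by (simp only: powr_minus divide_inverse mult_1)
    also have "\<dots> \<le> real t powr - (1 - \<theta>\<^sub>2)" using t \<theta>\<^sub>2 by (intro powr_mono2') auto
    finally show "\<gamma> (Suc t) \<le> real t powr - (1 - \<theta>\<^sub>2)" .
  qed
  then show ?thesis using sum_\<theta>\<^sub>2_le[of T] by simp
qed

text \<open>Times \<open>\<tau>\<^sub>0 / \<alpha>\<^sub>0\<close> this is the sum of
  \<open>\<tau> t / \<alpha> t\<close>. Whether it grows like a power or a logarithm or stays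
  bounded decides the three regret cases.\<close>

definition trigger_sum where "trigger_sum T = (\<Sum>t=1..T. real t powr (\<theta>\<^sub>1 - \<theta>\<^sub>3))"

lemma trigger_sum_nonneg: "0 \<le> trigger_sum T"
  by (simp add: trigger_sum_def sum_nonneg)

lemma sum_\<tau>_eq: "(\<Sum>t=1..T. \<tau> t) = \<tau>\<^sub>0 * (\<Sum>t=1..T. real t powr - \<theta>\<^sub>3)"
  unfolding sum_distrib_left by (intro sum.cong refl) (simp add: \<tau> powr_minus divide_inverse)

lemma sum_\<tau>_le: "(\<Sum>t=1..T. \<tau> t) \<le> \<alpha>\<^sub>0 * (\<tau>\<^sub>0 / \<alpha>\<^sub>0 * trigger_sum T)"
proof -
  have "(\<Sum>t=1..T. real t powr - \<theta>\<^sub>3) \<le> trigger_sum T"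
    unfolding trigger_sum_def using \<theta>\<^sub>1 by (intro sum_mono powr_mono) auto
  then show ?thesis unfolding sum_\<tau>_eq using \<tau>\<^sub>0 \<alpha>\<^sub>0 by (simp add: mult_left_mono)
qed

lemma inverse_\<alpha>_le:
  assumes "t \<ge> 1"
  shows "1 / \<alpha> (Suc t) \<le> 2 * real t powr \<theta>\<^sub>1 / \<alpha>\<^sub>0"
proof -
  have "real (Suc t) powr \<theta>\<^sub>1 \<le> (2 * real t) powr \<theta>\<^sub>1" using assms \<theta>\<^sub>1 by (intro powr_mono2) auto
  also have "\<dots> = 2 powr \<theta>\<^sub>1 * real t powr \<theta>\<^sub>1" by (simp add: powr_mult)
  also have "\<dots> \<le> 2 powr 1 * real t powr \<theta>\<^sub>1" using \<theta>\<^sub>1 by (intro mult_right_mono powr_mono) auto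
  finally have "real (Suc t) powr \<theta>\<^sub>1 / \<alpha>\<^sub>0 \<le> 2 * real t powr \<theta>\<^sub>1 / \<alpha>\<^sub>0"
    using \<alpha>\<^sub>0 by (intro divide_right_mono) auto
  then show ?thesis by (simp add: \<alpha>)
qed

lemma sum_\<tau>_\<alpha>_le: "(\<Sum>t=1..T. \<tau> t / \<alpha> (Suc t)) \<le> 2 * (\<tau>\<^sub>0 / \<alpha>\<^sub>0 * trigger_sum T)"
proof -
  have "(\<Sum>t=1..T. \<tau> t / \<alpha> (Suc t)) \<le> (\<Sum>t=1..T. 2 * (\<tau>\<^sub>0 / \<alpha>\<^sub>0 * real t powr (\<theta>\<^sub>1 - \<theta>\<^sub>3)))"
  proof (rule sum_mono)
    fix t assume "t \<in> {1..T}"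
    then have t: "t \<ge> 1" by simp
    have "\<tau> t * (1 / \<alpha> (Suc t)) \<le> (\<tau>\<^sub>0 / real t powr \<theta>\<^sub>3) * (2 * real t powr \<theta>\<^sub>1 / \<alpha>\<^sub>0)"
      unfolding \<tau>[OF t] using \<tau>\<^sub>0 by (intro mult_left_mono inverse_\<alpha>_le t) auto
    also have "\<dots> = 2 * (\<tau>\<^sub>0 / \<alpha>\<^sub>0 * real t powr (\<theta>\<^sub>1 - \<theta>\<^sub>3))" by (simp add: powr_diff mult_ac)
    finally show "\<tau> t / \<alpha> (Suc t) \<le> 2 * (\<tau>\<^sub>0 / \<alpha>\<^sub>0 * real t powr (\<theta>\<^sub>1 - \<theta>\<^sub>3))" by simp
  qed
  then show ?thesis by (simp add: trigger_sum_def sum_distrib_left)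
qed

text \<open>Shrinking and smoothing cost order 1/t in round t. The dual variable raises this to
  \<open>t powr (\<theta>\<^sub>2 - 1)\<close>, whose sum is of order
  \<open>T powr \<theta>\<^sub>2\<close>.\<close>

lemma total_bias_le:
  "total_bias T \<le> (real CARD('n) + sched.m_total * sched.qb) * (F\<^sub>2 * (R + 2 * r)) / \<theta>\<^sub>2 * real T powr \<theta>\<^sub>2"
proof -
  let ?c = "F\<^sub>2 * (R + 2 * r)"
  have c0: "0 \<le> ?c" using F_nonneg rR by simp
  have "bias i t \<le> (1 + real (m i) * sched.qb) * ?c * real t powr - (1 - \<theta>\<^sub>2)" if "t \<in> {1..T}" for i t
  proof -
    have t: "t \<ge> 1" using that by simp
    have "R * \<xi> (Suc t) + 2 * \<delta> t \<le> (R + 2 * r) / real t"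
    proof -
      have "R * \<xi> (Suc t) \<le> R / real t" "2 * \<delta> t \<le> 2 * r / real t"
        using t rR by (auto simp: \<xi> \<delta> intro!: divide_left_mono)
      then show ?thesis by (simp add: add_divide_distrib)
    qed
    then have 1: "F\<^sub>2 * (R * \<xi> (Suc t) + 2 * \<delta> t) \<le> ?c / real t"
      using mult_left_mono[OF _ F_nonneg(2)] by fastforce
    have "1 \<le> real t powr \<theta>\<^sub>2" using t \<theta>\<^sub>2 by (simp add: ge_one_powr_ge_zero)
    then have 2: "1 + real (m i) * (sched.qb * real t powr \<theta>\<^sub>2) \<le> (1 + real (m i) * sched.qb) * real t powr \<theta>\<^sub>2"
      by (simp add: algebra_simps)
    have "bias i t \<le> ((1 + real (m i) * sched.qb) * real t powr \<theta>\<^sub>2) * (?c / real t)"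
      unfolding bias_def using 1 2 qb_nonneg F_nonneg rR sched.\<xi>(1)[of "Suc t"] \<delta>_pos[OF t] by (intro mult_mono) auto
    also have "\<dots> = (1 + real (m i) * sched.qb) * ?c * (real t powr \<theta>\<^sub>2 / real t)" by simp
    also have "real t powr \<theta>\<^sub>2 / real t = real t powr - (1 - \<theta>\<^sub>2)" using powr_diff[of "real t" \<theta>\<^sub>2 1] t by simp
    finally show ?thesis .
  qed
  then have "total_bias T \<le> (\<Sum>t=1..T. \<Sum>i\<in>UNIV. (1 + real (m i) * sched.qb) * ?c * real t powr - (1 - \<theta>\<^sub>2))"
    unfolding total_bias_def by (intro sum_mono)
  also have "\<dots> = (real CARD('n) + sched.m_total * sched.qb) * ?c * (\<Sum>t=1..T. real t powr - (1 - \<theta>\<^sub>2))"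
    by (simp add: sum_distrib_right[symmetric] sum_distrib_left[symmetric] sum.distrib)
  also have "\<dots> \<le> (real CARD('n) + sched.m_total * sched.qb) * ?c * (real T powr \<theta>\<^sub>2 / \<theta>\<^sub>2)"
    using F_nonneg rR qb_nonneg
    by (intro mult_left_mono sum_\<theta>\<^sub>2_le mult_nonneg_nonneg add_nonneg_nonneg of_nat_0_le_iff) auto
  finally show ?thesis by simp
qed

definition rate where
  "rate T p = \<alpha>\<^sub>0 * real T powr (1 - \<theta>\<^sub>1) + real T powr \<theta>\<^sub>2 + \<tau>\<^sub>0 / \<alpha>\<^sub>0 * trigger_sum T
    + real T powr \<theta>\<^sub>1 * (1 + p) / \<alpha>\<^sub>0"

text \<open>Quantifying over a free number \<open>p\<close> fixes the constant before horizon and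
  comparator are chosen.\<close>

lemma budget_rate:
  assumes K: "0 \<le> K"
  obtains C where "C > 0" "\<And>T p. T \<ge> 1 \<Longrightarrow> 0 \<le> p \<Longrightarrow> sched.budget K T p + total_bias T \<le> C * rate T p"
proof
  let ?n = "real CARD('n)" and ?G = "real CARD('p) * F\<^sub>2"
  define L where "L = (?G + K) * sched.consensus_const"
  define c\<^sub>1 where "c\<^sub>1 = ?n * (?G + L)\<^sup>2 / (1 - \<theta>\<^sub>1)"
  define c\<^sub>2 where "c\<^sub>2 = L * R + 2 * sched.m_total * sched.qb\<^sup>2 / \<theta>\<^sub>2
    + (?n + sched.m_total * sched.qb) * (F\<^sub>2 * (R + 2 * r)) / \<theta>\<^sub>2"
  define c\<^sub>3 where "c\<^sub>3 = (?G * ?n + L) * \<alpha>\<^sub>0 + 4 * ?n * R"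
  define c\<^sub>4 where "c\<^sub>4 = 2 * ?n * (4 * R\<^sup>2 + 2 * R)"
  have G0: "0 \<le> ?G" using F_nonneg by simp
  have L0: "0 \<le> L" unfolding L_def using G0 K sched.consensus_const_nonneg by simp
  have m0: "0 \<le> sched.m_total" by (rule of_nat_0_le_iff)
  have c0: "0 \<le> c\<^sub>1" "0 \<le> c\<^sub>3" "0 \<le> c\<^sub>4"
    using G0 L0 \<theta>\<^sub>1 \<alpha>\<^sub>0 rR by (auto simp: c\<^sub>1_def c\<^sub>3_def c\<^sub>4_def)
  have c2: "0 \<le> c\<^sub>2"
    unfolding c\<^sub>2_def using L0 m0 rR \<theta>\<^sub>2 qb_nonneg F_nonneg
    by (intro add_nonneg_nonneg divide_nonneg_nonneg mult_nonneg_nonneg) auto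
  show "1 + c\<^sub>1 + c\<^sub>2 + c\<^sub>3 + c\<^sub>4 > 0" using c0 c2 by linarith
  fix T :: nat and p :: real assume T: "T \<ge> 1" and p: "0 \<le> p"
  let ?a = "\<alpha>\<^sub>0 * real T powr (1 - \<theta>\<^sub>1)" and ?b = "real T powr \<theta>\<^sub>2" and ?c = "\<tau>\<^sub>0 / \<alpha>\<^sub>0 * trigger_sum T"
    and ?d = "real T powr \<theta>\<^sub>1 * (1 + p) / \<alpha>\<^sub>0"
  have nn: "0 \<le> ?a" "1 \<le> ?b" "0 \<le> ?c" "0 \<le> ?d"
    using \<alpha>\<^sub>0 \<tau>\<^sub>0 \<theta>\<^sub>2 p T trigger_sum_nonneg[of T] by (auto simp: ge_one_powr_ge_zero)
  have 1: "?n * (?G + L)\<^sup>2 * (\<Sum>t=1..T. \<alpha> (Suc t)) \<le> c\<^sub>1 * ?a"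
    using mult_left_mono[OF sum_\<alpha>_le[of T], of "?n * (?G + L)\<^sup>2"] by (simp add: c\<^sub>1_def)
  have 2: "(?G * ?n + L) * (\<Sum>t=1..T. \<tau> t) \<le> (?G * ?n + L) * (\<alpha>\<^sub>0 * ?c)"
    using F_nonneg L0 by (intro mult_left_mono sum_\<tau>_le add_nonneg_nonneg mult_nonneg_nonneg) auto
  have 3: "L * R \<le> L * R * ?b" using mult_left_mono[OF nn(2), of "L * R"] L0 rR by simp
  have 4: "2 * sched.m_total * sched.qb\<^sup>2 * (\<Sum>t=1..T. \<gamma> (Suc t)) \<le> 2 * sched.m_total * sched.qb\<^sup>2 * (?b / \<theta>\<^sub>2)"
    using m0 by (intro mult_left_mono sum_\<gamma>_le mult_nonneg_nonneg) auto
  have 5: "2 * ?n * R * (\<Sum>t=1..T. \<tau> t / \<alpha> (Suc t)) \<le> 2 * ?n * R * (2 * ?c)"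
    using rR by (intro mult_left_mono sum_\<tau>_\<alpha>_le) auto
  have 6: "?n * (4 * R\<^sup>2 + 2 * R * p) / \<alpha> (Suc T) \<le> c\<^sub>4 * ?d"
  proof -
    define k where "k = 4 * R\<^sup>2 + 2 * R"
    have "?n * (4 * R\<^sup>2 + 2 * R * p) \<le> ?n * (k * (1 + p))"
      using p rR by (intro mult_left_mono) (auto simp: k_def algebra_simps)
    then have "?n * (4 * R\<^sup>2 + 2 * R * p) * (1 / \<alpha> (Suc T)) \<le> ?n * (k * (1 + p)) * (2 * real T powr \<theta>\<^sub>1 / \<alpha>\<^sub>0)"
      using p rR sched.\<alpha>(1)[of "Suc T"] by (intro mult_mono inverse_\<alpha>_le T) (auto simp: k_def)
    then show ?thesis unfolding c\<^sub>4_def k_def[symmetric] by (simp add: mult_ac)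
  qed
  have "sched.budget K T p + total_bias T \<le> c\<^sub>1 * ?a + (?G * ?n + L) * (\<alpha>\<^sub>0 * ?c) + L * R * ?b
      + 2 * sched.m_total * sched.qb\<^sup>2 * (?b / \<theta>\<^sub>2) + 2 * ?n * R * (2 * ?c) + c\<^sub>4 * ?d
      + (?n + sched.m_total * sched.qb) * (F\<^sub>2 * (R + 2 * r)) / \<theta>\<^sub>2 * ?b"
    unfolding sched.budget_def L_def[symmetric] by (intro add_mono 1 2 3 4 5 6 total_bias_le)
  also have "\<dots> = c\<^sub>1 * ?a + c\<^sub>2 * ?b + c\<^sub>3 * ?c + c\<^sub>4 * ?d"
    unfolding c\<^sub>2_def c\<^sub>3_def by (simp only: distrib_right distrib_left times_divide_eq_right times_divide_eq_left mult_ac add_ac)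
  also have "\<dots> \<le> (1 + c\<^sub>1 + c\<^sub>2 + c\<^sub>3 + c\<^sub>4) * ?a + (1 + c\<^sub>1 + c\<^sub>2 + c\<^sub>3 + c\<^sub>4) * ?b
      + (1 + c\<^sub>1 + c\<^sub>2 + c\<^sub>3 + c\<^sub>4) * ?c + (1 + c\<^sub>1 + c\<^sub>2 + c\<^sub>3 + c\<^sub>4) * ?d"
    using nn c0 c2 by (intro add_mono mult_right_mono) auto
  finally show "sched.budget K T p + total_bias T \<le> (1 + c\<^sub>1 + c\<^sub>2 + c\<^sub>3 + c\<^sub>4) * rate T p"
    by (simp only: rate_def distrib_left)
qed

lemma net_reg_rate:
  obtains C where "C > 0" "\<And>T y. T \<ge> 1 \<Longrightarrow> y \<in> feasible_seqs X m g T \<Longrightarrow>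
    expectation (\<lambda>\<omega>. net_reg f T (x \<omega>) y) \<le> C * rate T (path_length y T)"
proof -
  obtain C where C: "C > 0" "\<And>T p. T \<ge> 1 \<Longrightarrow> 0 \<le> p \<Longrightarrow> sched.budget F\<^sub>2 T p + total_bias T \<le> C * rate T p"
    using budget_rate[OF F_nonneg(2)] by blast
  show thesis
  proof (rule that[of "C / real CARD('n)"])
    fix T y assume T: "(T::nat) \<ge> 1" and y: "y \<in> feasible_seqs X m g T"
    have "(sched.budget F\<^sub>2 T (path_length y T) + total_bias T) / real CARD('n) \<le> C * rate T (path_length y T) / real CARD('n)"
      by (intro divide_right_mono C T) (auto simp: path_length_def intro!: sum_nonneg)
    then show "expectation (\<lambda>\<omega>. net_reg f T (x \<omega>) y) \<le> C / real CARD('n) * rate T (path_length y T)"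
      using net_reg_expectation[OF T y] by simp
  qed (use C in simp)
qed

text \<open>\<open>U\<close> is linear in \<open>T\<close>, because \<tau>/\<alpha> sums to at most
  that order when \<open>\<theta>\<^sub>1 < \<theta>\<^sub>3\<close>. Dividing \<open>T\<close> by
  \<open>T powr (\<theta>\<^sub>2 / 2)\<close> gives the same power as multiplying the sum of
  \<beta>, of order \<open>T powr (1 - \<theta>\<^sub>2)\<close>, by it; likewise for \<alpha> with
  \<open>\<theta>\<^sub>1\<close>. This balance dictates the weights. The sum of \<tau> is left
  untouched for the case distinction.\<close>

lemma net_ccv_rate:
  assumes "\<theta>\<^sub>1 < \<theta>\<^sub>3"
  obtains C where "C > 0" "\<And>T. T \<ge> 1 \<Longrightarrow> expectation (\<lambda>\<omega>. net_ccv m g T (x \<omega>))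
    \<le> C * (sqrt \<alpha>\<^sub>0 * real T powr (1 - \<theta>\<^sub>1 / 2) + real T powr (1 - \<theta>\<^sub>2 / 2) + (\<Sum>t=1..T. \<tau> t))"
proof -
  let ?n = "real CARD('n)" and ?G = "sched.m_total * (real CARD('p) * F\<^sub>2)"
  obtain C where C: "C > 0" "\<And>T p. T \<ge> 1 \<Longrightarrow> 0 \<le> p \<Longrightarrow> sched.budget 0 T p + total_bias T \<le> C * rate T p"
    using budget_rate[of 0] by auto
  define cU where "cU = C * (\<alpha>\<^sub>0 + 1 + \<tau>\<^sub>0 / \<alpha>\<^sub>0 + 1 / \<alpha>\<^sub>0) + ?n * F\<^sub>1"
  define L where "L = (?G + sched.m_total * F\<^sub>2) * sched.consensus_const"
  define c\<^sub>1 where "c\<^sub>1 = cU + ?n * (?G + L)\<^sup>2 * (\<alpha>\<^sub>0 / (1 - \<theta>\<^sub>1))"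
  define c\<^sub>2 where "c\<^sub>2 = sched.m_total / 2 * (1 + 1 / (1 - \<theta>\<^sub>2)) + cU + L * R"
  define c\<^sub>3 where "c\<^sub>3 = ?G * ?n + L"
  have m0: "0 \<le> sched.m_total" by (rule of_nat_0_le_iff)
  have G0: "0 \<le> ?G" using F_nonneg by (intro mult_nonneg_nonneg m0) auto
  have L0: "0 \<le> L" unfolding L_def using G0 F_nonneg sched.consensus_const_nonneg
    by (intro mult_nonneg_nonneg add_nonneg_nonneg m0) auto
  have cU0: "0 \<le> cU" unfolding cU_def using C(1) \<alpha>\<^sub>0 \<tau>\<^sub>0 F_nonneg by (intro add_nonneg_nonneg mult_nonneg_nonneg) auto
  have c0: "0 \<le> c\<^sub>1" unfolding c\<^sub>1_def using cU0 \<theta>\<^sub>1 \<alpha>\<^sub>0 by (intro add_nonneg_nonneg mult_nonneg_nonneg) auto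
  have c20: "0 \<le> c\<^sub>2" unfolding c\<^sub>2_def using cU0 \<theta>\<^sub>2 m0 L0 rR by (intro add_nonneg_nonneg mult_nonneg_nonneg) auto
  have c30: "0 \<le> c\<^sub>3" unfolding c\<^sub>3_def using G0 L0 by (intro add_nonneg_nonneg mult_nonneg_nonneg[OF G0]) auto
  \<comment> \<open>The rate displays \<open>sqrt \<alpha>\<^sub>0\<close>, and the constant may
    depend on \<open>\<alpha>\<^sub>0\<close>, so \<open>c\<^sub>1\<close> is divided by it.\<close>
  define C' where "C' = 1 + c\<^sub>1 / sqrt \<alpha>\<^sub>0 + c\<^sub>2 + c\<^sub>3"
  have s0: "sqrt \<alpha>\<^sub>0 > 0" using \<alpha>\<^sub>0 by simp
  show thesis
  proof (rule that[of C'])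
    show "C' > 0" using c0 c20 c30 s0 by (simp add: C'_def add_pos_nonneg)
    fix T :: nat assume T: "T \<ge> 1"
    define t where "t = real T"
    have t1: "1 \<le> t" using T by (simp add: t_def)
    have le_t: "t powr s \<le> t" if "s \<le> 1" for s
      using powr_mono[OF that t1] t1 by simp
    have ge1: "1 \<le> t powr s" if "0 \<le> s" for s using t1 that by (simp add: ge_one_powr_ge_zero)
    let ?\<mu> = "t powr (\<theta>\<^sub>2 / 2)" and ?\<mu>' = "t powr (\<theta>\<^sub>1 / 2)" and ?A = "t powr (1 - \<theta>\<^sub>1 / 2)" and ?B = "t powr (1 - \<theta>\<^sub>2 / 2)"
    have \<mu>: "?\<mu> > 0" "?\<mu>' > 0" using t1 by auto
    have A: "t / ?\<mu>' = ?A" "?\<mu>' * t powr (1 - \<theta>\<^sub>1) = ?A"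
      using t1 by (simp_all add: powr_diff powr_add[symmetric] flip: powr_add) (simp_all add: field_simps flip: powr_add)
    have B: "t / ?\<mu> = ?B" "?\<mu> * t powr (1 - \<theta>\<^sub>2) = ?B"
      using t1 by (simp_all add: powr_diff powr_add[symmetric] flip: powr_add) (simp_all add: field_simps flip: powr_add)
    define U where "U = sched.budget 0 T 0 + total_bias T + ?n * F\<^sub>1 * real T"
    have U: "U \<le> cU * t"
    proof -
      have "trigger_sum T \<le> (\<Sum>s=1..T. 1)"
        unfolding trigger_sum_def
      proof (rule sum_mono)
        fix s assume "s \<in> {1..T}"
        then show "real s powr (\<theta>\<^sub>1 - \<theta>\<^sub>3) \<le> 1"
          using powr_mono[of "\<theta>\<^sub>1 - \<theta>\<^sub>3" 0 "real s"] assms by simp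
      qed
      then have Q: "trigger_sum T \<le> t" by (simp add: t_def)
      have "rate T 0 \<le> \<alpha>\<^sub>0 * t + t + \<tau>\<^sub>0 / \<alpha>\<^sub>0 * t + t * (1 + 0) / \<alpha>\<^sub>0"
        unfolding rate_def t_def[symmetric] using \<alpha>\<^sub>0 \<tau>\<^sub>0 \<theta>\<^sub>1 \<theta>\<^sub>2
        by (intro add_mono mult_left_mono divide_right_mono mult_right_mono le_t Q) auto
      also have "\<dots> = (\<alpha>\<^sub>0 + 1 + \<tau>\<^sub>0 / \<alpha>\<^sub>0 + 1 / \<alpha>\<^sub>0) * t" by (simp add: algebra_simps)
      finally have "C * rate T 0 \<le> C * ((\<alpha>\<^sub>0 + 1 + \<tau>\<^sub>0 / \<alpha>\<^sub>0 + 1 / \<alpha>\<^sub>0) * t)" using C(1) by (intro mult_left_mono) auto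
      then show ?thesis using C(2)[OF T, of 0] by (simp add: U_def cU_def t_def distrib_right mult.assoc)
    qed
    have 1: "sched.m_total * (?\<mu> / 2) * (1 / \<gamma> 1 + (\<Sum>t=1..T. \<beta> (Suc t))) \<le> sched.m_total / 2 * (1 + 1 / (1 - \<theta>\<^sub>2)) * ?B"
    proof -
      have "?\<mu> * (1 / \<gamma> 1 + (\<Sum>t=1..T. \<beta> (Suc t))) \<le> ?\<mu> * (1 + t powr (1 - \<theta>\<^sub>2) / (1 - \<theta>\<^sub>2))"
        using sum_\<beta>_le[of T] by (intro mult_left_mono) (auto simp: \<gamma> t_def)
      also have "\<dots> = ?\<mu> + ?B / (1 - \<theta>\<^sub>2)" unfolding B(2)[symmetric] by (simp add: distrib_left)
      also have "?\<mu> \<le> ?B" using t1 \<theta>\<^sub>2 by (intro powr_mono) auto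
      finally have "?\<mu> * (1 / \<gamma> 1 + (\<Sum>t=1..T. \<beta> (Suc t))) \<le> (1 + 1 / (1 - \<theta>\<^sub>2)) * ?B"
        by (simp add: distrib_right)
      from mult_left_mono[OF this, of "sched.m_total / 2"] m0 show ?thesis by (simp add: mult_ac)
    qed
    have 2: "U / ?\<mu> \<le> cU * ?B" "U / ?\<mu>' \<le> cU * ?A"
      unfolding A(1)[symmetric] B(1)[symmetric] using divide_right_mono[OF U, of ?\<mu>] divide_right_mono[OF U, of ?\<mu>'] by simp_all
    have 3: "?n * (?G + L)\<^sup>2 * ?\<mu>' * (\<Sum>t=1..T. \<alpha> (Suc t)) \<le> ?n * (?G + L)\<^sup>2 * (\<alpha>\<^sub>0 / (1 - \<theta>\<^sub>1)) * ?A"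
      using mult_left_mono[OF sum_\<alpha>_le[of T], of "?n * (?G + L)\<^sup>2 * ?\<mu>'"]
      unfolding A(2)[symmetric] t_def[symmetric] by (simp add: mult_ac)
    have 4: "L * R \<le> L * R * ?B" using mult_left_mono[OF ge1[of "1 - \<theta>\<^sub>2 / 2"], of "L * R"] \<theta>\<^sub>2 L0 rR by simp
    have "expectation (\<lambda>\<omega>. net_ccv m g T (x \<omega>))
      \<le> sched.m_total / 2 * (1 + 1 / (1 - \<theta>\<^sub>2)) * ?B + cU * ?B + cU * ?A
        + ?n * (?G + L)\<^sup>2 * (\<alpha>\<^sub>0 / (1 - \<theta>\<^sub>1)) * ?A + c\<^sub>3 * (\<Sum>t=1..T. \<tau> t) + L * R * ?B"
      using net_ccv_expectation[OF T \<mu>] 1 2 3 4 unfolding U_def[symmetric] L_def[symmetric] c\<^sub>3_def[symmetric]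
      by linarith
    also have "\<dots> = c\<^sub>1 * ?A + c\<^sub>2 * ?B + c\<^sub>3 * (\<Sum>t=1..T. \<tau> t)"
      unfolding c\<^sub>1_def c\<^sub>2_def by (simp only: distrib_right)
    also have "\<dots> = c\<^sub>1 / sqrt \<alpha>\<^sub>0 * (sqrt \<alpha>\<^sub>0 * ?A) + c\<^sub>2 * ?B + c\<^sub>3 * (\<Sum>t=1..T. \<tau> t)" using s0 by simp
    also have "\<dots> \<le> C' * (sqrt \<alpha>\<^sub>0 * ?A) + C' * ?B + C' * (\<Sum>t=1..T. \<tau> t)"
      using c0 c20 c30 s0 sched.\<tau> unfolding C'_def
      by (intro add_mono mult_right_mono) (auto intro!: sum_nonneg divide_nonneg_nonneg)
    finally show "expectation (\<lambda>\<omega>. net_ccv m g T (x \<omega>)) \<le> C' * (sqrt \<alpha>\<^sub>0 * real T powr (1 - \<theta>\<^sub>1 / 2) + real T powr (1 - \<theta>\<^sub>2 / 2) + (\<Sum>t=1..T. \<tau> t))"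
      by (simp add: t_def distrib_left)
  qed
qed

section \<open>Trading the trigger sums for the displayed rates\<close>

lemma net_reg_bound:
  assumes k: "0 \<le> k" and h: "\<And>T. T \<ge> 1 \<Longrightarrow> 0 \<le> h T"
    and le: "\<And>T. T \<ge> 1 \<Longrightarrow> \<tau>\<^sub>0 / \<alpha>\<^sub>0 * trigger_sum T \<le> k * (real T powr \<theta>\<^sub>2 + h T)"
  shows "\<exists>C>0. \<forall>T\<ge>1. \<forall>y\<in>feasible_seqs X m g T. expectation (\<lambda>\<omega>. net_reg f T (x \<omega>) y)
    \<le> C * (\<alpha>\<^sub>0 * real T powr (1 - \<theta>\<^sub>1) + real T powr \<theta>\<^sub>2 + h T + real T powr \<theta>\<^sub>1 * (1 + path_length y T) / \<alpha>\<^sub>0)"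
proof -
  obtain C where C: "C > 0" "\<And>T y. T \<ge> 1 \<Longrightarrow> y \<in> feasible_seqs X m g T \<Longrightarrow>
    expectation (\<lambda>\<omega>. net_reg f T (x \<omega>) y) \<le> C * rate T (path_length y T)"
    using net_reg_rate by blast
  show ?thesis
  proof (intro exI[of _ "C * (1 + k)"] conjI allI ballI impI)
    show "C * (1 + k) > 0" using C(1) k by simp
    fix T y assume T: "(T::nat) \<ge> 1" and y: "y \<in> feasible_seqs X m g T"
    have "0 \<le> path_length y T" by (auto simp: path_length_def intro!: sum_nonneg)
    then show "expectation (\<lambda>\<omega>. net_reg f T (x \<omega>) y) \<le> C * (1 + k) * (\<alpha>\<^sub>0 * real T powr (1 - \<theta>\<^sub>1) + real T powr \<theta>\<^sub>2
        + h T + real T powr \<theta>\<^sub>1 * (1 + path_length y T) / \<alpha>\<^sub>0)"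
      using C(1) k h[OF T] \<alpha>\<^sub>0 by (intro absorb_term[OF C(2)[OF T y, unfolded rate_def] le[OF T]]) auto
  qed
qed

lemma net_ccv_bound:
  assumes "\<theta>\<^sub>1 < \<theta>\<^sub>3" and k: "0 \<le> k" and h: "\<And>T. T \<ge> 1 \<Longrightarrow> 0 \<le> h T"
    and le: "\<And>T. T \<ge> 1 \<Longrightarrow> (\<Sum>t=1..T. \<tau> t) \<le> k * (real T powr (1 - \<theta>\<^sub>2 / 2) + h T)"
  shows "\<exists>C>0. \<forall>T\<ge>1. expectation (\<lambda>\<omega>. net_ccv m g T (x \<omega>))
    \<le> C * (sqrt \<alpha>\<^sub>0 * real T powr (1 - \<theta>\<^sub>1 / 2) + real T powr (1 - \<theta>\<^sub>2 / 2) + h T)"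
proof -
  obtain C where C: "C > 0" "\<And>T. T \<ge> 1 \<Longrightarrow> expectation (\<lambda>\<omega>. net_ccv m g T (x \<omega>))
    \<le> C * (sqrt \<alpha>\<^sub>0 * real T powr (1 - \<theta>\<^sub>1 / 2) + real T powr (1 - \<theta>\<^sub>2 / 2) + (\<Sum>t=1..T. \<tau> t))"
    using net_ccv_rate[OF assms(1)] by blast
  show ?thesis
  proof (intro exI[of _ "C * (1 + k)"] conjI allI impI)
    show "C * (1 + k) > 0" using C(1) k by simp
    fix T assume T: "(T::nat) \<ge> 1"
    show "expectation (\<lambda>\<omega>. net_ccv m g T (x \<omega>))
      \<le> C * (1 + k) * (sqrt \<alpha>\<^sub>0 * real T powr (1 - \<theta>\<^sub>1 / 2) + real T powr (1 - \<theta>\<^sub>2 / 2) + h T)"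
      using absorb_term[of _ C _ _ _ 0 k "h T"] C(1) C(2)[OF T] k h[OF T] \<alpha>\<^sub>0 le[OF T] by simp
  qed
qed

text \<open>From exponent 1 on the sum is at most logarithmic, and a logarithm is dominated by every
  positive power; the power chosen is one already present in the violation rate.\<close>

lemma sum_\<tau>_le_log:
  assumes "\<theta>\<^sub>3 \<ge> 1" "T \<ge> 1"
  shows "(\<Sum>t=1..T. \<tau> t) \<le> \<tau>\<^sub>0 * (1 + 1 / (1 - \<theta>\<^sub>2 / 2)) * real T powr (1 - \<theta>\<^sub>2 / 2)"
proof -
  let ?a = "1 - \<theta>\<^sub>2 / 2"
  have a: "0 < ?a" using \<theta>\<^sub>2 by simp
  have "(\<Sum>t=1..T. real t powr - \<theta>\<^sub>3) \<le> (\<Sum>t=1..T. 1 / real t)"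
  proof (rule sum_mono)
    fix t assume "t \<in> {1..T}"
    then show "real t powr - \<theta>\<^sub>3 \<le> 1 / real t"
      using powr_mono[of "- \<theta>\<^sub>3" "- 1" "real t"] assms(1) by (simp add: powr_minus divide_inverse)
  qed
  also have "\<dots> \<le> 1 + ln (real T)" by (rule sum_inverse_le[OF assms(2)])
  also have "\<dots> \<le> real T powr ?a + real T powr ?a / ?a"
    using assms(2) a by (intro add_mono ln_powr_bound) (auto simp: ge_one_powr_ge_zero)
  also have "\<dots> = (1 + 1 / ?a) * real T powr ?a" by (simp add: distrib_right)
  finally have "\<tau>\<^sub>0 * (\<Sum>t=1..T. real t powr - \<theta>\<^sub>3) \<le> \<tau>\<^sub>0 * ((1 + 1 / ?a) * real T powr ?a)"
    using \<tau>\<^sub>0 by (intro mult_left_mono)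
  then show ?thesis by (simp only: sum_\<tau>_eq mult.assoc)
qed

end

theorem theorem2:
  fixes X :: "(real ^ 'p) set" and r R F\<^sub>1 F\<^sub>2 :: real
    and m :: "'n::finite \<Rightarrow> nat"
    and f :: "'n \<Rightarrow> nat \<Rightarrow> real ^ 'p \<Rightarrow> real"
    and g :: "'n \<Rightarrow> nat \<Rightarrow> real ^ 'p \<Rightarrow> nat \<Rightarrow> real"
    and E :: "nat \<Rightarrow> ('n \<times> 'n) set" and W :: "nat \<Rightarrow> real ^ 'n ^ 'n" and w :: real and B :: nat
    and \<alpha>\<^sub>0 \<theta>\<^sub>1 \<theta>\<^sub>2 \<theta>\<^sub>3 \<tau>\<^sub>0 :: real
    and \<alpha> \<beta> \<gamma> \<tau> \<xi> \<delta> :: "nat \<Rightarrow> real"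
    and M :: "'w measure" and u :: "'n \<Rightarrow> nat \<Rightarrow> 'w \<Rightarrow> real ^ 'p"
    and x\<^sub>1 :: "'n \<Rightarrow> real ^ 'p"
    and x x' :: "'w \<Rightarrow> 'n \<Rightarrow> nat \<Rightarrow> real ^ 'p" and q :: "'w \<Rightarrow> 'n \<Rightarrow> nat \<Rightarrow> nat \<Rightarrow> real"
  assumes "assumption1 X r R m f g F\<^sub>1 F\<^sub>2"
    and "assumption2 E W w B"
    and "feasibility X m g"
    and "\<alpha>\<^sub>0 > 0" and "\<theta>\<^sub>1 \<in> {0<..<1}" and "\<theta>\<^sub>2 \<in> {0<..<1}" and "\<theta>\<^sub>3 > 0" and "\<tau>\<^sub>0 \<ge> 0"
    and "\<And>t. t \<ge> 1 \<Longrightarrow> \<alpha> t = \<alpha>\<^sub>0 / real t powr \<theta>\<^sub>1"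
    and "\<And>t. t \<ge> 1 \<Longrightarrow> \<beta> t = 1 / real t powr \<theta>\<^sub>2"
    and "\<And>t. t \<ge> 1 \<Longrightarrow> \<gamma> t = 1 / real t powr (1 - \<theta>\<^sub>2)"
    and "\<And>t. t \<ge> 1 \<Longrightarrow> \<xi> t = 1 / (real t + 1)"
    and "\<And>t. t \<ge> 1 \<Longrightarrow> \<delta> t = r / (real t + 1)"
    and "\<And>t. t \<ge> 1 \<Longrightarrow> \<tau> t = \<tau>\<^sub>0 / real t powr \<theta>\<^sub>3"
    and "prob_space M"
    and "iid_sphere_draws M u"
    and "\<And>\<omega>. \<omega> \<in> space M \<Longrightarrow>
           algorithm1 X r m f g W \<alpha> \<beta> \<gamma> \<tau> \<xi> \<delta> x\<^sub>1 (\<lambda>i t. u i t \<omega>) (x \<omega>) (x' \<omega>) (q \<omega>)"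
  shows
    "(\<forall>T\<ge>1. \<forall>y\<in>feasible_seqs X m g T. integrable M (\<lambda>\<omega>. net_reg f T (x \<omega>) y)) \<and>
     (\<forall>T\<ge>1. integrable M (\<lambda>\<omega>. net_ccv m g T (x \<omega>))) \<and>
     (\<theta>\<^sub>1 < \<theta>\<^sub>3 \<and> \<theta>\<^sub>3 < 1 + \<theta>\<^sub>1 \<longrightarrow>
       (\<exists>C>0. \<forall>T\<ge>1. \<forall>y\<in>feasible_seqs X m g T.
          (\<integral>\<omega>. net_reg f T (x \<omega>) y \<partial>M) \<le>
            C * (\<alpha>\<^sub>0 * real T powr (1 - \<theta>\<^sub>1) + real T powr \<theta>\<^sub>2
                 + \<tau>\<^sub>0 / \<alpha>\<^sub>0 * real T powr (1 + \<theta>\<^sub>1 - \<theta>\<^sub>3)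
                 + real T powr \<theta>\<^sub>1 * (1 + path_length y T) / \<alpha>\<^sub>0))) \<and>
     (\<theta>\<^sub>3 = 1 + \<theta>\<^sub>1 \<longrightarrow>
       (\<exists>C>0. \<forall>T\<ge>1. \<forall>y\<in>feasible_seqs X m g T.
          (\<integral>\<omega>. net_reg f T (x \<omega>) y \<partial>M) \<le>
            C * (\<alpha>\<^sub>0 * real T powr (1 - \<theta>\<^sub>1) + real T powr \<theta>\<^sub>2
                 + \<tau>\<^sub>0 / \<alpha>\<^sub>0 * ln (real T)
                 + real T powr \<theta>\<^sub>1 * (1 + path_length y T) / \<alpha>\<^sub>0))) \<and>
     (\<theta>\<^sub>3 > 1 + \<theta>\<^sub>1 \<longrightarrow>
       (\<exists>C>0. \<forall>T\<ge>1. \<forall>y\<in>feasible_seqs X m g T.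
          (\<integral>\<omega>. net_reg f T (x \<omega>) y \<partial>M) \<le>
            C * (\<alpha>\<^sub>0 * real T powr (1 - \<theta>\<^sub>1) + real T powr \<theta>\<^sub>2
                 + \<tau>\<^sub>0 / \<alpha>\<^sub>0
                 + real T powr \<theta>\<^sub>1 * (1 + path_length y T) / \<alpha>\<^sub>0))) \<and>
     (\<theta>\<^sub>1 < \<theta>\<^sub>3 \<and> \<theta>\<^sub>3 < 1 \<longrightarrow>
       (\<exists>C>0. \<forall>T\<ge>1.
          (\<integral>\<omega>. net_ccv m g T (x \<omega>) \<partial>M) \<le>
            C * (sqrt \<alpha>\<^sub>0 * real T powr (1 - \<theta>\<^sub>1 / 2) + real T powr (1 - \<theta>\<^sub>2 / 2)
                 + sqrt \<tau>\<^sub>0 * real T powr (1 - \<theta>\<^sub>3 / 2)))) \<and>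
     (\<theta>\<^sub>3 = 1 \<longrightarrow>
       (\<exists>C>0. \<forall>T\<ge>1.
          (\<integral>\<omega>. net_ccv m g T (x \<omega>) \<partial>M) \<le>
            C * (sqrt \<alpha>\<^sub>0 * real T powr (1 - \<theta>\<^sub>1 / 2) + real T powr (1 - \<theta>\<^sub>2 / 2)
                 + sqrt (\<tau>\<^sub>0 * real T * ln (real T))))) \<and>
     (\<theta>\<^sub>3 > 1 \<longrightarrow>
       (\<exists>C>0. \<forall>T\<ge>1.
          (\<integral>\<omega>. net_ccv m g T (x \<omega>) \<partial>M) \<le>
            C * (sqrt \<alpha>\<^sub>0 * real T powr (1 - \<theta>\<^sub>1 / 2) + real T powr (1 - \<theta>\<^sub>2 / 2)
                 + sqrt (\<tau>\<^sub>0 * real T))))"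
proof -
  interpret prob_space M by fact
  interpret bandit M u X r R F\<^sub>1 F\<^sub>2 m f g E W w B \<alpha>\<^sub>0 \<theta>\<^sub>1 \<theta>\<^sub>2 \<theta>\<^sub>3 \<tau>\<^sub>0 \<alpha> \<beta> \<gamma> \<tau> \<xi> \<delta> x\<^sub>1 x x' q
    by unfold_locales (use assms in auto)
  let ?c = "\<tau>\<^sub>0 / \<alpha>\<^sub>0"
  have c: "0 \<le> ?c" using \<tau>\<^sub>0 \<alpha>\<^sub>0 by simp
  have trig: "trigger_sum T = (\<Sum>t=1..T. real t powr - (\<theta>\<^sub>3 - \<theta>\<^sub>1))" for T
    by (simp add: trigger_sum_def)
  have b1: "1 \<le> real T powr \<theta>\<^sub>2" if "T \<ge> 1" for T :: nat
    using that \<theta>\<^sub>2 by (simp add: ge_one_powr_ge_zero)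
  \<comment> \<open>The trigger errors already fit into the power with
    \<open>\<theta>\<^sub>2\<close>, so any nonnegative \<open>h\<close> may stand for the third
    term. Both square roots of the last two cases are instances.\<close>
  have ccv: "\<exists>C>0. \<forall>T\<ge>1. expectation (\<lambda>\<omega>. net_ccv m g T (x \<omega>)) \<le>
            C * (sqrt \<alpha>\<^sub>0 * real T powr (1 - \<theta>\<^sub>1 / 2) + real T powr (1 - \<theta>\<^sub>2 / 2) + h T)"
    if \<theta>: "\<theta>\<^sub>3 \<ge> 1" and h: "\<And>T. T \<ge> 1 \<Longrightarrow> 0 \<le> h T" for h :: "nat \<Rightarrow> real"
  proof (rule net_ccv_bound[where k = "\<tau>\<^sub>0 * (1 + 1 / (1 - \<theta>\<^sub>2 / 2))"])
    show k: "0 \<le> \<tau>\<^sub>0 * (1 + 1 / (1 - \<theta>\<^sub>2 / 2))" using \<tau>\<^sub>0 \<theta>\<^sub>2 by simp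
    show "\<theta>\<^sub>1 < \<theta>\<^sub>3" using \<theta> \<theta>\<^sub>1 by simp
    fix T :: nat assume T: "T \<ge> 1"
    show "0 \<le> h T" by (rule h[OF T])
    show "(\<Sum>t=1..T. \<tau> t) \<le> \<tau>\<^sub>0 * (1 + 1 / (1 - \<theta>\<^sub>2 / 2)) * (real T powr (1 - \<theta>\<^sub>2 / 2) + h T)"
      using sum_\<tau>_le_log[OF \<theta> T] mult_nonneg_nonneg[OF k h[OF T]] unfolding distrib_left[of _ _ "h T"] by linarith
  qed
  show ?thesis
  proof (intro conjI impI)
    assume \<theta>: "\<theta>\<^sub>1 < \<theta>\<^sub>3 \<and> \<theta>\<^sub>3 < 1 + \<theta>\<^sub>1"
    show "\<exists>C>0. \<forall>T\<ge>1. \<forall>y\<in>feasible_seqs X m g T. expectation (\<lambda>\<omega>. net_reg f T (x \<omega>) y) \<le>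
            C * (\<alpha>\<^sub>0 * real T powr (1 - \<theta>\<^sub>1) + real T powr \<theta>\<^sub>2 + ?c * real T powr (1 + \<theta>\<^sub>1 - \<theta>\<^sub>3)
                 + real T powr \<theta>\<^sub>1 * (1 + path_length y T) / \<alpha>\<^sub>0)"
    proof (rule net_reg_bound[where k = "1 / (1 - (\<theta>\<^sub>3 - \<theta>\<^sub>1))"])
      fix T :: nat
      have "?c * trigger_sum T \<le> ?c * (real T powr (1 - (\<theta>\<^sub>3 - \<theta>\<^sub>1)) / (1 - (\<theta>\<^sub>3 - \<theta>\<^sub>1)))"
        unfolding trig using \<theta> c by (intro mult_left_mono sum_powr_le) auto
      also have "\<dots> = 1 / (1 - (\<theta>\<^sub>3 - \<theta>\<^sub>1)) * (0 + ?c * real T powr (1 + \<theta>\<^sub>1 - \<theta>\<^sub>3))"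
        by (simp add: algebra_simps)
      also have "\<dots> \<le> 1 / (1 - (\<theta>\<^sub>3 - \<theta>\<^sub>1)) * (real T powr \<theta>\<^sub>2 + ?c * real T powr (1 + \<theta>\<^sub>1 - \<theta>\<^sub>3))"
        using \<theta> by (intro mult_left_mono add_right_mono) auto
      finally show "?c * trigger_sum T \<le> 1 / (1 - (\<theta>\<^sub>3 - \<theta>\<^sub>1)) * (real T powr \<theta>\<^sub>2 + ?c * real T powr (1 + \<theta>\<^sub>1 - \<theta>\<^sub>3))" .
    qed (use \<theta> \<tau>\<^sub>0 \<alpha>\<^sub>0 in auto)
  next
    assume \<theta>: "\<theta>\<^sub>3 = 1 + \<theta>\<^sub>1"
    show "\<exists>C>0. \<forall>T\<ge>1. \<forall>y\<in>feasible_seqs X m g T. expectation (\<lambda>\<omega>. net_reg f T (x \<omega>) y) \<le>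
            C * (\<alpha>\<^sub>0 * real T powr (1 - \<theta>\<^sub>1) + real T powr \<theta>\<^sub>2 + ?c * ln (real T)
                 + real T powr \<theta>\<^sub>1 * (1 + path_length y T) / \<alpha>\<^sub>0)"
    proof (rule net_reg_bound[where k = "1 + ?c"])
      fix T :: nat assume T: "T \<ge> 1"
      have l0: "0 \<le> ?c * ln (real T)" using c T by (intro mult_nonneg_nonneg) auto
      then show "0 \<le> ?c * ln (real T)" .
      \<comment> \<open>The leading 1 of the harmonic bound is charged to
        \<open>T powr \<theta>\<^sub>2\<close>, since the logarithm vanishes at
        \<open>T = 1\<close>; hence the constant \<open>1 + ?c\<close>.\<close>
      have "trigger_sum T \<le> 1 + ln (real T)"
        unfolding trig using sum_inverse_le[OF T] by (simp add: \<theta> powr_minus divide_inverse)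
      then have "?c * trigger_sum T \<le> ?c * (1 + ln (real T))" using c by (rule mult_left_mono)
      also have "\<dots> \<le> ?c * real T powr \<theta>\<^sub>2 + ?c * ln (real T)"
        using mult_left_mono[OF b1[OF T] c] by (simp add: distrib_left)
      also have "\<dots> \<le> (1 + ?c) * (real T powr \<theta>\<^sub>2 + ?c * ln (real T))"
      proof -
        have "a * b + l \<le> (1 + a) * (b + l)" if "0 \<le> a" "0 \<le> b" "0 \<le> l" for a b l :: real
          using that by (simp add: distrib_left distrib_right)
        from this[OF c _ l0] show ?thesis by simp
      qed
      finally show "?c * trigger_sum T \<le> (1 + ?c) * (real T powr \<theta>\<^sub>2 + ?c * ln (real T))" .
    qed (use c in auto)
  next
    assume \<theta>: "\<theta>\<^sub>3 > 1 + \<theta>\<^sub>1"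
    then obtain C where C: "C \<ge> 0" "\<And>T. (\<Sum>t=1..T. real t powr - (\<theta>\<^sub>3 - \<theta>\<^sub>1)) \<le> C"
      using sum_powr_bounded[of "\<theta>\<^sub>3 - \<theta>\<^sub>1"] by auto
    show "\<exists>C>0. \<forall>T\<ge>1. \<forall>y\<in>feasible_seqs X m g T. expectation (\<lambda>\<omega>. net_reg f T (x \<omega>) y) \<le>
            C * (\<alpha>\<^sub>0 * real T powr (1 - \<theta>\<^sub>1) + real T powr \<theta>\<^sub>2 + ?c
                 + real T powr \<theta>\<^sub>1 * (1 + path_length y T) / \<alpha>\<^sub>0)"
    proof (rule net_reg_bound[where k = C])
      fix T :: nat
      have "?c * trigger_sum T \<le> C * (0 + ?c)"
        using mult_left_mono[OF C(2)[of T] c] by (simp add: trig mult.commute)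
      also have "\<dots> \<le> C * (real T powr \<theta>\<^sub>2 + ?c)" using C(1) by (intro mult_left_mono add_right_mono) auto
      finally show "?c * trigger_sum T \<le> C * (real T powr \<theta>\<^sub>2 + ?c)" .
    qed (use C c in auto)
  next
    assume \<theta>: "\<theta>\<^sub>1 < \<theta>\<^sub>3 \<and> \<theta>\<^sub>3 < 1"
    show "\<exists>C>0. \<forall>T\<ge>1. expectation (\<lambda>\<omega>. net_ccv m g T (x \<omega>)) \<le>
            C * (sqrt \<alpha>\<^sub>0 * real T powr (1 - \<theta>\<^sub>1 / 2) + real T powr (1 - \<theta>\<^sub>2 / 2)
                 + sqrt \<tau>\<^sub>0 * real T powr (1 - \<theta>\<^sub>3 / 2))"
    proof (rule net_ccv_bound[where k = "sqrt \<tau>\<^sub>0 / (1 - \<theta>\<^sub>3)"])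
      fix T :: nat assume T: "T \<ge> 1"
      have "(\<Sum>t=1..T. \<tau> t) \<le> \<tau>\<^sub>0 * (real T powr (1 - \<theta>\<^sub>3) / (1 - \<theta>\<^sub>3))"
        unfolding sum_\<tau>_eq using \<theta> \<theta>\<^sub>3 \<tau>\<^sub>0 by (intro mult_left_mono sum_powr_le) auto
      also have "\<dots> \<le> \<tau>\<^sub>0 * (real T powr (1 - \<theta>\<^sub>3 / 2) / (1 - \<theta>\<^sub>3))"
        using \<theta> \<theta>\<^sub>3 \<tau>\<^sub>0 T by (intro mult_left_mono divide_right_mono powr_mono) auto
      \<comment> \<open>One square root of \<open>\<tau>\<^sub>0\<close> goes into the constant, the
        other is the one displayed in the rate.\<close>
      also have "\<dots> = sqrt \<tau>\<^sub>0 / (1 - \<theta>\<^sub>3) * (0 + sqrt \<tau>\<^sub>0 * real T powr (1 - \<theta>\<^sub>3 / 2))"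
        using \<tau>\<^sub>0 by simp
      also have "\<dots> \<le> sqrt \<tau>\<^sub>0 / (1 - \<theta>\<^sub>3) * (real T powr (1 - \<theta>\<^sub>2 / 2) + sqrt \<tau>\<^sub>0 * real T powr (1 - \<theta>\<^sub>3 / 2))"
        using \<theta> \<tau>\<^sub>0 by (intro mult_left_mono add_right_mono) auto
      finally show "(\<Sum>t=1..T. \<tau> t) \<le> sqrt \<tau>\<^sub>0 / (1 - \<theta>\<^sub>3) * (real T powr (1 - \<theta>\<^sub>2 / 2) + sqrt \<tau>\<^sub>0 * real T powr (1 - \<theta>\<^sub>3 / 2))" .
    qed (use \<theta> \<tau>\<^sub>0 in auto)
  next
    assume \<theta>: "\<theta>\<^sub>3 = 1"
    show "\<exists>C>0. \<forall>T\<ge>1. expectation (\<lambda>\<omega>. net_ccv m g T (x \<omega>)) \<le> C * (sqrt \<alpha>\<^sub>0 * real T powr (1 - \<theta>\<^sub>1 / 2)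
            + real T powr (1 - \<theta>\<^sub>2 / 2) + sqrt (\<tau>\<^sub>0 * real T * ln (real T)))"
      using ccv[of "\<lambda>T. sqrt (\<tau>\<^sub>0 * real T * ln (real T))"] \<tau>\<^sub>0 \<theta> by simp
  next
    assume \<theta>: "\<theta>\<^sub>3 > 1"
    show "\<exists>C>0. \<forall>T\<ge>1. expectation (\<lambda>\<omega>. net_ccv m g T (x \<omega>)) \<le> C * (sqrt \<alpha>\<^sub>0 * real T powr (1 - \<theta>\<^sub>1 / 2)
            + real T powr (1 - \<theta>\<^sub>2 / 2) + sqrt (\<tau>\<^sub>0 * real T))"
      using ccv[of "\<lambda>T. sqrt (\<tau>\<^sub>0 * real T)"] \<tau>\<^sub>0 \<theta> by simp
  qed (use net_reg_integrable net_ccv_integrable in auto)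
qed

end
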